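(* Let $n\ge4$, let $B=B^{n+1}\subset\mathbb{R}^{n+1}$ be the closed unit ball with Euclidean metric $dx^2$, and let $$\mathcal{C}_1=\{u\in C^\infty(B) : u>0,\ \sigma_1(u)\ge0\text{ in }B,\ H(u)>0\text{ on }\partial B\}.$$ Then $$\inf\left\{\mathcal{E}_2(u) : u\in\mathcal{C}_1,\ \oint_{\partial B}|u|^{\frac{4n}{n-3}}=1\right\}>0.$$
   Context: $C^\infty(B)$ denotes functions smooth up to the boundary; integrals are with respect to the Euclidean volume on $B$ and the induced measure on $\partial B=S^n$; $\eta$ is the outward unit normal; $\overline{\nabla},\overline{\Delta}$ are the gradient and Laplacian of the round metric on $S^n$. Define $$\sigma_1(u)=-\tfrac{n-3}{4}u\Delta u-\tfrac{n+1}{4}|\nabla u|^2,\qquad H(u)=\eta u+\tfrac{n-3}{4}u .$$ For a Riemannian metric $g$ on $B$ the Schouten tensor is $P=\frac{1}{n-1}\left(\mathrm{Ric}-\frac{R}{2n}g\right)$, with trace $J=\frac{R}{2n}$; $\sigma_2^g=\frac12(J^2-|P|^2)$; the mean curvature is $H^g=\frac1n\mathrm{tr}_{\iota^*g}\nabla\eta$ with $\eta$ the outward unit normal; and, for umbilic boundary, $H_2^g=H^g\,\mathrm{tr}_{\iota^*g}(P|_{T\partial B})+\frac n3(H^g)^3$. For $u>0$ put $g_u=u^{\frac{8}{n-3}}dx^2$ and $$L_4(u)=\left(\tfrac{n-3}{4}u\right)^3u^{\frac{16}{n-3}}\sigma_2^{g_u},\qquad B_3(u)=\left(\tfrac{n-3}{4}u\right)^3u^{\frac{12}{n-3}}H_2^{g_u}.$$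 These are homogeneous cubic polynomials in the 2-jet of $u$, and $L_4(u,v,w)$, $B_3(u,v,w)$ denote the symmetric trilinear polarizations, with $L_4(u,u,u)=L_4(u)$ and $B_3(u,u,u)=B_3(u)$. Finally $$\mathcal{E}_2(u)=\int_B u\,L_4(u,u,u)+\oint_{\partial B}u\,B_3(u,u,u);$$ for $u>0$ this equals $\left(\frac{n-3}{4}\right)^3\left[\int_B\sigma_2^{g_u}\,\mathrm{dvol}_{g_u}+\oint_{\partial B}H_2^{g_u}\,\mathrm{dvol}_{\iota^*g_u}\right]$. *)

theory Defs
  imports "HOL-Analysis.Analysis"
begin

text \<open>The ambient space is \<open>real ^ 'm\<close> with \<open>CARD('m) = n + 1\<close>; \<open>B\<close> is \<open>cball 0 1\<close>
  and its boundary is \<open>sphere 0 1\<close>.\<close>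

abbreviation (input) bdim :: "'m::finite itself \<Rightarrow> real" where
  "bdim _ \<equiv> real CARD('m) - 1"


subsection \<open>Smooth functions\<close>

definition partial_deriv :: "'m \<Rightarrow> (real ^ 'm \<Rightarrow> real) \<Rightarrow> real ^ 'm::finite \<Rightarrow> real" where
  "partial_deriv i f x = frechet_derivative f (at x) (axis i 1)"

text \<open>For open \<open>U\<close>, differentiability of all iterated partial derivatives is the same as
  \<open>C\<^sup>\<infinity>\<close>, since differentiability makes each of them continuous.\<close>

definition smooth_on :: "(real ^ 'm::finite) set \<Rightarrow> (real ^ 'm \<Rightarrow> real) \<Rightarrow> bool" where
  "smooth_on U f \<longleftrightarrow> (\<forall>is. foldr partial_deriv is f differentiable_on U)"

text \<open>\<open>C\<^sup>\<infinity>(B)\<close>: an element is represented by a function on the whole space that is smooth on some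
  open neighbourhood of the closed ball. Everything below only evaluates \<open>u\<close> and its derivatives
  at points of the closed ball, where by continuity they are determined by the values of \<open>u\<close> on
  the ball; the choice of smooth extension is therefore irrelevant.\<close>

definition smooth_ball :: "(real ^ 'm::finite \<Rightarrow> real) set" where
  "smooth_ball = {u. \<exists>U. open U \<and> cball 0 1 \<subseteq> U \<and> smooth_on U u}"


subsection \<open>Integration over the unit sphere\<close>

text \<open>The measure induced on the unit sphere by the Euclidean metric, as a Borel measure on the
  ambient space that is concentrated on the sphere: in polar coordinates
  \<open>dx = r\<^sup>n dr d\<omega>\<close>, the measure of \<open>A\<close> is \<open>n + 1\<close> times the volume of the cone over \<open>A\<close>.\<close>

definition sphere_measure :: "(real ^ 'm::finite) measure" where
  "sphere_measure = scale_measure (of_nat CARD('m))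
     (distr (restrict_space lborel (ball 0 1 - {0})) borel (\<lambda>x. x /\<^sub>R norm x))"


subsection \<open>Riemannian metrics in Cartesian coordinates\<close>

text \<open>A metric is given by its matrix \<open>g x $ i $ j\<close> of coefficients; vector fields by their
  components. The inverse matrix has the entries \<open>g\<^sup>i\<^sup>j\<close>.\<close>

type_synonym 'm metric_field = "real ^ 'm \<Rightarrow> real ^ 'm ^ 'm"

definition christoffel ::
    "'m::finite metric_field \<Rightarrow> 'm \<Rightarrow> 'm \<Rightarrow> 'm \<Rightarrow> real ^ 'm \<Rightarrow> real" where \<comment> \<open>\<open>\<Gamma>\<^sup>k\<^sub>i\<^sub>j\<close>\<close>
  "christoffel g k i j x = (\<Sum>l\<in>UNIV. matrix_inv (g x) $ k $ l *
      (partial_deriv i (\<lambda>y. g y $ j $ l) x + partial_deriv j (\<lambda>y. g y $ i $ l) x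
        - partial_deriv l (\<lambda>y. g y $ i $ j) x)) / 2"

text \<open>Sign convention: round spheres have positive Ricci curvature.\<close>

definition ricci :: "'m::finite metric_field \<Rightarrow> 'm metric_field" where
  "ricci g x = (\<chi> j k.
      (\<Sum>i\<in>UNIV. partial_deriv i (christoffel g i j k) x - partial_deriv j (christoffel g i i k) x)
    + (\<Sum>i\<in>UNIV. \<Sum>p\<in>UNIV. christoffel g i i p x * christoffel g p j k x
                        - christoffel g i j p x * christoffel g p i k x))"

definition scalar_curvature :: "'m::finite metric_field \<Rightarrow> real ^ 'm \<Rightarrow> real" where
  "scalar_curvature g x = (\<Sum>i\<in>UNIV. \<Sum>j\<in>UNIV. matrix_inv (g x) $ i $ j * ricci g x $ i $ j)"

definition schouten :: "'m::finite metric_field \<Rightarrow> 'm metric_field" where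
  "schouten g x = (1 / (bdim TYPE('m) - 1)) *\<^sub>R
     (ricci g x - (scalar_curvature g x / (2 * bdim TYPE('m))) *\<^sub>R g x)"

definition schouten_trace :: "'m::finite metric_field \<Rightarrow> real ^ 'm \<Rightarrow> real" where
  "schouten_trace g x = scalar_curvature g x / (2 * bdim TYPE('m))"

definition schouten_norm_sq :: "'m::finite metric_field \<Rightarrow> real ^ 'm \<Rightarrow> real" where
  "schouten_norm_sq g x = (\<Sum>i\<in>UNIV. \<Sum>j\<in>UNIV. \<Sum>k\<in>UNIV. \<Sum>l\<in>UNIV.
     matrix_inv (g x) $ i $ k * matrix_inv (g x) $ j $ l * schouten g x $ i $ j * schouten g x $ k $ l)"

definition sigma2 :: "'m::finite metric_field \<Rightarrow> real ^ 'm \<Rightarrow> real" where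
  "sigma2 g x = ((schouten_trace g x)\<^sup>2 - schouten_norm_sq g x) / 2"


subsection \<open>Boundary geometry of the ball\<close>

text \<open>The outward unit normal of a metric \<open>g\<close>, extended off the boundary by the unit normals of the
  spheres \<open>norm x = r\<close>: it is the normalised \<open>g\<close>-gradient of \<open>(norm x)\<^sup>2 / 2\<close>, whose
  differential has components \<open>x $ i\<close>. The extension does not affect the mean curvature, which only
  involves tangential derivatives.\<close>

definition outward_normal :: "'m::finite metric_field \<Rightarrow> real ^ 'm \<Rightarrow> real ^ 'm" where
  "outward_normal g x =
     (matrix_inv (g x) *v x) /\<^sub>R sqrt (x \<bullet> (matrix_inv (g x) *v x))"

definition cov_deriv ::
    "'m::finite metric_field \<Rightarrow> 'm \<Rightarrow> (real ^ 'm \<Rightarrow> real ^ 'm) \<Rightarrow> real ^ 'm \<Rightarrow> real ^ 'm" where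
  "cov_deriv g i V x =
     (\<chi> k. partial_deriv i (\<lambda>y. V y $ k) x + (\<Sum>j\<in>UNIV. christoffel g k i j x * V x $ j))"

text \<open>Trace, with respect to the induced metric, of the restriction of a bilinear form \<open>b\<close> to the
  tangent space of the boundary. Completing an orthonormal frame of the tangent space by the unit
  normal \<open>\<eta>\<close> shows that it is the full trace minus \<open>b(\<eta>, \<eta>)\<close>.\<close>

definition bdry_trace :: "'m::finite metric_field \<Rightarrow> real ^ 'm \<Rightarrow> real ^ 'm ^ 'm \<Rightarrow> real" where
  "bdry_trace g x b = (\<Sum>i\<in>UNIV. \<Sum>j\<in>UNIV.
     (matrix_inv (g x) $ i $ j - outward_normal g x $ i * outward_normal g x $ j) * b $ i $ j)"

definition mean_curvature :: "'m::finite metric_field \<Rightarrow> real ^ 'm \<Rightarrow> real" where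
  "mean_curvature g x = bdry_trace g x
     (\<chi> i j. \<Sum>k\<in>UNIV. g x $ j $ k * cov_deriv g i (outward_normal g) x $ k) / bdim TYPE('m)"

definition H2 :: "'m::finite metric_field \<Rightarrow> real ^ 'm \<Rightarrow> real" where
  "H2 g x = mean_curvature g x * bdry_trace g x (schouten g x)
     + bdim TYPE('m) / 3 * mean_curvature g x ^ 3"


subsection \<open>The conformally invariant energy\<close>

definition conf_metric :: "(real ^ 'm \<Rightarrow> real) \<Rightarrow> 'm::finite metric_field" where
  "conf_metric u x = (u x powr (8 / (bdim TYPE('m) - 3))) *\<^sub>R mat 1"

definition L4 :: "(real ^ 'm::finite \<Rightarrow> real) \<Rightarrow> real ^ 'm \<Rightarrow> real" where
  "L4 u x = ((bdim TYPE('m) - 3) / 4 * u x) ^ 3 * u x powr (16 / (bdim TYPE('m) - 3))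
     * sigma2 (conf_metric u) x"

definition B3 :: "(real ^ 'm::finite \<Rightarrow> real) \<Rightarrow> real ^ 'm \<Rightarrow> real" where
  "B3 u x = ((bdim TYPE('m) - 3) / 4 * u x) ^ 3 * u x powr (12 / (bdim TYPE('m) - 3))
     * H2 (conf_metric u) x"

text \<open>Meaningful for \<open>u > 0\<close> on the closed ball. The polarizations of the cubic forms \<open>L4\<close>, \<open>B3\<close>
  enter the energy only on the diagonal, where \<open>L4(u,u,u) = L4(u)\<close> and \<open>B3(u,u,u) = B3(u)\<close>.\<close>

definition E2 :: "(real ^ 'm::finite \<Rightarrow> real) \<Rightarrow> real" where
  "E2 u = (LINT x:cball 0 1|lborel. u x * L4 u x) + (LINT x|sphere_measure. u x * B3 u x)"


subsection \<open>The admissible cone\<close>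

definition laplacian :: "(real ^ 'm::finite \<Rightarrow> real) \<Rightarrow> real ^ 'm \<Rightarrow> real" where
  "laplacian u x = (\<Sum>i\<in>UNIV. partial_deriv i (partial_deriv i u) x)"

definition gradient :: "(real ^ 'm::finite \<Rightarrow> real) \<Rightarrow> real ^ 'm \<Rightarrow> real ^ 'm" where
  "gradient u x = (\<chi> i. partial_deriv i u x)"

definition sigma1_op :: "(real ^ 'm::finite \<Rightarrow> real) \<Rightarrow> real ^ 'm \<Rightarrow> real" where
  "sigma1_op u x = - (bdim TYPE('m) - 3) / 4 * u x * laplacian u x
     - (bdim TYPE('m) + 1) / 4 * (norm (gradient u x))\<^sup>2"

text \<open>At a point \<open>x\<close> of the unit sphere the Euclidean outward unit normal is \<open>x\<close>.\<close>

definition H_op :: "(real ^ 'm::finite \<Rightarrow> real) \<Rightarrow> real ^ 'm \<Rightarrow> real" where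
  "H_op u x = frechet_derivative u (at x) x + (bdim TYPE('m) - 3) / 4 * u x"

definition C1 :: "(real ^ 'm::finite \<Rightarrow> real) set" where
  "C1 = {u \<in> smooth_ball. (\<forall>x\<in>cball 0 1. u x > 0 \<and> sigma1_op u x \<ge> 0)
                        \<and> (\<forall>x\<in>sphere 0 1. H_op u x > 0)}"

end

theory Submission
  imports Defs "HOL-Real_Asymp.Real_Asymp"
begin

text \<open>Put \<open>c = 4 / (n - 3)\<close>, \<open>s = u / c\<close>, and on the sphere \<open>H = H(u)\<close>. Writing out the curvatures of
  \<open>g\<^sub>u\<close> and integrating by parts (in the ball, and tangentially on the sphere) turns \<open>E\<^sub>2(u)\<close> into the
  sum of the integral of \<open>\<sigma>\<^sub>1(u) |\<nabla>u|\<^sup>2 + |\<nabla>u|\<^sup>4 / 2\<close> over the ball and the integral of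
  \<open>(s H + s\<^sup>2) |\<nabla>\<^sub>S u|\<^sup>2 + s (H\<^sup>3/3 - s H\<^sup>2 + s\<^sup>2 H) + (c + 1) s\<^sup>4\<close> over the sphere, where \<open>\<nabla>\<^sub>S\<close> is the
  tangential gradient. On the cone \<open>C1\<close> every term is nonnegative, since \<open>H\<^sup>2/3 - s H + s\<^sup>2 > 0\<close>. So \<open>E\<^sub>2(u)\<close>
  controls the integral of \<open>|\<nabla>u|\<^sup>4\<close> over the ball plus that of \<open>u\<^sup>4\<close> over the sphere, and the claim is the
  critical trace embedding of \<open>W\<^sup>1\<^sup>,\<^sup>4\<close> into \<open>L\<^sup>q\<close> of the sphere, \<open>q = 4n/(n - 3) = 3c + 4\<close>. The latter follows from
  the divergence theorem and the Gagliardo-Nirenberg inequality, applied to \<open>u\<^sup>q\<close> extended by zero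
  outside the ball.\<close>

subsection \<open>Partial derivatives\<close>

text \<open>Elements of \<open>C1\<close> are controlled only near the closed ball, while
  \<open>sphere_measure\<close> lives on the Borel sets of the whole space and a non-measurable
  integrand has integral 0 by default. The normalisation resolves this: an integral equal to 1
  forces \<open>\<bar>u\<bar> powr q\<close>, hence \<open>\<bar>u\<bar>\<close>, to be Borel, and
  the curvature integrand follows because partial derivatives of arbitrary functions are Borel. As
  the surface measure is defined through cones, boundary integrals arise as limits of integrals over
  thin shells, namely those on which a cutoff that is affine in the squared norm decreases. The
  embedding is critical, so the constant comes from absorption. With \<open>d = CARD('m)\<close>,
  let Y be the integral of \<open>u powr (4 * c + 4)\<close> over the ball. The gradient of u^q has
  L1 norm of order Y^(3/4) as long as the integral of |\<nabla>u|^4 is bounded, and the Sobolev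
  inequality bounds Y by a power d/(d - 1) of that; since d \<ge> 5, the total exponent is at most
  15/16.\<close>

lemma partial_deriv_eq:
  "(f has_derivative f') (at x) \<Longrightarrow> partial_deriv i f x = f' (axis i 1)"
  unfolding partial_deriv_def by (metis frechet_derivative_at)

lemma has_derivative_partial_deriv:
  fixes f :: "real ^ 'm::finite \<Rightarrow> real"
  assumes "f differentiable (at x)"
  shows "(f has_derivative (\<lambda>h. (\<chi> i. partial_deriv i f x) \<bullet> h)) (at x)"
proof -
  let ?D = "frechet_derivative f (at x)"
  have D: "(f has_derivative ?D) (at x)"
    using assms frechet_derivative_works by blast
  interpret bounded_linear ?D
    using D by (rule has_derivative_bounded_linear)
  have "?D h = (\<chi> i. partial_deriv i f x) \<bullet> h" for h
  proof -
    have "?D h = ?D (\<Sum>i\<in>UNIV. h $ i *\<^sub>R axis i 1)"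
      by (simp add: basis_expansion scalar_mult_eq_scaleR[symmetric])
    also have "\<dots> = (\<Sum>i\<in>UNIV. h $ i * partial_deriv i f x)"
      by (simp add: sum scaleR partial_deriv_def)
    finally show ?thesis
      by (simp add: inner_vec_def mult.commute)
  qed
  with D show ?thesis
    by (metis (no_types, lifting) ext)
qed

section \<open>Borel measurability of the partial derivatives of an arbitrary function\<close>

lemma closed_uniform_affine_approximation:
  fixes f :: "'a::euclidean_space \<Rightarrow> real"
  assumes "d > 0"
  shows "closed {x. \<forall>y. norm (y - x) < d \<longrightarrow> \<bar>f y - f x - a \<bullet> (y - x)\<bar> \<le> e * norm (y - x)}"
  unfolding closed_sequential_limits
proof safe
  fix X x y
  assume X: "\<forall>k. X k \<in> {x. \<forall>y. norm (y - x) < d \<longrightarrow> \<bar>f y - f x - a \<bullet> (y - x)\<bar> \<le> e * norm (y - x)}"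
    and lim: "X \<longlonglongrightarrow> x" and y: "norm (y - x) < d"
  have near: "\<forall>\<^sub>F k in sequentially. \<bar>f z - f (X k) - a \<bullet> (z - X k)\<bar> \<le> e * norm (z - X k)"
    if "norm (z - x) < d" for z
  proof -
    have "(\<lambda>k. norm (z - X k)) \<longlonglongrightarrow> norm (z - x)"
      by (intro tendsto_intros lim)
    then have "\<forall>\<^sub>F k in sequentially. norm (z - X k) < d"
      using that by (rule order_tendstoD)
    then show ?thesis
      by eventually_elim (use X in blast)
  qed
  \<comment> \<open>No continuity of \<open>f\<close> is available. The estimate centred at
    \<open>X k\<close>, evaluated at the limit point \<open>x\<close> itself, forces
    \<open>f (X k)\<close> to converge to \<open>f x\<close>; after that the estimates at any
    \<open>y\<close> pass to the limit.\<close>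
  have "(\<lambda>k. (f x - f (X k) - a \<bullet> (x - X k)) + a \<bullet> (x - X k)) \<longlonglongrightarrow> 0 + a \<bullet> (x - x)"
  proof (intro tendsto_add tendsto_inner tendsto_diff tendsto_const lim)
    have "(\<lambda>k. e * norm (x - X k)) \<longlonglongrightarrow> e * norm (x - x)"
      by (intro tendsto_intros lim)
    then have "(\<lambda>k. e * norm (x - X k)) \<longlonglongrightarrow> 0"
      by simp
    moreover have "\<forall>\<^sub>F k in sequentially. norm (f x - f (X k) - a \<bullet> (x - X k)) \<le> e * norm (x - X k)"
      using near[of x] \<open>d > 0\<close> by simp
    ultimately show "(\<lambda>k. f x - f (X k) - a \<bullet> (x - X k)) \<longlonglongrightarrow> 0"
      by (rule Lim_null_comparison[rotated])
  qed
  then have "(\<lambda>k. f x - f (X k)) \<longlonglongrightarrow> 0"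
    by simp
  then have fX: "(\<lambda>k. f (X k)) \<longlonglongrightarrow> f x"
    using tendsto_diff[OF tendsto_const[of "f x"], of "\<lambda>k. f x - f (X k)" 0] by simp
  show "\<bar>f y - f x - a \<bullet> (y - x)\<bar> \<le> e * norm (y - x)"
    by (rule tendsto_le[OF _ _ _ near[OF y]]) (auto intro!: tendsto_intros lim fX)
qed

lemma has_derivative_real_iff:
  fixes f :: "'a::euclidean_space \<Rightarrow> real"
  shows "(f has_derivative (\<lambda>h. a \<bullet> h)) (at x) \<longleftrightarrow>
    (\<forall>e>0. \<exists>d>0. \<forall>y. norm (y - x) < d \<longrightarrow> \<bar>f y - f x - a \<bullet> (y - x)\<bar> \<le> e * norm (y - x))"
  unfolding has_derivative_at_alt by (auto simp: bounded_linear_inner_right)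

text \<open>Test both estimates on a short step in the direction \<open>a - b\<close>, where the two
  linear parts differ as much as Cauchy-Schwarz allows.\<close>

lemma linear_approximations_close:
  fixes f :: "'a::euclidean_space \<Rightarrow> real"
  assumes a: "\<And>y. norm (y - x) < d \<Longrightarrow> \<bar>f y - f x - a \<bullet> (y - x)\<bar> \<le> e * norm (y - x)" "d > 0"
    and b: "\<And>y. norm (y - x) < d' \<Longrightarrow> \<bar>f y - f x - b \<bullet> (y - x)\<bar> \<le> e' * norm (y - x)" "d' > 0"
    and e: "e \<ge> 0" "e' \<ge> 0"
  shows "norm (a - b) \<le> e + e'"
proof (cases "a = b")
  case False
  define t where "t = min d d' / (2 * norm (a - b))"
  define y where "y = x + t *\<^sub>R (a - b)"
  have t: "t > 0" using a(2) b(2) False by (simp add: t_def)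
  have "norm (y - x) = min d d' / 2"
    using False a(2) b(2) by (simp add: y_def t_def)
  then have "norm (y - x) < d" "norm (y - x) < d'"
    using a(2) b(2) by auto
  then have "\<bar>(a - b) \<bullet> (y - x)\<bar> \<le> (e + e') * norm (y - x)"
    using a(1)[of y] b(1)[of y] by (simp add: inner_diff_left algebra_simps)
  then have "t * (norm (a - b) * norm (a - b)) \<le> t * ((e + e') * norm (a - b))"
    using t by (simp add: y_def dot_square_norm power2_eq_square abs_mult mult_ac)
  then show ?thesis
    using t False by simp
qed (use e in simp)

text \<open>The function \<open>f\<close> need not be measurable: where its difference quotients are uniformly
  controlled it is automatically continuous, so the sets involved are closed.\<close>

lemma borel_measurable_partial_deriv [measurable]:
  fixes f :: "real ^ 'm::finite \<Rightarrow> real"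
  shows "partial_deriv i f \<in> borel_measurable borel"
proof -
  define S where "S a e d =
    {x. \<forall>y. norm (y - x) < d \<longrightarrow> \<bar>f y - f x - a \<bullet> (y - x)\<bar> \<le> e * norm (y - x)}" for a e d
  define \<epsilon> :: "nat \<Rightarrow> real" where "\<epsilon> j = 1 / (real j + 1)" for j
  have \<epsilon>: "\<epsilon> j > 0" for j by (simp add: \<epsilon>_def)
  have \<epsilon>_lim: "\<epsilon> \<longlonglongrightarrow> 0"
    unfolding \<epsilon>_def using LIMSEQ_inverse_real_of_nat by (simp add: inverse_eq_divide add.commute)
  have small: "\<exists>j. \<epsilon> j < e" if "e > 0" for e
    using order_tendstoD(2)[OF \<epsilon>_lim that] by (auto simp: eventually_sequentially)
  obtain D :: "(real ^ 'm) set" where D: "countable D" "\<And>X. open X \<Longrightarrow> X \<noteq> {} \<Longrightarrow> \<exists>d\<in>D. d \<in> X"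
    by (meson countable_dense_setE)
  \<comment> \<open>\<open>P\<close> will be the set of differentiability points and
    \<open>Q t\<close> the part of it where the partial derivative is at most \<open>t\<close>.
    Slopes come from a countable dense set and radii from the sequence \<open>\<epsilon>\<close>, so
    both are countable combinations of the closed sets \<open>S\<close>.\<close>
  define P where "P = (\<Inter>j. \<Union>a\<in>D. \<Union>k. S a (\<epsilon> j) (\<epsilon> k))"
  define Q where "Q t = (\<Inter>j. \<Union>a\<in>{a \<in> D. a $ i \<le> t + \<epsilon> j}. \<Union>k. S a (\<epsilon> j) (\<epsilon> k))" for t
  have S_borel: "S a e d \<in> sets borel" if "d > 0" for a e d
    using closed_uniform_affine_approximation[OF that, of f a e] unfolding S_def
    by (rule borel_closed)
  have PQ [measurable]: "P \<in> sets borel" "Q t \<in> sets borel" for t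
    unfolding P_def Q_def using D(1)
    by (intro sets.countable_INT sets.countable_UN'' S_borel \<epsilon>;
        auto intro!: sets.countable_UN'' sets.countable_UN S_borel \<epsilon>)+
  have approx: "\<exists>a\<in>D. norm (a - A) < \<epsilon> j / 2 \<and> (\<exists>k. x \<in> S a (\<epsilon> j) (\<epsilon> k))"
    if hd: "(f has_derivative (\<lambda>h. A \<bullet> h)) (at x)" for A x j
  proof -
    obtain a where a: "a \<in> D" "a \<in> ball A (\<epsilon> j / 2)"
      using D(2)[OF open_ball, of A "\<epsilon> j / 2"] \<epsilon>[of j] by (metis centre_in_ball empty_iff half_gt_zero)
    obtain d where d: "d > 0" "\<And>y. norm (y - x) < d \<Longrightarrow> \<bar>f y - f x - A \<bullet> (y - x)\<bar> \<le> \<epsilon> j / 2 * norm (y - x)"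
      using hd \<epsilon>[of j] unfolding has_derivative_real_iff by (meson half_gt_zero)
    obtain k where k: "\<epsilon> k < d" using small d(1) by blast
    have "\<bar>f y - f x - a \<bullet> (y - x)\<bar> \<le> \<epsilon> j * norm (y - x)" if y: "norm (y - x) < \<epsilon> k" for y
    proof -
      have "\<bar>(A - a) \<bullet> (y - x)\<bar> \<le> norm (A - a) * norm (y - x)"
        by (rule Cauchy_Schwarz_ineq2)
      also have "\<dots> \<le> \<epsilon> j / 2 * norm (y - x)"
        using a(2) by (intro mult_right_mono) (auto simp: dist_norm)
      finally have "\<bar>A \<bullet> (y - x) - a \<bullet> (y - x)\<bar> \<le> \<epsilon> j / 2 * norm (y - x)"
        by (simp add: inner_diff_left)
      moreover have "\<bar>f y - f x - A \<bullet> (y - x)\<bar> \<le> \<epsilon> j / 2 * norm (y - x)"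
        using d(2)[of y] y k by linarith
      ultimately show ?thesis by linarith
    qed
    then have "x \<in> S a (\<epsilon> j) (\<epsilon> k)" by (simp add: S_def)
    with a show ?thesis by (auto simp: dist_norm norm_minus_commute)
  qed
  have PD: "x \<in> P \<longleftrightarrow> f differentiable (at x)" for x
  proof
    assume "f differentiable (at x)"
    from approx[OF has_derivative_partial_deriv[OF this]] show "x \<in> P"
      unfolding P_def by blast
  next
    assume "x \<in> P"
    then have "\<forall>j. \<exists>a k. x \<in> S a (\<epsilon> j) (\<epsilon> k)" unfolding P_def by blast
    then obtain a k where ak: "\<And>j. x \<in> S (a j) (\<epsilon> j) (\<epsilon> (k j))" by metis
    \<comment> \<open>The slopes found at different precisions may differ, but pairwise comparison
      makes them a Cauchy sequence, whose limit is the gradient.\<close>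
    have close: "norm (a j - a l) \<le> \<epsilon> j + \<epsilon> l" for j l
      using ak[of j] ak[of l] \<epsilon> unfolding S_def
      by (intro linear_approximations_close[where d="\<epsilon> (k j)" and d'="\<epsilon> (k l)" and f=f and x=x])
         (auto intro: less_imp_le)
    have "Cauchy a"
    proof (rule metric_CauchyI)
      fix e :: real assume "e > 0"
      then obtain M where M: "\<And>j. j \<ge> M \<Longrightarrow> \<epsilon> j < e / 2"
        using order_tendstoD(2)[OF \<epsilon>_lim, of "e / 2"] by (auto simp: eventually_sequentially)
      show "\<exists>M. \<forall>m\<ge>M. \<forall>n\<ge>M. dist (a m) (a n) < e"
        using M close by (intro exI[of _ M]) (smt (verit) dist_norm field_sum_of_halves)
    qed
    then obtain A where A: "a \<longlonglongrightarrow> A"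
      using Cauchy_convergent convergent_def by blast
    have aA: "norm (a j - A) \<le> \<epsilon> j" for j
    proof -
      have "(\<lambda>l. norm (a j - a l)) \<longlonglongrightarrow> norm (a j - A)" "(\<lambda>l. \<epsilon> j + \<epsilon> l) \<longlonglongrightarrow> \<epsilon> j + 0"
        by (intro tendsto_intros A \<epsilon>_lim)+
      then show ?thesis
        using close by (intro LIMSEQ_le[where X="\<lambda>l. norm (a j - a l)"]) auto
    qed
    have "(f has_derivative (\<lambda>h. A \<bullet> h)) (at x)"
      unfolding has_derivative_real_iff
    proof (intro allI impI)
      fix e :: real assume "e > 0"
      then obtain j where j: "\<epsilon> j < e / 2" using small[of "e / 2"] by auto
      show "\<exists>d>0. \<forall>y. norm (y - x) < d \<longrightarrow> \<bar>f y - f x - A \<bullet> (y - x)\<bar> \<le> e * norm (y - x)"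
      proof (intro exI[of _ "\<epsilon> (k j)"] conjI allI impI \<epsilon>)
        fix y assume y: "norm (y - x) < \<epsilon> (k j)"
        have "\<bar>(a j - A) \<bullet> (y - x)\<bar> \<le> norm (a j - A) * norm (y - x)"
          by (rule Cauchy_Schwarz_ineq2)
        also have "\<dots> \<le> \<epsilon> j * norm (y - x)"
          by (intro mult_right_mono aA) simp
        finally have 1: "\<bar>(a j - A) \<bullet> (y - x)\<bar> \<le> \<epsilon> j * norm (y - x)" .
        have 2: "\<bar>f y - f x - a j \<bullet> (y - x)\<bar> \<le> \<epsilon> j * norm (y - x)"
          using ak[of j] y by (simp add: S_def)
        have "2 * \<epsilon> j * norm (y - x) \<le> e * norm (y - x)"
          using j by (intro mult_right_mono) auto
        then show "\<bar>f y - f x - A \<bullet> (y - x)\<bar> \<le> e * norm (y - x)"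
          using 1 2 unfolding inner_diff_left by linarith
      qed
    qed
    then show "f differentiable (at x)" by (auto simp: differentiable_def)
  qed
  have QD: "x \<in> Q t \<longleftrightarrow> partial_deriv i f x \<le> t" if "x \<in> P" for x t
  proof -
    define A where "A = (\<chi> i. partial_deriv i f x)"
    have A: "(f has_derivative (\<lambda>h. A \<bullet> h)) (at x)"
      using that PD has_derivative_partial_deriv unfolding A_def by blast
    have Ai: "A $ i = partial_deriv i f x" by (simp add: A_def)
    show ?thesis
    proof
      assume "x \<in> Q t"
      show "partial_deriv i f x \<le> t"
      proof (rule field_le_epsilon)
        fix e :: real assume "e > 0"
        then obtain j where j: "\<epsilon> j < e / 3" using small[of "e / 3"] by auto
        obtain a k where a: "a $ i \<le> t + \<epsilon> j" "x \<in> S a (\<epsilon> j) (\<epsilon> k)"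
          using \<open>x \<in> Q t\<close> unfolding Q_def by blast
        obtain d where d: "d > 0" "\<And>y. norm (y - x) < d \<Longrightarrow> \<bar>f y - f x - A \<bullet> (y - x)\<bar> \<le> \<epsilon> j * norm (y - x)"
          using A \<epsilon> unfolding has_derivative_real_iff by meson
        have "norm (A - a) \<le> \<epsilon> j + \<epsilon> j"
          using d a(2) \<epsilon> unfolding S_def
          by (intro linear_approximations_close[where d=d and d'="\<epsilon> k" and f=f and x=x])
             (auto intro: less_imp_le)
        then have "\<bar>(A - a) $ i\<bar> \<le> 2 * \<epsilon> j"
          using component_le_norm_cart[of "A - a" i] by simp
        then show "partial_deriv i f x \<le> t + e"
          using a(1) j unfolding Ai[symmetric] by simp
      qed
    next
      assume t: "partial_deriv i f x \<le> t"
      have "\<exists>a\<in>{a \<in> D. a $ i \<le> t + \<epsilon> j}. x \<in> (\<Union>k. S a (\<epsilon> j) (\<epsilon> k))" for j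
      proof -
        obtain a k where a: "a \<in> D" "norm (a - A) < \<epsilon> j / 2" "x \<in> S a (\<epsilon> j) (\<epsilon> k)"
          using approx[OF A, of j] by blast
        have "\<bar>(a - A) $ i\<bar> \<le> \<epsilon> j"
          using component_le_norm_cart[of "a - A" i] a(2) by (smt (verit) field_sum_of_halves norm_ge_zero)
        then have "a $ i \<le> t + \<epsilon> j" using t unfolding Ai[symmetric] by simp
        with a show ?thesis by blast
      qed
      then show "x \<in> Q t" unfolding Q_def by blast
    qed
  qed
  \<comment> \<open>Where \<open>f\<close> is not differentiable, \<open>frechet_derivative\<close>
    is a choice from the empty predicate, which is the same at every such point. Hence the partial
    derivative is constant off \<open>P\<close>.\<close>
  define K where "K = (SOME f' :: real ^ 'm \<Rightarrow> real. False) (axis i 1)"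
  have nd: "partial_deriv i f x = K" if "x \<notin> P" for x
  proof -
    have "\<not> (f has_derivative f') (at x)" for f'
      using that PD by (auto simp: differentiable_def)
    then show ?thesis by (simp add: partial_deriv_def frechet_derivative_def K_def)
  qed
  have "x \<in> {x. partial_deriv i f x \<le> t} \<longleftrightarrow> x \<in> (P \<inter> Q t) \<union> (if K \<le> t then - P else {})" for x t
    using QD[of x t] nd[of x] by (cases "x \<in> P") auto
  then have "{x. partial_deriv i f x \<le> t} = (P \<inter> Q t) \<union> (if K \<le> t then - P else {})" for t
    by blast
  then have "{x \<in> space borel. partial_deriv i f x \<le> t} \<in> sets borel" for t
    using PQ by simp
  then show ?thesis
    unfolding borel_measurable_iff_le by blast
qed

section \<open>Calculus rules for partial derivatives\<close>

lemma partial_deriv_cong: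
  assumes "open U" "x \<in> U" "\<And>y. y \<in> U \<Longrightarrow> f y = g y"
  shows "partial_deriv i f x = partial_deriv i g x"
proof -
  have "(f has_derivative f') (at x) \<longleftrightarrow> (g has_derivative f') (at x)" for f'
    using assms has_derivative_transform_within_open[of f f' x UNIV U g]
      has_derivative_transform_within_open[of g f' x UNIV U f] by auto
  then show ?thesis by (simp add: partial_deriv_def frechet_derivative_def)
qed

lemma partial_deriv_const [simp]: "partial_deriv i (\<lambda>_. c) x = 0"
  by (rule partial_deriv_eq[OF has_derivative_const])

lemma partial_deriv_nth [simp]: "partial_deriv i (\<lambda>x. x $ j) x = (if i = j then 1 else 0)"
  by (subst partial_deriv_eq[where f'="\<lambda>h. h $ j"])
     (auto intro!: bounded_linear.has_derivative[OF bounded_linear_vec_nth] derivative_eq_intros simp: axis_def)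

context
  fixes f g :: "real ^ 'm::finite \<Rightarrow> real" and x
  assumes f: "f differentiable (at x)" and g: "g differentiable (at x)"
begin

lemma partial_deriv_add:
  "partial_deriv i (\<lambda>x. f x + g x) x = partial_deriv i f x + partial_deriv i g x"
  by (subst partial_deriv_eq[OF has_derivative_add[OF f[THEN has_derivative_partial_deriv] g[THEN has_derivative_partial_deriv]]])
     (simp add: inner_axis)

lemma partial_deriv_diff:
  "partial_deriv i (\<lambda>x. f x - g x) x = partial_deriv i f x - partial_deriv i g x"
  by (subst partial_deriv_eq[OF has_derivative_diff[OF f[THEN has_derivative_partial_deriv] g[THEN has_derivative_partial_deriv]]])
     (simp add: inner_axis)

lemma partial_deriv_mult:
  "partial_deriv i (\<lambda>x. f x * g x) x = partial_deriv i f x * g x + f x * partial_deriv i g x"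
  by (subst partial_deriv_eq[OF has_derivative_mult[OF f[THEN has_derivative_partial_deriv] g[THEN has_derivative_partial_deriv]]])
     (simp add: inner_axis mult_ac)

end

lemma partial_deriv_sum:
  fixes f :: "'i \<Rightarrow> real ^ 'm::finite \<Rightarrow> real"
  assumes "\<And>k. k \<in> K \<Longrightarrow> f k differentiable (at x)"
  shows "partial_deriv i (\<lambda>x. \<Sum>k\<in>K. f k x) x = (\<Sum>k\<in>K. partial_deriv i (f k) x)"
  by (subst partial_deriv_eq[OF has_derivative_sum[OF has_derivative_partial_deriv[OF assms]]])
     (auto simp: inner_axis)

lemma partial_deriv_cmult:
  fixes f :: "real ^ 'm::finite \<Rightarrow> real"
  assumes "f differentiable (at x)"
  shows "partial_deriv i (\<lambda>x. c * f x) x = c * partial_deriv i f x"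
  using partial_deriv_mult[OF _ assms, of "\<lambda>_. c"] by simp

lemma partial_deriv_chain:
  fixes f :: "real ^ 'm::finite \<Rightarrow> real"
  assumes f: "f differentiable (at x)" and G: "(G has_real_derivative G') (at (f x))"
  shows "partial_deriv i (\<lambda>x. G (f x)) x = G' * partial_deriv i f x"
    and "(\<lambda>x. G (f x)) differentiable (at x)"
proof -
  have "((\<lambda>x. G (f x)) has_derivative (\<lambda>h. ((\<chi> i. partial_deriv i f x) \<bullet> h) * G')) (at x)"
    using G[THEN DERIV_compose_FDERIV[OF _ has_derivative_partial_deriv[OF f]]] by (simp add: o_def)
  then show "partial_deriv i (\<lambda>x. G (f x)) x = G' * partial_deriv i f x"
    and "(\<lambda>x. G (f x)) differentiable (at x)"
    by (auto simp: partial_deriv_eq inner_axis differentiable_def mult_ac)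
qed

lemma line_derivative:
  fixes f :: "real ^ 'm::finite \<Rightarrow> real"
  assumes "f differentiable (at (y + t *\<^sub>R axis i 1))"
  shows "((\<lambda>t. f (y + t *\<^sub>R axis i 1)) has_real_derivative partial_deriv i f (y + t *\<^sub>R axis i 1)) (at t)"
proof -
  have "((\<lambda>t. y + t *\<^sub>R axis i 1) has_derivative (\<lambda>s. s *\<^sub>R axis i 1)) (at t)"
    by (auto intro!: derivative_eq_intros)
  from has_derivative_compose[OF this has_derivative_partial_deriv[OF assms]]
  show ?thesis
    unfolding has_field_derivative_def
    by (rule has_derivative_eq_rhs) (simp add: fun_eq_iff inner_axis)
qed

subsection \<open>Closure properties of smooth functions\<close>

text \<open>Finite orders of smoothness make closure properties accessible to induction on
  \<open>k\<close>: differentiating a product or a power leaves expressions that are smooth of one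
  order less.\<close>

definition ck :: "nat \<Rightarrow> (real ^ 'm::finite) set \<Rightarrow> (real ^ 'm \<Rightarrow> real) \<Rightarrow> bool" where
  "ck k U f \<longleftrightarrow> (\<forall>is. length is \<le> k \<longrightarrow> foldr partial_deriv is f differentiable_on U)"

lemma smooth_on_iff_ck: "smooth_on U f \<longleftrightarrow> (\<forall>k. ck k U f)"
  unfolding smooth_on_def ck_def by blast

lemma ck_0: "ck 0 U f \<longleftrightarrow> f differentiable_on U"
  by (simp add: ck_def)

text \<open>\<open>foldr\<close> applies the last entry of the list first, so the innermost
  derivative is peeled off at the right end of the list.\<close>

lemma ck_Suc: "ck (Suc k) U f \<longleftrightarrow> f differentiable_on U \<and> (\<forall>i. ck k U (partial_deriv i f))"
proof
  assume L: "ck (Suc k) U f"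
  have "foldr partial_deriv is (partial_deriv i f) differentiable_on U" if "length is \<le> k" for "is" i
    using L[unfolded ck_def, rule_format, of "is @ [i]"] that by simp
  moreover have "f differentiable_on U"
    using L[unfolded ck_def, rule_format, of "[]"] by simp
  ultimately show "f differentiable_on U \<and> (\<forall>i. ck k U (partial_deriv i f))"
    by (simp add: ck_def)
next
  assume R: "f differentiable_on U \<and> (\<forall>i. ck k U (partial_deriv i f))"
  show "ck (Suc k) U f"
    unfolding ck_def
  proof (intro allI impI)
    fix "is" :: "'a list"
    assume "length is \<le> Suc k"
    then show "foldr partial_deriv is f differentiable_on U"
      using R by (cases "is" rule: rev_cases) (auto simp: ck_def)
  qed
qed

lemma ck_SucD: "ck (Suc k) U f \<Longrightarrow> ck k U f"
  by (auto simp: ck_def)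

lemma differentiable_on_transfer:
  "(\<And>x. x \<in> U \<Longrightarrow> f x = g x) \<Longrightarrow> f differentiable_on U \<Longrightarrow> g differentiable_on U"
  unfolding differentiable_on_def differentiable_def
  by (metis has_derivative_transform)

lemma ck_cong:
  assumes "open U" "\<And>x. x \<in> U \<Longrightarrow> f x = g x" "ck k U f"
  shows "ck k U g"
  using assms(2,3)
proof (induction k arbitrary: f g)
  case 0
  then show ?case
    using differentiable_on_transfer[of U f g] unfolding ck_0 by blast
next
  case (Suc k)
  have "ck k U (partial_deriv i g)" for i
  proof (rule Suc.IH)
    show "partial_deriv i f x = partial_deriv i g x" if "x \<in> U" for x
      using assms(1) that Suc.prems(1) by (rule partial_deriv_cong)
    show "ck k U (partial_deriv i f)"
      using Suc.prems(2) by (simp add: ck_Suc)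
  qed
  moreover have "g differentiable_on U"
    using differentiable_on_transfer[of U f g] Suc.prems unfolding ck_Suc by blast
  ultimately show ?case by (simp add: ck_Suc)
qed

context
  fixes U :: "(real ^ 'm::finite) set"
  assumes U: "open U"
begin

lemma differentiable_on_atD:
  fixes f :: "real ^ 'm \<Rightarrow> real"
  shows "f differentiable_on U \<Longrightarrow> x \<in> U \<Longrightarrow> f differentiable (at x)"
  unfolding differentiable_on_def by (metis U at_within_open)

lemma ck_const: "ck k U (\<lambda>_. c)"
proof (induction k arbitrary: c)
  case (Suc k)
  have "partial_deriv i (\<lambda>_. c) = (\<lambda>_. 0)" for i :: 'm by (simp add: fun_eq_iff)
  then show ?case using Suc by (simp add: ck_Suc)
qed (simp add: ck_0)

lemma ck_add: "ck k U f \<Longrightarrow> ck k U g \<Longrightarrow> ck k U (\<lambda>x. f x + g x)"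
proof (induction k arbitrary: f g)
  case 0
  then show ?case by (auto simp: ck_0)
next
  case (Suc k)
  have d: "f differentiable_on U" "g differentiable_on U" using Suc.prems unfolding ck_Suc by blast+
  have d': "f differentiable (at x)" "g differentiable (at x)" if "x \<in> U" for x
    using d that by (blast intro: differentiable_on_atD)+
  have "ck k U (partial_deriv i (\<lambda>x. f x + g x))" for i
  proof (rule ck_cong[OF U])
    show "ck k U (\<lambda>x. partial_deriv i f x + partial_deriv i g x)"
      using Suc.prems by (intro Suc.IH) (auto simp: ck_Suc)
  qed (rule partial_deriv_add[OF d', symmetric])
  then show ?case using differentiable_on_add[OF d] unfolding ck_Suc by simp
qed

lemma ck_mult: "ck k U f \<Longrightarrow> ck k U g \<Longrightarrow> ck k U (\<lambda>x. f x * g x)"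
proof (induction k arbitrary: f g)
  case 0
  then show ?case unfolding ck_0 by (rule differentiable_on_mult)
next
  case (Suc k)
  have d: "f differentiable_on U" "g differentiable_on U" using Suc.prems unfolding ck_Suc by blast+
  have d': "f differentiable (at x)" "g differentiable (at x)" if "x \<in> U" for x
    using d that by (blast intro: differentiable_on_atD)+
  have "ck k U (partial_deriv i (\<lambda>x. f x * g x))" for i
  proof (rule ck_cong[OF U])
    show "ck k U (\<lambda>x. partial_deriv i f x * g x + f x * partial_deriv i g x)"
      using Suc.prems ck_SucD[OF Suc.prems(1)] ck_SucD[OF Suc.prems(2)]
      by (intro ck_add Suc.IH) (auto simp: ck_Suc)
  qed (rule partial_deriv_mult[OF d', symmetric])
  then show ?case using differentiable_on_mult[OF d] unfolding ck_Suc by simp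
qed

lemma powr_has_partial_deriv:
  fixes u :: "real ^ 'm \<Rightarrow> real"
  assumes "u differentiable (at x)" "u x > 0"
  shows "partial_deriv i (\<lambda>x. u x powr a) x = a * u x powr (a - 1) * partial_deriv i u x"
    and "(\<lambda>x. u x powr a) differentiable (at x)"
  using partial_deriv_chain[OF assms(1) has_real_derivative_powr[OF assms(2), of a]] by auto

text \<open>The exponent is generalised in the induction because differentiation lowers it to
  \<open>a - 1\<close>.\<close>

lemma ck_powr: "ck k U u \<Longrightarrow> (\<And>x. x \<in> U \<Longrightarrow> u x > 0) \<Longrightarrow> ck k U (\<lambda>x. u x powr a)"
proof (induction k arbitrary: a)
  case 0
  then show ?case
    using powr_has_partial_deriv(2)
    by (simp add: ck_0 differentiable_on_def at_within_open[OF _ U])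
next
  case (Suc k)
  have d: "u differentiable_on U" using Suc.prems by (auto simp: ck_Suc)
  have "ck k U (partial_deriv i (\<lambda>x. u x powr a))" for i
  proof (rule ck_cong[OF U])
    show "ck k U (\<lambda>x. a * u x powr (a - 1) * partial_deriv i u x)"
      using Suc.prems ck_SucD[OF Suc.prems(1)]
      by (intro ck_mult ck_const Suc.IH) (auto simp: ck_Suc)
  qed (simp_all add: powr_has_partial_deriv differentiable_on_atD d Suc.prems)
  moreover have "(\<lambda>x. u x powr a) differentiable_on U"
    using Suc.prems d powr_has_partial_deriv(2)
    by (simp add: differentiable_on_def at_within_open[OF _ U])
  ultimately show ?case by (simp add: ck_Suc)
qed

lemma smooth_on_const [intro]: "smooth_on U (\<lambda>_. c)"
  by (simp add: smooth_on_iff_ck ck_const)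

lemma smooth_on_add [intro]: "smooth_on U f \<Longrightarrow> smooth_on U g \<Longrightarrow> smooth_on U (\<lambda>x. f x + g x)"
  by (simp add: smooth_on_iff_ck ck_add)

lemma smooth_on_mult [intro]: "smooth_on U f \<Longrightarrow> smooth_on U g \<Longrightarrow> smooth_on U (\<lambda>x. f x * g x)"
  by (simp add: smooth_on_iff_ck ck_mult)

lemma smooth_on_diff [intro]: "smooth_on U f \<Longrightarrow> smooth_on U g \<Longrightarrow> smooth_on U (\<lambda>x. f x - g x)"
  using smooth_on_add[OF _ smooth_on_mult[OF smooth_on_const], of f g "-1"] by simp

lemma smooth_on_sum [intro]:
  "(\<And>k. k \<in> K \<Longrightarrow> smooth_on U (f k)) \<Longrightarrow> smooth_on U (\<lambda>x. \<Sum>k\<in>K. f k x)"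
  by (induction K rule: infinite_finite_induct) auto

lemma smooth_on_power [intro]: "smooth_on U f \<Longrightarrow> smooth_on U (\<lambda>x. f x ^ k)"
  by (induction k) auto

lemma smooth_on_powr [intro]:
  "smooth_on U u \<Longrightarrow> (\<And>x. x \<in> U \<Longrightarrow> u x > 0) \<Longrightarrow> smooth_on U (\<lambda>x. u x powr a)"
  by (simp add: smooth_on_iff_ck ck_powr)

lemma smooth_on_partial_deriv [intro]: "smooth_on U f \<Longrightarrow> smooth_on U (partial_deriv i f)"
  using ck_Suc unfolding smooth_on_iff_ck by blast

lemma smooth_on_nth [intro]: "smooth_on U (\<lambda>x. x $ j)"
  unfolding smooth_on_iff_ck
proof
  fix k
  have *: "partial_deriv i (\<lambda>x. x $ j) = (\<lambda>_. if i = j then 1 else 0)" for i :: 'm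
    by (simp add: fun_eq_iff)
  have "(\<lambda>x. x $ j) differentiable_on U"
    unfolding differentiable_on_def differentiable_def
    using bounded_linear.has_derivative[OF bounded_linear_vec_nth has_derivative_ident] by blast
  then show "ck k U (\<lambda>x. x $ j)"
    by (cases k) (simp_all add: ck_0 ck_Suc * ck_const)
qed

lemma smooth_on_differentiable: "smooth_on U f \<Longrightarrow> x \<in> U \<Longrightarrow> f differentiable (at x)"
  using ck_0 differentiable_on_atD smooth_on_iff_ck by blast

lemma smooth_on_continuous_on: "smooth_on U f \<Longrightarrow> S \<subseteq> U \<Longrightarrow> continuous_on S f"
  by (meson smooth_on_differentiable continuous_at_imp_continuous_on differentiable_imp_continuous_within subsetD)

text \<open>The second difference quotient is symmetric in \<open>i\<close> and \<open>j\<close>,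
  which yields the symmetry of second derivatives. The mean value theorem in direction
  \<open>i\<close> turns it into a first difference of \<open>partial_deriv i f\<close>, and then
  differentiability of that function at the single point \<open>x\<close> gives the limit.\<close>

lemma mixed_difference_tendsto:
  assumes f: "smooth_on U f" and x: "x \<in> U"
  shows "((\<lambda>h. (f (x + h *\<^sub>R axis i 1 + h *\<^sub>R axis j 1) - f (x + h *\<^sub>R axis i 1)
      - f (x + h *\<^sub>R axis j 1) + f x) / h\<^sup>2) \<longlongrightarrow> partial_deriv j (partial_deriv i f) x) (at_right 0)"
proof (rule tendstoI)
  fix e :: real assume "e > 0"
  define g where "g = partial_deriv i f"
  define G where "G = (\<chi> i. partial_deriv i g x)"
  let ?i = "axis i 1 :: real ^ 'm" and ?j = "axis j 1 :: real ^ 'm"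
  have "(g has_derivative (\<lambda>h. G \<bullet> h)) (at x)"
    unfolding g_def G_def using f x by (intro has_derivative_partial_deriv smooth_on_differentiable) auto
  \<comment> \<open>Tolerance \<open>e / 4\<close>: the two sample points lie within
    \<open>2 * h\<close> and \<open>h\<close> of \<open>x\<close>, so the total error is at most
    \<open>3 / 4 * e * h\<close>.\<close>
  then obtain d where d: "d > 0" "\<And>y. norm (y - x) < d \<Longrightarrow> \<bar>g y - g x - G \<bullet> (y - x)\<bar> \<le> e / 4 * norm (y - x)"
    using \<open>e > 0\<close> unfolding has_derivative_real_iff by (meson divide_pos_pos zero_less_numeral)
  obtain r where r: "r > 0" "ball x r \<subseteq> U"
    using U x open_contains_ball by blast
  have "\<bar>(f (x + h *\<^sub>R ?i + h *\<^sub>R ?j) - f (x + h *\<^sub>R ?i) - f (x + h *\<^sub>R ?j) + f x) / h\<^sup>2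
      - partial_deriv j g x\<bar> < e" if h: "0 < h" "h < min d r / 2" for h
  proof -
    have in_U: "x + s *\<^sub>R ?i + t *\<^sub>R ?j \<in> U" if "0 \<le> s" "s \<le> h" "0 \<le> t" "t \<le> h" for s t
    proof -
      have "norm (s *\<^sub>R ?i + t *\<^sub>R ?j) \<le> s + t"
        by (rule norm_triangle_le) (use that in simp)
      moreover have "dist x (x + s *\<^sub>R ?i + t *\<^sub>R ?j) = norm (s *\<^sub>R ?i + t *\<^sub>R ?j)"
        by (metis add.assoc add_diff_cancel_left' dist_commute dist_norm)
      ultimately have "dist x (x + s *\<^sub>R ?i + t *\<^sub>R ?j) < r"
        using that h by simp
      then show ?thesis using r by auto
    qed
    have "\<exists>s. 0 < s \<and> s < h \<and>
        (f (x + h *\<^sub>R ?j + h *\<^sub>R ?i) - f (x + h *\<^sub>R ?i)) - (f (x + h *\<^sub>R ?j + 0 *\<^sub>R ?i) - f (x + 0 *\<^sub>R ?i))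
        = (h - 0) * (g (x + h *\<^sub>R ?j + s *\<^sub>R ?i) - g (x + s *\<^sub>R ?i))"
    proof (rule MVT2[OF h(1)])
      fix s assume s: "0 \<le> s" "s \<le> h"
      have "x + s *\<^sub>R ?i \<in> U" "x + h *\<^sub>R ?j + s *\<^sub>R ?i \<in> U"
        using in_U[of s 0] in_U[of s h] s h(1) by (simp_all add: add_ac)
      then show "((\<lambda>s. f (x + h *\<^sub>R ?j + s *\<^sub>R ?i) - f (x + s *\<^sub>R ?i)) has_real_derivative
          (g (x + h *\<^sub>R ?j + s *\<^sub>R ?i) - g (x + s *\<^sub>R ?i))) (at s)"
        unfolding g_def by (intro DERIV_diff line_derivative smooth_on_differentiable f)
    qed
    then obtain s where s: "0 < s" "s < h" and
      eq: "(f (x + h *\<^sub>R ?i + h *\<^sub>R ?j) - f (x + h *\<^sub>R ?i)) - (f (x + h *\<^sub>R ?j) - f x)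
        = h * (g (x + (s *\<^sub>R ?i + h *\<^sub>R ?j)) - g (x + s *\<^sub>R ?i))"
      by (auto simp: add_ac)
    have n: "norm (s *\<^sub>R ?i + h *\<^sub>R ?j) \<le> 2 * h"
      by (rule norm_triangle_le) (use s h in simp)
    have 1: "\<bar>g (x + (s *\<^sub>R ?i + h *\<^sub>R ?j)) - g x - G \<bullet> (s *\<^sub>R ?i + h *\<^sub>R ?j)\<bar> \<le> e / 4 * (2 * h)"
    proof (rule order_trans)
      show "\<bar>g (x + (s *\<^sub>R ?i + h *\<^sub>R ?j)) - g x - G \<bullet> (s *\<^sub>R ?i + h *\<^sub>R ?j)\<bar>
          \<le> e / 4 * norm (s *\<^sub>R ?i + h *\<^sub>R ?j)"
        using d(2)[of "x + (s *\<^sub>R ?i + h *\<^sub>R ?j)"] h n by (simp del: times_divide_eq_left)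
    qed (use \<open>e > 0\<close> in \<open>intro mult_left_mono n; simp\<close>)
    have 2: "\<bar>g (x + s *\<^sub>R ?i) - g x - G \<bullet> (s *\<^sub>R ?i)\<bar> \<le> e / 4 * h"
    proof (rule order_trans)
      show "\<bar>g (x + s *\<^sub>R ?i) - g x - G \<bullet> (s *\<^sub>R ?i)\<bar> \<le> e / 4 * s"
        using d(2)[of "x + s *\<^sub>R ?i"] h s by simp
    qed (use \<open>e > 0\<close> s in \<open>intro mult_left_mono; simp\<close>)
    have Gj: "G \<bullet> ?j = partial_deriv j g x" by (simp add: G_def inner_axis)
    have "\<bar>(g (x + (s *\<^sub>R ?i + h *\<^sub>R ?j)) - g (x + s *\<^sub>R ?i)) - h * partial_deriv j g x\<bar> \<le> 3 / 4 * e * h"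
      using 1 2 unfolding inner_add_right inner_scaleR_right Gj by linarith
    then have "\<bar>(g (x + (s *\<^sub>R ?i + h *\<^sub>R ?j)) - g (x + s *\<^sub>R ?i)) / h - partial_deriv j g x\<bar> \<le> 3 / 4 * e"
      using h(1) by (simp add: field_simps abs_le_iff)
    moreover have "(f (x + h *\<^sub>R ?i + h *\<^sub>R ?j) - f (x + h *\<^sub>R ?i) - f (x + h *\<^sub>R ?j) + f x) / h\<^sup>2
        = (g (x + (s *\<^sub>R ?i + h *\<^sub>R ?j)) - g (x + s *\<^sub>R ?i)) / h"
    proof -
      have "f (x + h *\<^sub>R ?i + h *\<^sub>R ?j) - f (x + h *\<^sub>R ?i) - f (x + h *\<^sub>R ?j) + f x
          = h * (g (x + (s *\<^sub>R ?i + h *\<^sub>R ?j)) - g (x + s *\<^sub>R ?i))"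
        using eq by linarith
      then show ?thesis using h(1) by (simp only: power2_eq_square) simp
    qed
    ultimately show ?thesis using \<open>e > 0\<close> by simp
  qed
  moreover have "\<forall>\<^sub>F h in at_right (0::real). h \<in> {0<..<min d r / 2}"
    using d(1) r(1) by (intro eventually_at_right_real) auto
  ultimately show "\<forall>\<^sub>F h in at_right 0. dist ((f (x + h *\<^sub>R ?i + h *\<^sub>R ?j) - f (x + h *\<^sub>R ?i)
      - f (x + h *\<^sub>R ?j) + f x) / h\<^sup>2) (partial_deriv j (partial_deriv i f) x) < e"
    unfolding g_def dist_real_def by (auto elim!: eventually_mono)
qed

lemma partial_deriv_commute:
  assumes "smooth_on U f" "x \<in> U"
  shows "partial_deriv i (partial_deriv j f) x = partial_deriv j (partial_deriv i f) x"
proof (rule tendsto_unique)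
  show "((\<lambda>h. (f (x + h *\<^sub>R axis i 1 + h *\<^sub>R axis j 1) - f (x + h *\<^sub>R axis i 1)
      - f (x + h *\<^sub>R axis j 1) + f x) / h\<^sup>2) \<longlongrightarrow> partial_deriv i (partial_deriv j f) x) (at_right 0)"
    using mixed_difference_tendsto[OF assms, of j i] by (simp add: algebra_simps)
qed (use mixed_difference_tendsto[OF assms] in auto)

end

subsection \<open>Integration over the unit sphere\<close>

lemma set_integrable_bounded_continuous:
  fixes f :: "'a::euclidean_space \<Rightarrow> real"
  assumes A: "A \<in> sets borel" "bounded A" and f: "continuous_on A f" "\<And>x. x \<in> A \<Longrightarrow> \<bar>f x\<bar> \<le> C"
  shows "set_integrable lborel A f"
proof -
  have "integrable lborel (\<lambda>x. indicator A x *\<^sub>R (indicator A x *\<^sub>R f x))"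
  proof (rule integrableI_bounded_set_indicator[where B="\<bar>C\<bar>"])
    show "(\<lambda>x. indicator A x *\<^sub>R f x) \<in> borel_measurable lborel"
      using borel_measurable_continuous_on_indicator[OF A(1) f(1)] by simp
    show "emeasure lborel A < \<infinity>" by (rule emeasure_bounded_finite[OF A(2)])
    show "AE x in lborel. x \<in> A \<longrightarrow> norm (indicator A x *\<^sub>R f x) \<le> \<bar>C\<bar>"
    proof (intro AE_I2 impI)
      show "norm (indicator A x *\<^sub>R f x) \<le> \<bar>C\<bar>" if "x \<in> A" for x
        using f(2)[OF that] that by simp
    qed
  qed (use A in auto)
  then show ?thesis
    unfolding set_integrable_def by (rule Bochner_Integration.integrable_cong[THEN iffD1, rotated 2]) (auto simp: indicator_def)
qed

lemma set_integrable_continuous_cball: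
  fixes f :: "'a::euclidean_space \<Rightarrow> real"
  assumes "continuous_on (cball a r) f" "A \<subseteq> cball a r" "A \<in> sets borel"
  shows "set_integrable lborel A f"
proof -
  have "bounded (f ` cball a r)"
    using assms(1) compact_cball compact_continuous_image compact_imp_bounded by blast
  then obtain C where C: "\<forall>y\<in>f ` cball a r. norm y \<le> C"
    unfolding bounded_iff by blast
  then have "\<bar>f x\<bar> \<le> C" if "x \<in> cball a r" for x
    using that by auto
  moreover have "bounded A" using assms(2) bounded_cball bounded_subset by blast
  ultimately show ?thesis
    using assms by (intro set_integrable_bounded_continuous[where C=C]) (auto intro: continuous_on_subset)
qed

lemma set_integrable_ball:
  "continuous_on (cball 0 1) f \<Longrightarrow> set_integrable lborel (ball 0 1) (f :: 'a::euclidean_space \<Rightarrow> real)"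
  by (rule set_integrable_continuous_cball) auto

text \<open>The cone formula as a Lebesgue integral that reads \<open>F\<close> only on the sphere.
  Continuity of \<open>F\<close> there already gives integrability, so the calculus is done with
  \<open>sphere_int\<close> instead of \<open>sphere_measure\<close>.\<close>

definition sphere_int :: "(real ^ 'm::finite \<Rightarrow> real) \<Rightarrow> real" where
  "sphere_int F = real CARD('m) * (LINT x:ball 0 1 - {0}|lborel. F (x /\<^sub>R norm x))"

text \<open>\<open>sphere_measure\<close> is an image measure on all Borel sets of the space, so
  passing to the cone integral requires measurability of \<open>F\<close> everywhere and not just on
  the sphere.\<close>

lemma integral_sphere_measure:
  fixes F :: "real ^ 'm::finite \<Rightarrow> real"
  assumes F: "F \<in> borel_measurable borel"
  shows "(LINT x|sphere_measure. F x) = sphere_int F"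
proof -
  define N where "N = (restrict_space lborel (ball 0 1 - {0}) :: (real ^ 'm) measure)"
  have proj: "(\<lambda>x::real ^ 'm. x /\<^sub>R norm x) \<in> measurable N borel"
    unfolding N_def by (rule measurable_restrict_space1) simp
  have "(sphere_measure :: (real ^ 'm) measure) =
      density (distr N borel (\<lambda>x. x /\<^sub>R norm x)) (\<lambda>_. ennreal (real CARD('m)))"
    unfolding sphere_measure_def N_def[symmetric]
    by (rule measure_eqI) (auto simp: emeasure_density_const ennreal_of_nat_eq_real_of_nat)
  then have "(LINT x|sphere_measure. F x) =
      (LINT x|density (distr N borel (\<lambda>x. x /\<^sub>R norm x)) (\<lambda>_. ennreal (real CARD('m))). F x)"
    by (rule arg_cong)
  also have "\<dots> = (LINT x|distr N borel (\<lambda>x. x /\<^sub>R norm x). real CARD('m) *\<^sub>R F x)"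
    using F by (intro integral_density) auto
  also have "\<dots> = (LINT x|N. real CARD('m) *\<^sub>R F (x /\<^sub>R norm x))"
    using F proj by (intro integral_distr) auto
  also have "\<dots> = sphere_int F"
    unfolding N_def sphere_int_def set_lebesgue_integral_def
    by (subst integral_restrict_space) (auto simp: mult.left_commute)
  finally show ?thesis .
qed

lemma norm_radial_projection: "(x::'a::real_normed_vector) \<noteq> 0 \<Longrightarrow> x /\<^sub>R norm x \<in> sphere 0 1"
  by simp

lemma sphere_int_cong:
  assumes "\<And>x. x \<in> sphere 0 1 \<Longrightarrow> F x = G x"
  shows "sphere_int F = sphere_int G"
  unfolding sphere_int_def
  by (intro arg_cong[where f="\<lambda>t. _ * t"] set_lebesgue_integral_cong) (auto intro!: assms)

lemma set_integrable_radial: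
  fixes F :: "real ^ 'm::finite \<Rightarrow> real"
  assumes F: "continuous_on (sphere 0 1) F" and A: "A \<in> sets borel" "bounded A" "0 \<notin> A"
  shows "set_integrable lborel A (\<lambda>x. F (x /\<^sub>R norm x))"
proof -
  have "bounded (F ` sphere 0 1)"
    using F compact_sphere compact_continuous_image compact_imp_bounded by blast
  then obtain C where C: "\<forall>y\<in>F ` sphere 0 1. norm y \<le> C"
    unfolding bounded_iff by blast
  then have "\<bar>F x\<bar> \<le> C" if "x \<in> sphere 0 1" for x
    using that by auto
  moreover have proj: "x /\<^sub>R norm x \<in> sphere 0 1" if "x \<in> A" for x
    using A(3) that by (intro norm_radial_projection) auto
  moreover have "continuous_on A (\<lambda>x. F (x /\<^sub>R norm x))"
  proof (rule continuous_on_compose2[OF F])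
    show "continuous_on A (\<lambda>x. x /\<^sub>R norm x)"
      using A(3) by (intro continuous_intros) auto
    show "(\<lambda>x. x /\<^sub>R norm x) ` A \<subseteq> sphere 0 1"
      using proj by (rule image_subsetI)
  qed
  ultimately show ?thesis
    using A by (intro set_integrable_bounded_continuous[where C=C]) auto
qed

lemma sphere_int_add:
  assumes "continuous_on (sphere 0 1) F" "continuous_on (sphere 0 1) G"
  shows "sphere_int (\<lambda>x. F x + G x) = sphere_int F + sphere_int G"
  unfolding sphere_int_def using assms
  by (subst set_integral_add(2)) (auto intro!: set_integrable_radial simp: distrib_left bounded_diff)

lemma sphere_int_cmult: "sphere_int (\<lambda>x. c * F x) = c * sphere_int F"
  by (simp add: sphere_int_def)

lemma sphere_int_diff:
  assumes "continuous_on (sphere 0 1) F" "continuous_on (sphere 0 1) G"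
  shows "sphere_int (\<lambda>x. F x - G x) = sphere_int F - sphere_int G"
  using sphere_int_add[of F "\<lambda>x. -1 * G x"] sphere_int_cmult[of "-1" G] assms
  by (simp add: continuous_on_minus)

lemma sphere_int_sum:
  assumes "\<And>k. k \<in> K \<Longrightarrow> continuous_on (sphere 0 1) (F k)"
  shows "sphere_int (\<lambda>x. \<Sum>k\<in>K. F k x) = (\<Sum>k\<in>K. sphere_int (F k))"
  using assms
proof (induction K rule: infinite_finite_induct)
  case (insert k K)
  then show ?case by (simp add: sphere_int_add continuous_on_sum)
qed (simp_all add: sphere_int_def)

lemma sphere_int_mono:
  assumes "continuous_on (sphere 0 1) F" "continuous_on (sphere 0 1) G"
    and "\<And>x. x \<in> sphere 0 1 \<Longrightarrow> F x \<le> G x"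
  shows "sphere_int F \<le> sphere_int G"
  unfolding sphere_int_def using assms
  by (intro mult_left_mono set_integral_mono set_integrable_radial) (auto simp: bounded_diff)

section \<open>Integrals over thin spherical shells\<close>

lemma lborel_integral_scaling:
  fixes f :: "real ^ 'm::finite \<Rightarrow> real"
  assumes r: "r > 0" and f: "f \<in> borel_measurable borel"
  shows "(LINT x|lborel. f x) = r ^ CARD('m) * (LINT x|lborel. f (r *\<^sub>R x))"
proof -
  have "(LINT x|lborel. f x) =
      (LINT x|density (distr lborel borel (\<lambda>x. 0 + r *\<^sub>R x)) (\<lambda>_. ennreal (\<bar>r\<bar> ^ DIM(real ^ 'm))). f x)"
    using r by (subst lborel_affine[of r 0]) auto
  also have "\<dots> = r ^ CARD('m) * (LINT x|lborel. f (r *\<^sub>R x))"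
    using r f by (simp add: integral_density integral_distr)
  finally show ?thesis .
qed

text \<open>The integrand is constant along rays, so a dilation by \<open>r\<close> contributes only
  its Jacobian.\<close>

lemma radial_integral_scaling:
  fixes F :: "real ^ 'm::finite \<Rightarrow> real"
  assumes F: "continuous_on (sphere 0 1) F" and r: "0 < r"
  shows "(LINT x:ball 0 r - {0}|lborel. F (x /\<^sub>R norm x)) = r ^ CARD('m) * (sphere_int F / real CARD('m))"
proof -
  have "set_integrable lborel (ball 0 r - {0}) (\<lambda>x. F (x /\<^sub>R norm x))"
    by (intro set_integrable_radial F) (auto simp: bounded_diff)
  then have "(\<lambda>x. indicator (ball 0 r - {0}) x *\<^sub>R F (x /\<^sub>R norm x)) \<in> borel_measurable borel"
    unfolding set_integrable_def by (auto dest: borel_measurable_integrable)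
  from lborel_integral_scaling[OF r this]
  have "(LINT x:ball 0 r - {0}|lborel. F (x /\<^sub>R norm x)) = r ^ CARD('m) *
    (LINT x|lborel. indicator (ball 0 r - {0}) (r *\<^sub>R x) *\<^sub>R F ((r *\<^sub>R x) /\<^sub>R norm (r *\<^sub>R x)))"
    by (simp add: set_lebesgue_integral_def)
  also have "(\<lambda>x. indicator (ball 0 r - {0}) (r *\<^sub>R x) *\<^sub>R F ((r *\<^sub>R x) /\<^sub>R norm (r *\<^sub>R x)))
      = (\<lambda>x. indicator (ball 0 1 - {0}) x *\<^sub>R F (x /\<^sub>R norm x))"
  proof
    fix x :: "real ^ 'm"
    have "(r *\<^sub>R x) /\<^sub>R norm (r *\<^sub>R x) = x /\<^sub>R norm x"
      using r by (cases "x = 0") (simp_all add: field_simps)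
    moreover have "r *\<^sub>R x \<in> ball 0 r - {0} \<longleftrightarrow> x \<in> ball 0 1 - {0}"
      using r by simp
    ultimately show "indicator (ball 0 r - {0}) (r *\<^sub>R x) *\<^sub>R F ((r *\<^sub>R x) /\<^sub>R norm (r *\<^sub>R x))
      = indicator (ball 0 1 - {0}) x *\<^sub>R F (x /\<^sub>R norm x)"
      unfolding indicator_def by presburger
  qed
  finally show ?thesis
    by (simp add: sphere_int_def set_lebesgue_integral_def)
qed

text \<open>The thin shell in which the cutoff function decreases from \<open>1\<close> to \<open>0\<close>.\<close>

definition shell :: "real \<Rightarrow> (real ^ 'm::finite) set" where
  "shell r = ball 0 1 - ball 0 r"

lemma shell_radial_integral:
  fixes F :: "real ^ 'm::finite \<Rightarrow> real"
  assumes F: "continuous_on (sphere 0 1) F" and r: "0 < r" "r < 1"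
  shows "(LINT x:shell r|lborel. F (x /\<^sub>R norm x)) = (1 - r ^ CARD('m)) * (sphere_int F / real CARD('m))"
proof -
  have "(LINT x:(ball 0 r - {0}) \<union> shell r|lborel. F (x /\<^sub>R norm x)) =
      (LINT x:ball 0 r - {0}|lborel. F (x /\<^sub>R norm x)) + (LINT x:shell r|lborel. F (x /\<^sub>R norm x))"
    using r by (intro set_integral_Un set_integrable_radial F) (auto simp: bounded_diff shell_def)
  also have "(ball 0 r - {0}) \<union> shell r = (ball 0 1 - {0} :: (real ^ 'm) set)"
    using r by (auto simp: shell_def)
  finally have "(LINT x:ball 0 1 - {0}|lborel. F (x /\<^sub>R norm x)) =
      (LINT x:ball 0 r - {0}|lborel. F (x /\<^sub>R norm x)) + (LINT x:shell r|lborel. F (x /\<^sub>R norm x))" .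
  moreover have "(LINT x:ball 0 1 - {0}|lborel. F (x /\<^sub>R norm x)) = sphere_int F / real CARD('m)"
    using radial_integral_scaling[OF F, of 1] by simp
  ultimately show ?thesis
    unfolding left_diff_distrib radial_integral_scaling[OF F r(1)] by linarith
qed

text \<open>The shift by 2 keeps \<open>radii 0 = 1 / 2\<close> positive.\<close>

definition radii :: "nat \<Rightarrow> real" where
  "radii k = 1 - 1 / (real k + 2)"

lemma radii: "0 < radii k" "radii k < 1"
  by (simp_all add: radii_def)

lemma radii_tendsto: "radii \<longlonglongrightarrow> 1"
  unfolding radii_def by real_asymp

text \<open>The factor \<open>2 / (1 - r\<^sup>2)\<close> comes from the gradient of the cutoff on
  the shell. Cancelling the common factor \<open>1 - r\<close> leaves a geometric sum that is
  continuous at 1.\<close>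

lemma shell_coefficient_tendsto:
  assumes "d > 0"
  shows "(\<lambda>k. 2 / (1 - (radii k)\<^sup>2) * ((1 - radii k ^ d) / real d)) \<longlonglongrightarrow> 1"
proof -
  have "2 / (1 - (radii k)\<^sup>2) * ((1 - radii k ^ d) / real d)
      = 2 * (\<Sum>i<d. radii k ^ i) / ((1 + radii k) * real d)" for k
  proof -
    have "1 - radii k \<noteq> 0" "1 + radii k \<noteq> 0" using radii[of k] by auto
    moreover have "1 - (radii k)\<^sup>2 = (1 - radii k) * (1 + radii k)"
      by (simp add: algebra_simps power2_eq_square)
    ultimately show ?thesis
      unfolding one_diff_power_eq[of "radii k" d] by simp
  qed
  moreover have "(\<lambda>k. 2 * (\<Sum>i<d. radii k ^ i) / ((1 + radii k) * real d))
      \<longlonglongrightarrow> 2 * (\<Sum>i<d. 1 ^ i) / ((1 + 1) * real d)"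
    using assms by (intro tendsto_intros radii_tendsto) auto
  ultimately show ?thesis using assms by simp
qed

text \<open>Compare \<open>F\<close> with the function that is constant along rays and agrees with
  \<open>F\<close> on the sphere. For the latter the shell integral is explicit, and uniform
  continuity controls the difference because the shell lies within \<open>1 - radii k\<close> of the
  sphere.\<close>

theorem shell_integral_tendsto:
  fixes F :: "real ^ 'm::finite \<Rightarrow> real"
  assumes F: "continuous_on (cball 0 1) F"
  shows "(\<lambda>k. 2 / (1 - (radii k)\<^sup>2) * (LINT x:shell (radii k)|lborel. F x)) \<longlonglongrightarrow> sphere_int F"
proof -
  define a where "a k = 2 / (1 - (radii k)\<^sup>2) * ((1 - radii k ^ CARD('m)) / real CARD('m))" for k
  have a: "a \<longlonglongrightarrow> 1"
    unfolding a_def by (rule shell_coefficient_tendsto) simp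
  have coef: "2 / (1 - (radii k)\<^sup>2) > 0" for k
    using radii[of k] by (simp add: power_less_one_iff)
  have Fs: "continuous_on (sphere 0 1) F"
    using F by (rule continuous_on_subset) auto
  have sh: "shell (radii k) \<in> sets borel" "bounded (shell (radii k))" "0 \<notin> shell (radii k)"
      "shell (radii k) \<subseteq> cball 0 1" for k
    using radii[of k] by (auto simp: shell_def bounded_diff)
  have radial: "2 / (1 - (radii k)\<^sup>2) * (LINT x:shell (radii k)|lborel. G (x /\<^sub>R norm x)) = a k * sphere_int G"
    if "continuous_on (sphere 0 1) G" for k and G :: "real ^ 'm \<Rightarrow> real"
    by (simp add: shell_radial_integral[OF that radii] a_def)
  define V where "V = sphere_int (\<lambda>_::real ^ 'm. 1)"
  have V: "V \<ge> 0"
    using sphere_int_mono[of "\<lambda>_. 0" "\<lambda>_. 1"] by (simp add: V_def sphere_int_def)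
  define E where "E k = 2 / (1 - (radii k)\<^sup>2) * (LINT x:shell (radii k)|lborel. F x - F (x /\<^sub>R norm x))" for k
  have split: "2 / (1 - (radii k)\<^sup>2) * (LINT x:shell (radii k)|lborel. F x) = E k + a k * sphere_int F" for k
    unfolding E_def radial[OF Fs, symmetric]
    by (subst set_integral_diff(2))
       (auto intro!: set_integrable_radial Fs sh set_integrable_continuous_cball[OF F] simp: algebra_simps)
  have "E \<longlonglongrightarrow> 0"
  proof (rule tendstoI)
    fix e :: real assume "e > 0"
    \<comment> \<open>Since \<open>a k\<close> is eventually below 2, the error is at most
      \<open>2 * \<eta> * V = e * (V / (V + 1))\<close>; the added 1 makes this strictly smaller
      than \<open>e\<close>.\<close>
    define \<eta> where "\<eta> = e / (2 * (V + 1))"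
    have \<eta>: "\<eta> > 0" using \<open>e > 0\<close> V by (simp add: \<eta>_def)
    obtain d where d: "d > 0" "\<And>x y. x \<in> cball 0 1 \<Longrightarrow> y \<in> cball 0 1 \<Longrightarrow> dist x y < d \<Longrightarrow> dist (F x) (F y) < \<eta>"
      using compact_uniformly_continuous[OF F] \<eta> unfolding uniformly_continuous_on_def by (metis compact_cball dist_commute)
    have "\<forall>\<^sub>F k in sequentially. radii k > 1 - d"
      using radii_tendsto d(1) by (intro order_tendstoD) auto
    moreover have "\<forall>\<^sub>F k in sequentially. a k < 2"
      using a by (rule order_tendstoD) simp
    ultimately show "\<forall>\<^sub>F k in sequentially. dist (E k) 0 < e"
    proof eventually_elim
      fix k assume k: "radii k > 1 - d" "a k < 2"
      have close: "\<bar>F x - F (x /\<^sub>R norm x)\<bar> \<le> \<eta>" if x: "x \<in> shell (radii k)" for x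
      proof -
        have nx: "norm x > 0" "norm x < 1" "norm x \<ge> radii k" using x radii[of k] by (auto simp: shell_def)
        have "x - x /\<^sub>R norm x = (1 - inverse (norm x)) *\<^sub>R x" by (simp add: algebra_simps)
        then have "dist x (x /\<^sub>R norm x) = \<bar>1 - inverse (norm x)\<bar> * norm x" by (simp add: dist_norm)
        also have "\<dots> = \<bar>(1 - inverse (norm x)) * norm x\<bar>" by (simp add: abs_mult)
        also have "\<dots> = 1 - norm x" using nx by (simp add: algebra_simps)
        finally have "dist x (x /\<^sub>R norm x) < d" using k(1) nx by simp
        then show ?thesis using d(2)[of x "x /\<^sub>R norm x"] nx by (simp add: dist_real_def)
      qed
      have "\<bar>LINT x:shell (radii k)|lborel. F x - F (x /\<^sub>R norm x)\<bar> \<le> (LINT x:shell (radii k)|lborel. \<bar>F x - F (x /\<^sub>R norm x)\<bar>)"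
        using set_integral_norm_bound[of lborel "shell (radii k)" "\<lambda>x. F x - F (x /\<^sub>R norm x)"]
        by (simp add: set_integral_diff(1) set_integrable_radial Fs sh set_integrable_continuous_cball[OF F])
      also have "\<dots> \<le> (LINT x:(shell (radii k) :: (real ^ 'm) set)|lborel. \<eta>)"
      proof (rule set_integral_mono)
        show "set_integrable lborel (shell (radii k)) (\<lambda>x. \<bar>F x - F (x /\<^sub>R norm x)\<bar>)"
          by (intro set_integrable_abs set_integral_diff(1) set_integrable_radial Fs sh set_integrable_continuous_cball[OF F])
        show "set_integrable lborel (shell (radii k)) (\<lambda>x. \<eta>)"
          by (intro set_integrable_continuous_cball[where a=0 and r=1] sh) auto
      qed (use close in auto)
      finally have "\<bar>E k\<bar> \<le> 2 / (1 - (radii k)\<^sup>2) * (LINT x:(shell (radii k) :: (real ^ 'm) set)|lborel. \<eta>)"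
        unfolding E_def abs_mult abs_of_pos[OF coef] using coef[of k] by (intro mult_left_mono) simp_all
      also have "\<dots> = a k * sphere_int (\<lambda>_::real ^ 'm. \<eta>)"
        by (rule radial) auto
      also have "\<dots> = a k * \<eta> * V"
        using sphere_int_cmult[of \<eta> "\<lambda>_::real ^ 'm. 1"] by (simp add: V_def)
      also have "\<dots> \<le> 2 * \<eta> * V"
        using k(2) \<eta> V by (intro mult_right_mono) auto
      also have "\<dots> = e * (V / (V + 1))"
        using V by (simp add: \<eta>_def divide_simps)
      also have "\<dots> < e * 1"
        using V \<open>e > 0\<close> by (intro mult_strict_left_mono) (auto simp: divide_less_eq)
      finally show "dist (E k) 0 < e" by simp
    qed
  qed
  then have "(\<lambda>k. E k + a k * sphere_int F) \<longlonglongrightarrow> 0 + 1 * sphere_int F"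
    by (intro tendsto_intros a)
  then show ?thesis unfolding split by simp
qed

subsection \<open>The Loomis-Whitney inequality\<close>

definition line :: "real ^ 'm::finite \<Rightarrow> 'm \<Rightarrow> real \<Rightarrow> real ^ 'm" where
  "line x i t = (\<chi> k. if k = i then t else x $ k)"

lemma line_nth [simp]: "line x i t $ k = (if k = i then t else x $ k)"
  by (simp add: line_def)

lemma line_eq: "line x i t = line x i 0 + t *\<^sub>R axis i 1"
  by (simp add: vec_eq_iff axis_def)

lemma line_same [simp]: "line x i (x $ i) = x" "line (line x i s) i t = line x i t"
  by (simp_all add: vec_eq_iff)

lemma line_commute: "i \<noteq> j \<Longrightarrow> line (line x i s) j t = line (line x j t) i s"
  by (simp add: vec_eq_iff)

lemma continuous_on_line [continuous_intros]:
  assumes "continuous_on S f" "continuous_on S g"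
  shows "continuous_on S (\<lambda>z. line (f z) i (g z))"
  unfolding line_def
proof (rule continuous_on_vec_lambda)
  show "continuous_on S (\<lambda>z. if k = i then g z else f z $ k)" for k
    using assms by (cases "k = i") (auto intro: continuous_on_component)
qed

lemma measurable_line [measurable]: "(\<lambda>(x, t). line x i t) \<in> borel_measurable (borel \<Otimes>\<^sub>M borel)"
  unfolding borel_prod case_prod_beta
  by (intro borel_measurable_continuous_onI continuous_intros)

lemma measurable_line_compose [measurable (raw)]:
  assumes "f \<in> borel_measurable M" "g \<in> borel_measurable M"
  shows "(\<lambda>z. line (f z) i (g z)) \<in> borel_measurable M"
  using measurable_compose[OF measurable_Pair[OF assms] measurable_line, of i] by simp

text \<open>A box of finite measure containing the unit ball: a function cut off to vanish outside
  the open ball is zero at both ends of every coordinate segment of the box.\<close>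

definition unit_cube :: "(real ^ 'm::finite) set" where
  "unit_cube = cbox (- 1) 1"

lemma mem_unit_cube: "x \<in> unit_cube \<longleftrightarrow> (\<forall>i. x $ i \<in> {-1..1})"
  by (auto simp: unit_cube_def mem_box_cart)

lemma unit_cube_borel [measurable]: "unit_cube \<in> sets borel"
  by (simp add: unit_cube_def)

lemma measure_unit_cube: "measure lborel (unit_cube :: (real ^ 'm::finite) set) = 2 ^ CARD('m)"
proof -
  have "(0 :: real ^ 'm) \<in> cbox (- 1) 1" by (simp add: mem_box_cart)
  then show ?thesis unfolding unit_cube_def by (subst content_cbox_cart) auto
qed

lemma emeasure_unit_cube: "emeasure lborel unit_cube < \<infinity>"
  unfolding unit_cube_def by (rule emeasure_bounded_finite) simp

lemma measurable_vec [measurable]: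
  "(\<lambda>\<omega>. (\<chi> i. \<omega> i) :: real ^ 'm) \<in> borel_measurable (\<Pi>\<^sub>M i\<in>(UNIV :: 'm::finite set). lborel)"
proof (subst borel_measurable_euclidean_space, rule ballI)
  fix b :: "real ^ 'm" assume "b \<in> Basis"
  then obtain i where "b = axis i 1" by (auto simp: Basis_vec_def)
  then show "(\<lambda>\<omega>. (\<chi> i. \<omega> i) \<bullet> b) \<in> borel_measurable (\<Pi>\<^sub>M i\<in>(UNIV :: 'm set). lborel)"
    by (simp add: inner_axis)
qed

text \<open>Box volumes determine Lebesgue measure. The product form opens the way to Fubini in a
  single chosen coordinate.\<close>

lemma lborel_vec:
  "lborel = distr (\<Pi>\<^sub>M i\<in>(UNIV :: 'm::finite set). lborel) borel (\<lambda>\<omega>. (\<chi> i. \<omega> i) :: real ^ 'm)"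
proof (rule lborel_eqI)
  interpret product_sigma_finite "\<lambda>_::'m. lborel :: real measure" ..
  fix l u :: "real ^ 'm"
  assume le: "\<And>b. b \<in> Basis \<Longrightarrow> l \<bullet> b \<le> u \<bullet> b"
  have le': "l $ i \<le> u $ i" for i
    using le[of "axis i 1"] by (simp add: inner_axis)
  have "(\<lambda>\<omega>. (\<chi> i. \<omega> i) :: real ^ 'm) -` box l u \<inter> space (\<Pi>\<^sub>M i\<in>UNIV. lborel) = (\<Pi>\<^sub>E i\<in>UNIV. {l $ i<..<u $ i})"
    by (auto simp: mem_box_cart space_PiM PiE_UNIV_domain Pi_iff)
  then have "emeasure (distr (\<Pi>\<^sub>M i\<in>UNIV. lborel) borel (\<lambda>\<omega>. (\<chi> i. \<omega> i) :: real ^ 'm)) (box l u)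
      = (\<Prod>i\<in>UNIV. ennreal (u $ i - l $ i))"
    using le' by (simp add: emeasure_distr emeasure_PiM)
  also have "\<dots> = ennreal (\<Prod>i\<in>UNIV. u $ i - l $ i)"
    using le' by (intro prod_ennreal) auto
  also have "(\<Prod>i\<in>UNIV. u $ i - l $ i) = (\<Prod>b\<in>Basis. (u - l) \<bullet> b)"
    by (simp add: Basis_vec_def axis_eq_axis prod.UNION_disjoint inner_axis cong: prod.cong)
  finally show "emeasure (distr (\<Pi>\<^sub>M i\<in>UNIV. lborel) borel (\<lambda>\<omega>. (\<chi> i. \<omega> i) :: real ^ 'm)) (box l u)
      = (\<Prod>b\<in>Basis. (u - l) \<bullet> b)" .
qed simp

text \<open>One condition that gives integrability on the cube and on every segment and is stable
  under products, powers and integration along lines.\<close>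

definition bounded_borel :: "('a::topological_space \<Rightarrow> real) \<Rightarrow> bool" where
  "bounded_borel f \<longleftrightarrow> f \<in> borel_measurable borel \<and> (\<exists>C. \<forall>x. \<bar>f x\<bar> \<le> C)"

lemma bounded_borelE:
  assumes "bounded_borel f"
  obtains C where "f \<in> borel_measurable borel" "C \<ge> 0" "\<And>x. \<bar>f x\<bar> \<le> C"
  using assms unfolding bounded_borel_def by (metis abs_ge_zero order_trans)

lemma bounded_borelI: "f \<in> borel_measurable borel \<Longrightarrow> (\<And>x. \<bar>f x\<bar> \<le> C) \<Longrightarrow> bounded_borel f"
  unfolding bounded_borel_def by blast

lemma set_integrable_bounded_borel:
  fixes f :: "'a::topological_space \<Rightarrow> real"
  assumes "bounded_borel f" "sets M = sets borel" "A \<in> sets borel" "emeasure M A < \<infinity>"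
  shows "set_integrable M A f"
  using assms(1)
proof (rule bounded_borelE)
  fix C assume C: "f \<in> borel_measurable borel" "C \<ge> 0" "\<And>x. \<bar>f x\<bar> \<le> C"
  show ?thesis unfolding set_integrable_def
    using C assms measurable_cong_sets[OF assms(2) refl, of borel]
    by (intro integrableI_bounded_set_indicator[where B=C]) auto
qed

lemma set_integrable_cube:
  "bounded_borel (f :: real ^ 'm::finite \<Rightarrow> real) \<Longrightarrow> set_integrable lborel unit_cube f"
  using emeasure_unit_cube by (intro set_integrable_bounded_borel) auto

lemma set_integrable_interval: "bounded_borel f \<Longrightarrow> set_integrable lborel {-1..1::real} f"
  by (rule set_integrable_bounded_borel) auto

text \<open>Integrating out a coordinate gives again a function on the whole space, constant in
  direction \<open>i\<close>, rather than a function of fewer variables. Coordinates can thus be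
  integrated out along a list without any change of type.\<close>

definition line_int :: "'m \<Rightarrow> (real ^ 'm::finite \<Rightarrow> real) \<Rightarrow> real ^ 'm \<Rightarrow> real" where
  "line_int i f x = (LINT t:{-1..1}|lborel. f (line x i t))"

lemma bounded_borel_line: "bounded_borel f \<Longrightarrow> bounded_borel (\<lambda>t. f (line x i t))"
  unfolding bounded_borel_def by (auto intro!: measurable_compose[where N=borel and g=f])

lemma bounded_borel_line_int:
  assumes "bounded_borel f"
  shows "bounded_borel (line_int i f)"
  using assms
proof (rule bounded_borelE)
  fix C assume C: "f \<in> borel_measurable borel" "C \<ge> 0" "\<And>x. \<bar>f x\<bar> \<le> C"
  note [measurable] = C(1)
  show ?thesis
  proof (rule bounded_borelI)
    show "line_int i f \<in> borel_measurable borel"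
      unfolding line_int_def[abs_def] set_lebesgue_integral_def by measurable
    fix x
    have "\<bar>line_int i f x\<bar> \<le> (LINT t:{-1..1}|lborel. \<bar>f (line x i t)\<bar>)"
      unfolding line_int_def
      using set_integral_norm_bound[OF set_integrable_interval[OF bounded_borel_line[OF assms]]] by simp
    also have "\<dots> \<le> (LINT t:{-1..1::real}|lborel. C)"
    proof (rule set_integral_mono)
      show "set_integrable lborel {-1..1} (\<lambda>t. \<bar>f (line x i t)\<bar>)"
        by (rule set_integrable_abs[OF set_integrable_interval[OF bounded_borel_line[OF assms]]])
      show "set_integrable lborel {-1..1} (\<lambda>t::real. C)"
        by (intro set_integrable_interval bounded_borelI[of _ "\<bar>C\<bar>"]) auto
    qed (rule C(3))
    finally show "\<bar>line_int i f x\<bar> \<le> 2 * C" by (simp add: set_lebesgue_integral_def)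
  qed
qed

text \<open>Fubini in coordinate \<open>i\<close>; the factor 2 is the length of the edge along
  which \<open>line_int i f\<close> is constant.\<close>

theorem integral_line_int:
  fixes f :: "real ^ 'm::finite \<Rightarrow> real"
  assumes f: "bounded_borel f"
  shows "(LINT x:unit_cube|lborel. line_int i f x) = 2 * (LINT x:unit_cube|lborel. f x)"
proof -
  interpret product_sigma_finite "\<lambda>_::'m. lborel :: real measure" ..
  let ?P = "PiM (UNIV :: 'm set) (\<lambda>_. lborel :: real measure)"
  let ?P' = "PiM (UNIV - {i} :: 'm set) (\<lambda>_. lborel :: real measure)"
  let ?v = "\<lambda>\<omega>. (\<chi> i. \<omega> i) :: real ^ 'm"
  note meas = measurable_vec[where 'm='m]
  have slice: "(LINT x:unit_cube|lborel. g x)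
      = (\<integral>\<omega>. indicator unit_cube (line (?v \<omega>) i 0) * (LINT t:{-1..1}|lborel. g (line (?v \<omega>) i t)) \<partial>?P')"
    if g: "bounded_borel g" for g :: "real ^ 'm \<Rightarrow> real"
  proof -
    have int: "integrable lborel (\<lambda>x. indicator unit_cube x *\<^sub>R g x)"
      using set_integrable_cube[OF g] by (simp add: set_integrable_def)
    have "(LINT x:unit_cube|lborel. g x) = (\<integral>\<omega>. indicator unit_cube (?v \<omega>) *\<^sub>R g (?v \<omega>) \<partial>?P)"
      unfolding set_lebesgue_integral_def using int
      by (subst (1) lborel_vec, subst integral_distr) (auto dest: borel_measurable_integrable)
    also have "\<dots> = (\<integral>\<omega>. indicator unit_cube (?v \<omega>) *\<^sub>R g (?v \<omega>) \<partial>(PiM (insert i (UNIV - {i})) (\<lambda>_. lborel)))"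
      by (simp add: insert_absorb)
    also have "\<dots> = (\<integral>\<omega>. (\<integral>t. indicator unit_cube (?v (fun_upd \<omega> i t)) *\<^sub>R g (?v (fun_upd \<omega> i t)) \<partial>lborel) \<partial>?P')"
    proof (rule product_integral_insert)
      have "integrable ?P (\<lambda>\<omega>. indicator unit_cube (?v \<omega>) *\<^sub>R g (?v \<omega>))"
        using int by (subst (asm) lborel_vec) (auto dest!: integrable_distr[OF meas])
      then show "integrable (PiM (insert i (UNIV - {i})) (\<lambda>_. lborel)) (\<lambda>\<omega>. indicator unit_cube (?v \<omega>) *\<^sub>R g (?v \<omega>))"
        by (simp add: insert_absorb)
    qed auto
    also have "(\<lambda>\<omega>. (\<integral>t. indicator unit_cube (?v (fun_upd \<omega> i t)) *\<^sub>R g (?v (fun_upd \<omega> i t)) \<partial>lborel))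
       = (\<lambda>\<omega>. indicator unit_cube (line (?v \<omega>) i 0) * (LINT t:{-1..1}|lborel. g (line (?v \<omega>) i t)))"
    proof
      fix \<omega> :: "'m \<Rightarrow> real"
      have v: "?v (fun_upd \<omega> i t) = line (?v \<omega>) i t" for t by (simp add: vec_eq_iff)
      \<comment> \<open>The value 0 lies in the interval, so resetting coordinate \<open>i\<close>
        to 0 leaves a test of the remaining coordinates.\<close>
      have ind: "indicator unit_cube (line (?v \<omega>) i t)
          = (indicator unit_cube (line (?v \<omega>) i 0) * indicator {-1..1} t :: real)" for t
        unfolding mem_unit_cube indicator_def by (auto split: if_splits)
      have "(\<integral>t. indicator unit_cube (line (?v \<omega>) i t) *\<^sub>R g (line (?v \<omega>) i t) \<partial>lborel)
          = (\<integral>t. indicator unit_cube (line (?v \<omega>) i 0) * (indicator {-1..1} t *\<^sub>R g (line (?v \<omega>) i t)) \<partial>lborel)"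
        by (intro Bochner_Integration.integral_cong refl, subst ind) (simp only: real_scaleR_def mult.assoc)
      then show "(\<integral>t. indicator unit_cube (?v (fun_upd \<omega> i t)) *\<^sub>R g (?v (fun_upd \<omega> i t)) \<partial>lborel)
          = indicator unit_cube (line (?v \<omega>) i 0) * (LINT t:{-1..1}|lborel. g (line (?v \<omega>) i t))"
        unfolding v set_lebesgue_integral_def by simp
    qed
    finally show ?thesis .
  qed
  have "(LINT t:{-1..1}|lborel. line_int i f (line (?v \<omega>) i t)) = 2 * (LINT t:{-1..1}|lborel. f (line (?v \<omega>) i t))" for \<omega>
    by (simp add: line_int_def set_lebesgue_integral_def)
  then show ?thesis
    by (simp add: slice[OF f] slice[OF bounded_borel_line_int[OF f]] mult.left_commute)
qed

lemma bounded_borel_const: "bounded_borel (\<lambda>_. c)"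
  by (rule bounded_borelI[of _ "\<bar>c\<bar>"]) auto

lemma bounded_borel_abs: "bounded_borel f \<Longrightarrow> bounded_borel (\<lambda>x. \<bar>f x\<bar>)"
  unfolding bounded_borel_def by auto

lemma bounded_borel_mult:
  assumes "bounded_borel f" "bounded_borel g"
  shows "bounded_borel (\<lambda>x. f x * g x)"
proof -
  obtain C D where C: "f \<in> borel_measurable borel" "C \<ge> 0" "\<And>x. \<bar>f x\<bar> \<le> C"
    and D: "g \<in> borel_measurable borel" "D \<ge> 0" "\<And>x. \<bar>g x\<bar> \<le> D"
    using assms by (auto elim!: bounded_borelE)
  then show ?thesis
    by (intro bounded_borelI[where C="C * D"]) (auto simp: abs_mult intro!: mult_mono)
qed

lemma bounded_borel_prod:
  "(\<And>i. i \<in> K \<Longrightarrow> bounded_borel (f i)) \<Longrightarrow> bounded_borel (\<lambda>x. \<Prod>i\<in>K. f i x)"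
  by (induction K rule: infinite_finite_induct) (auto intro: bounded_borel_mult bounded_borel_const)

lemma bounded_borel_powr:
  assumes "bounded_borel f" "\<And>x. f x \<ge> 0" "p \<ge> 0"
  shows "bounded_borel (\<lambda>x. f x powr p)"
proof -
  obtain C where C: "f \<in> borel_measurable borel" "C \<ge> 0" "\<And>x. \<bar>f x\<bar> \<le> C"
    using assms by (auto elim!: bounded_borelE)
  have "f x \<le> C" for x using C(3)[of x] by simp
  then show ?thesis
    using C assms by (intro bounded_borelI[where C="C powr p"]) (auto intro!: powr_mono2)
qed

lemma line_int_nonneg: "(\<And>x. f x \<ge> 0) \<Longrightarrow> line_int i f x \<ge> 0"
  unfolding line_int_def set_lebesgue_integral_def by (intro Bochner_Integration.integral_nonneg) auto

lemma line_int_mono: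
  assumes "bounded_borel f" "bounded_borel g" "\<And>x. f x \<le> g x"
  shows "line_int i f x \<le> line_int i g x"
  unfolding line_int_def using assms
  by (intro set_integral_mono set_integrable_interval bounded_borel_line) auto

definition indep_coord :: "'m \<Rightarrow> (real ^ 'm::finite \<Rightarrow> real) \<Rightarrow> bool" where
  "indep_coord i f \<longleftrightarrow> (\<forall>x t. f (line x i t) = f x)"

lemma indep_coord_line_int_same: "indep_coord i (line_int i f)"
  by (simp add: indep_coord_def line_int_def)

lemma indep_coord_line_int:
  assumes "indep_coord j f"
  shows "indep_coord j (line_int i f)"
proof (cases "i = j")
  case False
  have "f (line (line x j t) i s) = f (line x i s)" for x s t
    using assms line_commute[of j i x t s] False by (simp add: indep_coord_def)
  then show ?thesis by (simp add: indep_coord_def line_int_def)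
qed (simp add: indep_coord_line_int_same)

section \<open>Hoelder's inequality for several factors and its iteration\<close>

lemma set_lebesgue_integral_finite_sum:
  fixes f :: "'i \<Rightarrow> 'a \<Rightarrow> real"
  assumes "\<And>j. j \<in> J \<Longrightarrow> set_integrable M A (f j)"
  shows "set_integrable M A (\<lambda>x. \<Sum>j\<in>J. f j x)"
    and "(LINT x:A|M. (\<Sum>j\<in>J. f j x)) = (\<Sum>j\<in>J. LINT x:A|M. f j x)"
  using assms unfolding set_integrable_def set_lebesgue_integral_def scaleR_sum_right
  by (auto intro: Bochner_Integration.integrable_sum Bochner_Integration.integral_sum)

text \<open>If some factor has integral 0, the product vanishes almost everywhere. Otherwise
  normalise every factor to integral 1 and apply the arithmetic-geometric mean inequality
  pointwise.\<close>

lemma Hoelder_prod: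
  fixes h :: "'j \<Rightarrow> real \<Rightarrow> real"
  assumes J: "finite J" "J \<noteq> {}" and h: "\<And>j. j \<in> J \<Longrightarrow> bounded_borel (h j)" "\<And>j t. h j t \<ge> 0"
  defines "p \<equiv> 1 / real (card J)"
  shows "(LINT t:{-1..1}|lborel. \<Prod>j\<in>J. h j t powr p) \<le> (\<Prod>j\<in>J. (LINT t:{-1..1}|lborel. h j t) powr p)"
proof -
  define a where "a j = (LINT t:{-1..1}|lborel. h j t)" for j
  have card: "card J > 0" using J by (simp add: card_gt_0_iff)
  then have p: "p > 0" by (simp add: p_def)
  have a: "a j \<ge> 0" for j
    unfolding a_def set_lebesgue_integral_def using h(2) by (intro Bochner_Integration.integral_nonneg) auto
  have int: "set_integrable lborel {-1..1} (h j)" if "j \<in> J" for j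
    using h(1)[OF that] by (rule set_integrable_interval)
  show ?thesis
  proof (cases "\<exists>j\<in>J. a j = 0")
    case True
    then obtain j where j: "j \<in> J" "a j = 0" by blast
    have "AE t in lborel. indicator {-1..1} t *\<^sub>R h j t = 0"
      using j int[OF j(1)] h(2) unfolding a_def set_lebesgue_integral_def set_integrable_def
      by (subst (asm) integral_nonneg_eq_0_iff_AE) auto
    then have "AE t in lborel. indicator {-1..1} t *\<^sub>R (\<Prod>j\<in>J. h j t powr p) = 0"
    proof eventually_elim
      case (elim t)
      then show ?case using J(1) j(1) by (auto simp: indicator_def split: if_splits)
    qed
    then have "(LINT t:{-1..1}|lborel. \<Prod>j\<in>J. h j t powr p) = 0"
      unfolding set_lebesgue_integral_def by (rule integral_eq_zero_AE)
    then show ?thesis by (simp add: prod_nonneg)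
  next
    case False
    then have apos: "a j > 0" if "j \<in> J" for j using a[of j] that by force
    define A where "A = (\<Prod>j\<in>J. a j powr p)"
    have A: "A > 0" unfolding A_def by (intro prod_pos) (use apos in force)
    have pw: "(\<Prod>j\<in>J. h j t powr p) \<le> A * (\<Sum>j\<in>J. p / a j * h j t)" for t
    proof -
      have "(\<Prod>j\<in>J. h j t powr p) = A * (\<Prod>j\<in>J. h j t / a j) powr p"
        unfolding A_def using apos h(2) a
        by (simp add: prod_powr_distrib[symmetric] powr_divide prod_dividef prod_nonneg)
           (metis (mono_tags, lifting) less_irrefl nonzero_mult_div_cancel_left powr_eq_0_iff prod_pos)
      also have "\<dots> \<le> A * (\<Sum>j\<in>J. h j t / a j / card J)"
        using arith_geom_mean[OF J, of "\<lambda>j. h j t / a j"] h(2) a A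
        by (intro mult_left_mono) (auto simp: p_def)
      also have "(\<Sum>j\<in>J. h j t / a j / card J) = (\<Sum>j\<in>J. p / a j * h j t)"
        by (simp add: p_def field_simps)
      finally show ?thesis .
    qed
    have sint: "set_integrable lborel {-1..1} (\<lambda>t. \<Sum>j\<in>J. p / a j * h j t)"
      by (intro set_lebesgue_integral_finite_sum(1) set_integrable_mult_right int)
    have "(LINT t:{-1..1}|lborel. \<Prod>j\<in>J. h j t powr p) \<le> (LINT t:{-1..1}|lborel. A * (\<Sum>j\<in>J. p / a j * h j t))"
    proof (rule set_integral_mono)
      show "set_integrable lborel {-1..1} (\<lambda>t. \<Prod>j\<in>J. h j t powr p)"
        using h p by (intro set_integrable_interval bounded_borel_prod bounded_borel_powr) auto
      show "set_integrable lborel {-1..1} (\<lambda>t. A * (\<Sum>j\<in>J. p / a j * h j t))"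
        by (intro set_integrable_mult_right sint)
    qed (rule pw)
    also have "\<dots> = A * (\<Sum>j\<in>J. p / a j * a j)"
      using int by (simp add: a_def set_lebesgue_integral_finite_sum(2) set_integrable_mult_right)
    also have "(\<Sum>j\<in>J. p / a j * a j) = (\<Sum>j\<in>J. p)"
      by (rule sum.cong) (use apos in force)+
    also have "A * \<dots> = A"
      using card by (simp add: p_def)
    finally show ?thesis unfolding A_def a_def .
  qed
qed

lemma foldr_line_int_props:
  assumes "bounded_borel f"
  shows "bounded_borel (foldr line_int xs f)"
    and "(\<And>x. f x \<ge> 0) \<Longrightarrow> foldr line_int xs f x \<ge> 0"
    and "indep_coord i f \<or> i \<in> set xs \<Longrightarrow> indep_coord i (foldr line_int xs f)"
    and "(LINT x:unit_cube|lborel. foldr line_int xs f x) = 2 ^ length xs * (LINT x:unit_cube|lborel. f x)"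
proof -
  show bb: "bounded_borel (foldr line_int xs f)" for xs
    by (induction xs) (auto simp: assms bounded_borel_line_int)
  show "foldr line_int xs f x \<ge> 0" if "\<And>x. f x \<ge> 0"
    by (induction xs arbitrary: x) (auto simp: that line_int_nonneg)
  show "indep_coord i (foldr line_int xs f)" if "indep_coord i f \<or> i \<in> set xs"
    using that by (induction xs) (auto simp: indep_coord_line_int_same indep_coord_line_int)
  show "(LINT x:unit_cube|lborel. foldr line_int xs f x) = 2 ^ length xs * (LINT x:unit_cube|lborel. f x)"
    by (induction xs) (auto simp: integral_line_int[OF bb])
qed

text \<open>Move from \<open>x\<close> to \<open>y\<close> by replacing one coordinate at a
  time.\<close>

lemma indep_all_coords_const:
  assumes "\<And>i. indep_coord i f"
  shows "f x = f y"
proof -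
  obtain xs :: "'a list" where xs: "set xs = UNIV" using finite_list[OF finite] by blast
  have "f (foldr (\<lambda>j z. line z j (y $ j)) ys x) = f x" for ys
    using assms by (induction ys) (auto simp: indep_coord_def)
  moreover have "foldr (\<lambda>j z. line z j (y $ j)) ys x $ k = (if k \<in> set ys then y $ k else x $ k)" for ys k
    by (induction ys) auto
  then have "foldr (\<lambda>j z. line z j (y $ j)) xs x = y" by (simp add: vec_eq_iff xs)
  ultimately show ?thesis by metis
qed

lemma integral_unit_cube_indep:
  fixes f :: "real ^ 'm::finite \<Rightarrow> real"
  assumes "\<And>i. indep_coord i f"
  shows "(LINT x:unit_cube|lborel. f x) = 2 ^ CARD('m) * f 0"
proof -
  have "f = (\<lambda>_. f 0)" using indep_all_coords_const[OF assms] by blast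
  then have "(LINT x:unit_cube|lborel. f x) = (LINT x:(unit_cube :: (real ^ 'm) set)|lborel. f 0)" by metis
  also have "\<dots> = 2 ^ CARD('m) * f 0"
    by (simp add: set_lebesgue_integral_def measure_unit_cube)
  finally show ?thesis .
qed

text \<open>When coordinate \<open>j\<close> is integrated out, the factor with index
  \<open>j\<close> does not depend on it and comes out of the integral; Hoelder with
  \<open>CARD('m) - 1\<close> equal exponents handles the others. So the \<open>i\<close>-th factor
  is integrated in all listed coordinates except its own, which is the purpose of
  \<open>filter\<close>.\<close>

lemma Loomis_Whitney_iterated:
  fixes f :: "'m::finite \<Rightarrow> real ^ 'm \<Rightarrow> real"
  assumes card: "CARD('m) \<ge> 2"
    and f: "\<And>i. bounded_borel (f i)" "\<And>i x. f i x \<ge> 0" "\<And>i. indep_coord i (f i)"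
    and "distinct xs"
  defines "p \<equiv> 1 / (real CARD('m) - 1)"
  shows "foldr line_int xs (\<lambda>x. \<Prod>i\<in>UNIV. f i x powr p) x
      \<le> (\<Prod>i\<in>UNIV. foldr line_int (filter (\<lambda>j. j \<noteq> i) xs) (f i) x powr p)"
  using \<open>distinct xs\<close>
proof (induction xs arbitrary: x)
  case (Cons j xs)
  define F where "F i = foldr line_int (filter (\<lambda>j. j \<noteq> i) xs) (f i)" for i
  have p: "p > 0" using card by (simp add: p_def)
  have F: "bounded_borel (F i)" "F i y \<ge> 0" "indep_coord i (F i)" for i y
    unfolding F_def using f by (auto intro!: foldr_line_int_props)
  have bbp: "bounded_borel (\<lambda>x. \<Prod>i\<in>K. F i x powr p)" for K
    using F p by (intro bounded_borel_prod bounded_borel_powr) auto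
  have split: "(\<Prod>i\<in>UNIV. g i) = g j * (\<Prod>i\<in>UNIV - {j}. g i)" for g :: "'m \<Rightarrow> real"
    by (rule prod.remove) auto
  have cardj: "real (card (UNIV - {j})) = real CARD('m) - 1"
    using card by (simp add: card_Diff_singleton of_nat_diff)
  have ne: "UNIV - {j} \<noteq> {}" using cardj card by force
  have "foldr line_int (j # xs) (\<lambda>x. \<Prod>i\<in>UNIV. f i x powr p) x
      \<le> line_int j (\<lambda>x. \<Prod>i\<in>UNIV. F i x powr p) x"
    using Cons f p bbp F(2) by (auto simp: F_def intro!: line_int_mono foldr_line_int_props(1) bounded_borel_prod bounded_borel_powr)
  also have "\<dots> = F j x powr p * (LINT t:{-1..1}|lborel. \<Prod>i\<in>UNIV - {j}. F i (line x j t) powr p)"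
    using F(3)[of j] by (simp add: line_int_def split indep_coord_def)
  also have "\<dots> \<le> F j x powr p * (\<Prod>i\<in>UNIV - {j}. line_int j (F i) x powr p)"
    using Hoelder_prod[of "UNIV - {j}" "\<lambda>i t. F i (line x j t)"] ne bounded_borel_line[OF F(1)] F(2) cardj
    by (intro mult_left_mono) (auto simp: line_int_def p_def)
  also have "\<dots> = (\<Prod>i\<in>UNIV. foldr line_int (filter (\<lambda>k. k \<noteq> i) (j # xs)) (f i) x powr p)"
    unfolding split by (intro arg_cong2[where f="(*)"] prod.cong) (auto simp: F_def)
  finally show ?case .
qed simp

text \<open>Once all coordinates are integrated out both sides are constant, so the iterated
  inequality can be read off at 0. The division by 2 removes the edge in direction \<open>i\<close>,
  along which \<open>f i\<close> is constant.\<close>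

theorem Loomis_Whitney:
  fixes f :: "'m::finite \<Rightarrow> real ^ 'm \<Rightarrow> real"
  assumes card: "CARD('m) \<ge> 2"
    and f: "\<And>i. bounded_borel (f i)" "\<And>i x. f i x \<ge> 0" "\<And>i. indep_coord i (f i)"
  defines "p \<equiv> 1 / (real CARD('m) - 1)"
  shows "(LINT x:unit_cube|lborel. \<Prod>i\<in>UNIV. f i x powr p)
      \<le> (\<Prod>i\<in>UNIV. ((LINT x:unit_cube|lborel. f i x) / 2) powr p)"
proof -
  obtain xs :: "'m list" where xs: "set xs = UNIV" "distinct xs"
    using finite_distinct_list[OF finite] by blast
  have p: "p > 0" using card by (simp add: p_def)
  have len: "length xs = CARD('m)" using distinct_card[OF xs(2)] xs(1) by simp
  have len': "length (filter (\<lambda>j. j \<noteq> i) xs) = CARD('m) - 1" for i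
  proof -
    have "set (filter (\<lambda>j. j \<noteq> i) xs) = UNIV - {i}" using xs(1) by auto
    then show ?thesis
      using distinct_card[OF distinct_filter[OF xs(2), of "\<lambda>j. j \<noteq> i"]] by (simp add: card_Diff_singleton)
  qed
  have bb: "bounded_borel (\<lambda>x. \<Prod>i\<in>UNIV. f i x powr p)"
    using f p by (intro bounded_borel_prod bounded_borel_powr) auto
  have "2 ^ CARD('m) * foldr line_int xs (\<lambda>x. \<Prod>i\<in>UNIV. f i x powr p) 0
      = (LINT x:unit_cube|lborel. foldr line_int xs (\<lambda>x. \<Prod>i\<in>UNIV. f i x powr p) x)"
    using foldr_line_int_props(3)[OF bb, of _ xs] xs(1) by (intro integral_unit_cube_indep[symmetric]) auto
  then have 1: "(LINT x:unit_cube|lborel. \<Prod>i\<in>UNIV. f i x powr p)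
      = foldr line_int xs (\<lambda>x. \<Prod>i\<in>UNIV. f i x powr p) 0"
    using foldr_line_int_props(4)[OF bb, of xs] by (simp add: len)
  have 2: "foldr line_int (filter (\<lambda>j. j \<noteq> i) xs) (f i) 0 = (LINT x:unit_cube|lborel. f i x) / 2" for i
  proof -
    have "2 ^ CARD('m) * foldr line_int (filter (\<lambda>j. j \<noteq> i) xs) (f i) 0
        = (LINT x:unit_cube|lborel. foldr line_int (filter (\<lambda>j. j \<noteq> i) xs) (f i) x)"
    proof (rule integral_unit_cube_indep[symmetric])
      show "indep_coord k (foldr line_int (filter (\<lambda>j. j \<noteq> i) xs) (f i))" for k
        using f xs(1) by (cases "k = i") (auto intro!: foldr_line_int_props(3))
    qed
    also have "\<dots> = 2 ^ (CARD('m) - 1) * (LINT x:unit_cube|lborel. f i x)"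
      using foldr_line_int_props(4)[OF f(1)] by (simp add: len')
    also have "(2::real) ^ CARD('m) = 2 * 2 ^ (CARD('m) - 1)"
      using card by (cases "CARD('m)") auto
    finally show ?thesis by simp
  qed
  show ?thesis
    unfolding 1 using Loomis_Whitney_iterated[OF card f xs(2), of 0] by (simp add: 2 p_def)
qed

text \<open>Multiply the one-dimensional bounds \<open>GD\<close> over all directions, each raised
  to the power \<open>p\<close>; since \<open>q = CARD('m) * p\<close>, the left side becomes
  \<open>G x powr q\<close>. The right side is a Loomis-Whitney product, and its halves cancel the
  factor 2 of \<open>integral_line_int\<close>.\<close>

theorem Gagliardo_Nirenberg_unit_cube:
  fixes G :: "real ^ 'm::finite \<Rightarrow> real"
  assumes card: "CARD('m) \<ge> 2"
    and G: "bounded_borel G" "\<And>x. G x \<ge> 0"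
    and D: "\<And>i. bounded_borel (D i)"
    and GD: "\<And>x i. x \<in> unit_cube \<Longrightarrow> G x \<le> line_int i (\<lambda>x. \<bar>D i x\<bar>) x"
    and N: "\<And>i. (LINT x:unit_cube|lborel. \<bar>D i x\<bar>) \<le> N"
  defines "q \<equiv> real CARD('m) / (real CARD('m) - 1)"
  shows "(LINT x:unit_cube|lborel. G x powr q) \<le> N powr q"
proof -
  define p where "p = 1 / (real CARD('m) - 1)"
  have p: "p > 0" "q = real CARD('m) * p" using card by (simp_all add: p_def q_def)
  let ?f = "\<lambda>i. line_int i (\<lambda>x. \<bar>D i x\<bar>)"
  have f: "bounded_borel (?f i)" "?f i x \<ge> 0" "indep_coord i (?f i)" for i x
    using D by (auto intro!: bounded_borel_line_int bounded_borel_abs line_int_nonneg indep_coord_line_int_same)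
  have powers: "x powr q = (\<Prod>i\<in>(UNIV :: 'm set). x powr p)" if "x \<ge> 0" for x
    using that by (cases "x = 0") (simp_all add: p powr_realpow[symmetric] powr_powr mult.commute)
  have nonneg: "(LINT x:unit_cube|lborel. \<bar>D i x\<bar>) \<ge> 0" for i
    unfolding set_lebesgue_integral_def by (intro Bochner_Integration.integral_nonneg) auto
  have "(LINT x:unit_cube|lborel. G x powr q) \<le> (LINT x:unit_cube|lborel. \<Prod>i\<in>UNIV. ?f i x powr p)"
  proof (rule set_integral_mono)
    show "set_integrable lborel unit_cube (\<lambda>x. G x powr q)"
      using G p by (intro set_integrable_cube bounded_borel_powr) auto
    show "set_integrable lborel unit_cube (\<lambda>x. \<Prod>i\<in>UNIV. ?f i x powr p)"
      using f p by (intro set_integrable_cube bounded_borel_prod bounded_borel_powr) auto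
    show "G x powr q \<le> (\<Prod>i\<in>UNIV. ?f i x powr p)" if "x \<in> unit_cube" for x
      unfolding powers[OF G(2)] using that G p GD by (intro prod_mono conjI powr_mono2) auto
  qed
  also have "\<dots> \<le> (\<Prod>i\<in>UNIV. ((LINT x:unit_cube|lborel. ?f i x) / 2) powr p)"
    unfolding p_def by (rule Loomis_Whitney[OF card f])
  also have "\<dots> = (\<Prod>i\<in>UNIV. (LINT x:unit_cube|lborel. \<bar>D i x\<bar>) powr p)"
    using D by (simp add: integral_line_int bounded_borel_abs)
  also have "\<dots> \<le> (\<Prod>i\<in>(UNIV :: 'm set). N powr p)"
    using p N nonneg by (intro prod_mono conjI powr_mono2) auto
  also have "\<dots> = N powr q"
    using N nonneg by (intro powers[symmetric]) (meson order_trans)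
  finally show ?thesis .
qed

subsection \<open>The divergence theorem and the Sobolev inequality on the ball\<close>

text \<open>Affine in the squared norm, so that its gradient on the shell is
  \<open>- 2 / (1 - r\<^sup>2)\<close> times the position vector, with no square root. Along a
  coordinate line the squared norm is a constant plus \<open>t\<^sup>2\<close>, and the kinks are
  roots of two quadratic equations.\<close>

definition cutoff :: "real \<Rightarrow> real ^ 'm::finite \<Rightarrow> real" where
  "cutoff r x = max 0 (min 1 ((1 - (norm x)\<^sup>2) / (1 - r\<^sup>2)))"

lemma cutoff_bounds: "0 \<le> cutoff r x" "cutoff r x \<le> 1"
  by (auto simp: cutoff_def)

lemma continuous_on_cutoff [continuous_intros]: "continuous_on S (cutoff r)"
  unfolding cutoff_def[abs_def] divide_inverse by (intro continuous_intros)

lemma cutoff_eq: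
  assumes "0 < r" "r < 1"
  shows "norm x \<ge> 1 \<Longrightarrow> cutoff r x = 0"
    and "norm x \<le> r \<Longrightarrow> cutoff r x = 1"
    and "r \<le> norm x \<Longrightarrow> norm x \<le> 1 \<Longrightarrow> cutoff r x = (1 - (norm x)\<^sup>2) / (1 - r\<^sup>2)"
proof -
  have r: "1 - r\<^sup>2 > 0" using assms by (simp add: power_less_one_iff)
  show "cutoff r x = 0" if "norm x \<ge> 1"
  proof -
    have "1 - (norm x)\<^sup>2 \<le> 0" using that by (simp add: one_le_power)
    then show ?thesis using r by (simp add: cutoff_def divide_nonpos_pos)
  qed
  show "cutoff r x = 1" if "norm x \<le> r"
  proof -
    have "(norm x)\<^sup>2 \<le> r\<^sup>2" using that by (intro power_mono) auto
    then show ?thesis using r by (simp add: cutoff_def)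
  qed
  show "cutoff r x = (1 - (norm x)\<^sup>2) / (1 - r\<^sup>2)" if "r \<le> norm x" "norm x \<le> 1"
  proof -
    have "r\<^sup>2 \<le> (norm x)\<^sup>2" "(norm x)\<^sup>2 \<le> 1"
      using that assms by (auto intro!: power_mono simp: power_le_one)
    then show ?thesis using r by (simp add: cutoff_def)
  qed
qed

lemma norm_line_squared: "(norm (line x i t))\<^sup>2 = (norm (line x i 0))\<^sup>2 + t\<^sup>2"
proof -
  have "line x i 0 \<bullet> axis i 1 = 0" by (simp add: inner_axis)
  then show ?thesis
    unfolding line_eq[of x i t] power2_norm_eq_inner
    by (simp add: inner_add_left inner_add_right inner_commute power2_eq_square)
qed

lemma unit_ball_subset_cube: "cball 0 1 \<subseteq> unit_cube"
proof
  fix x :: "real ^ 'm" assume "x \<in> cball 0 1"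
  then have "\<bar>x $ i\<bar> \<le> 1" for i using component_le_norm_cart[of x i] by simp
  then show "x \<in> unit_cube" by (simp add: mem_unit_cube abs_le_iff minus_le_iff)
qed

lemma bounded_borel_indicator_ball:
  fixes h :: "real ^ 'm::finite \<Rightarrow> real"
  assumes "continuous_on (cball 0 1) h" "A \<subseteq> cball 0 1" "A \<in> sets borel"
  shows "bounded_borel (\<lambda>x. indicator A x * h x)"
proof -
  have "bounded (h ` cball 0 1)"
    using assms(1) compact_cball compact_continuous_image compact_imp_bounded by blast
  then obtain C where C: "\<forall>y\<in>h ` cball 0 1. norm y \<le> C"
    unfolding bounded_iff by blast
  have "continuous_on A h" using assms continuous_on_subset by blast
  then have "(\<lambda>x. indicator A x *\<^sub>R h x) \<in> borel_measurable borel"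
    using assms(3) by (rule borel_measurable_continuous_on_indicator[rotated])
  moreover have "\<bar>indicator A x * h x\<bar> \<le> \<bar>C\<bar>" for x
  proof (cases "x \<in> A")
    case True
    then have "\<bar>h x\<bar> \<le> C" using C assms(2) by auto
    then show ?thesis using True by simp
  qed simp
  ultimately show ?thesis by (intro bounded_borelI) auto
qed

lemma integral_cube_indicator:
  assumes "A \<subseteq> unit_cube"
  shows "(LINT x:unit_cube|lborel. indicator A x * h x) = (LINT x:A|lborel. (h x :: real))"
  unfolding set_lebesgue_integral_def
  by (intro Bochner_Integration.integral_cong) (use assms in \<open>auto simp: indicator_def\<close>)

lemma cutoff_radii_tendsto:
  assumes "x \<in> ball 0 1"
  shows "(\<lambda>k. cutoff (radii k) x) \<longlonglongrightarrow> 1"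
proof -
  have "\<forall>\<^sub>F k in sequentially. norm x < radii k"
    using radii_tendsto assms by (intro order_tendstoD) auto
  then have "\<forall>\<^sub>F k in sequentially. cutoff (radii k) x = 1"
    by eventually_elim (simp add: cutoff_eq(2)[OF radii])
  then show ?thesis by (rule tendsto_eventually)
qed

text \<open>The exponent \<open>a\<close> is 1 for the divergence theorem and the Sobolev exponent
  for the zero extension.\<close>

lemma cutoff_integral_tendsto:
  fixes h :: "real ^ 'm::finite \<Rightarrow> real"
  assumes h: "continuous_on (cball 0 1) h" and a: "a > 0"
  shows "(\<lambda>k. LINT x:ball 0 1|lborel. cutoff (radii k) x powr a * h x) \<longlonglongrightarrow> (LINT x:ball 0 1|lborel. h x)"
  unfolding set_lebesgue_integral_def
proof (rule integral_dominated_convergence)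
  note int = set_integrable_ball
  show "(\<lambda>x. indicator (ball 0 1) x *\<^sub>R h x) \<in> borel_measurable lborel"
    using int[OF h] unfolding set_integrable_def by (rule borel_measurable_integrable)
  have "continuous_on (cball 0 1) (\<lambda>x. cutoff (radii k) x powr a * h x)" for k
    using a by (intro continuous_on_mult continuous_on_powr' continuous_on_cutoff continuous_on_const h)
      (auto simp: cutoff_bounds)
  from int[OF this] show "(\<lambda>x. indicator (ball 0 1) x *\<^sub>R (cutoff (radii k) x powr a * h x)) \<in> borel_measurable lborel" for k
    unfolding set_integrable_def by (rule borel_measurable_integrable)
  show "integrable lborel (\<lambda>x. norm (indicator (ball 0 1) x *\<^sub>R h x))"
    using int[OF h] unfolding set_integrable_def by (rule integrable_norm)
  show "AE x in lborel. (\<lambda>k. indicator (ball 0 1) x *\<^sub>R (cutoff (radii k) x powr a * h x)) \<longlonglongrightarrow> indicator (ball 0 1) x *\<^sub>R h x"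
  proof (intro AE_I2)
    fix x :: "real ^ 'm"
    show "(\<lambda>k. indicator (ball 0 1) x *\<^sub>R (cutoff (radii k) x powr a * h x)) \<longlonglongrightarrow> indicator (ball 0 1) x *\<^sub>R h x"
    proof (cases "x \<in> ball 0 1")
      case True
      then have "(\<lambda>k. cutoff (radii k) x powr a * h x) \<longlonglongrightarrow> 1 powr a * h x"
        by (intro tendsto_intros cutoff_radii_tendsto) auto
      then show ?thesis using True by simp
    qed simp
  qed
  show "AE x in lborel. norm (indicator (ball 0 1) x *\<^sub>R (cutoff (radii k) x powr a * h x)) \<le> norm (indicator (ball 0 1) x *\<^sub>R h x)" for k
  proof (intro AE_I2)
    fix x :: "real ^ 'm"
    have "cutoff (radii k) x powr a \<le> 1"
      using a cutoff_bounds[of "radii k" x] by (intro powr_le1) auto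
    then show "norm (indicator (ball 0 1) x *\<^sub>R (cutoff (radii k) x powr a * h x)) \<le> norm (indicator (ball 0 1) x *\<^sub>R h x)"
      by (auto simp: indicator_def abs_mult mult_left_le_one_le)
  qed
qed

section \<open>Zero extension of a function multiplied by the cutoff\<close>

locale smooth_near_ball =
  fixes U :: "(real ^ 'm::finite) set" and f :: "real ^ 'm \<Rightarrow> real"
  assumes open_U: "open U" and ball_U: "cball 0 1 \<subseteq> U" and smooth: "smooth_on U f"
begin

lemma continuous_f: "continuous_on (cball 0 1) f"
  by (rule smooth_on_continuous_on[OF open_U smooth ball_U])

lemma continuous_partial: "continuous_on (cball 0 1) (partial_deriv i f)"
  by (rule smooth_on_continuous_on[OF open_U smooth_on_partial_deriv[OF open_U smooth] ball_U])

definition cut :: "real \<Rightarrow> real ^ 'm \<Rightarrow> real" where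
  "cut r x = indicator (ball 0 1) x * (cutoff r x * f x)"

text \<open>The partial derivative of \<open>cut\<close> away from the spheres of radius
  \<open>r\<close> and 1. Its values on these are immaterial, as a coordinate line meets them in
  finitely many points.\<close>

definition cut_deriv :: "real \<Rightarrow> 'm \<Rightarrow> real ^ 'm \<Rightarrow> real" where
  "cut_deriv r i x = indicator (ball 0 1) x * (cutoff r x * partial_deriv i f x)
     - indicator (shell r) x * (2 / (1 - r\<^sup>2) * (x $ i * f x))"

lemma shell_subset: "shell r \<subseteq> (cball 0 1 :: (real ^ 'm) set)" "(shell r :: (real ^ 'm) set) \<in> sets borel"
  by (auto simp: shell_def)

lemma bounded_borel_cut: "bounded_borel (cut r)"
  unfolding cut_def[abs_def]
  by (intro bounded_borel_indicator_ball continuous_on_mult continuous_f continuous_on_cutoff) auto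

lemma bounded_borel_shell: "bounded_borel (\<lambda>x. indicator (shell r) x * (c * (x $ i * f x)))"
  using shell_subset
  by (intro bounded_borel_indicator_ball continuous_intros continuous_f) auto

lemma bounded_borel_ball_partial:
  "bounded_borel (\<lambda>x. indicator (ball 0 1) x * (cutoff r x * partial_deriv i f x))"
  by (intro bounded_borel_indicator_ball continuous_on_mult continuous_partial continuous_on_cutoff) auto

lemma bounded_borel_cut_deriv: "bounded_borel (cut_deriv r i)"
proof -
  have diff: "bounded_borel (\<lambda>x. g x - h x)" if g: "bounded_borel g" and h: "bounded_borel h"
    for g h :: "real ^ 'm \<Rightarrow> real"
  proof -
    obtain C D where "g \<in> borel_measurable borel" "\<And>x. \<bar>g x\<bar> \<le> C" "h \<in> borel_measurable borel" "\<And>x. \<bar>h x\<bar> \<le> D"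
      using g h unfolding bounded_borel_def by metis
    then show ?thesis
      by (intro bounded_borelI[where C="C + D"]) (auto intro: order_trans[OF abs_triangle_ineq4 add_mono])
  qed
  show ?thesis
    unfolding cut_deriv_def[abs_def] by (intro diff bounded_borel_ball_partial bounded_borel_shell)
qed

context
  fixes r :: real
  assumes r: "0 < r" "r < 1"
begin

lemma cut_eq: "x \<notin> ball 0 1 \<Longrightarrow> cut r x = 0" "norm x \<le> 1 \<Longrightarrow> cut r x = cutoff r x * f x"
  using cutoff_eq(1)[OF r, of x] by (auto simp: cut_def indicator_def)

lemma continuous_cut: "continuous_on UNIV (cut r)"
proof -
  have "continuous_on (cball 0 1) (\<lambda>x. cutoff r x * f x)"
    by (intro continuous_on_mult continuous_f continuous_on_cutoff)
  then have "continuous_on (cball 0 1) (cut r)"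
    by (rule continuous_on_eq) (simp add: cut_eq)
  moreover have "continuous_on (- ball 0 1) (cut r)"
    using continuous_on_const[of "- ball 0 1" 0] by (rule continuous_on_eq) (simp add: cut_eq)
  ultimately have "continuous_on (cball 0 1 \<union> - ball 0 1) (cut r)"
    by (intro continuous_on_closed_Un) (auto simp: closed_Compl)
  moreover have "cball 0 1 \<union> - ball 0 1 = (UNIV :: (real ^ 'm) set)" by auto
  ultimately show ?thesis by simp
qed

lemma cut_line_derivative:
  assumes t: "(norm (line x i t))\<^sup>2 \<noteq> 1" "(norm (line x i t))\<^sup>2 \<noteq> r\<^sup>2"
  shows "((\<lambda>t. cut r (line x i t)) has_real_derivative cut_deriv r i (line x i t)) (at t)"
proof -
  define b where "b = (norm (line x i 0))\<^sup>2"
  have n: "(norm (line x i s))\<^sup>2 = b + s\<^sup>2" for s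
    unfolding b_def by (rule norm_line_squared)
  have r2: "0 < r\<^sup>2" "r\<^sup>2 < 1" using r by (auto simp: power_less_one_iff)
  have lt1: "norm (line x i s) < 1 \<longleftrightarrow> b + s\<^sup>2 < 1" for s
    unfolding n[symmetric] by (simp add: abs_square_less_1[of "norm (line x i s)", simplified])
  have ltr: "norm (line x i s) < r \<longleftrightarrow> b + s\<^sup>2 < r\<^sup>2" for s
    unfolding n[symmetric] using r by (metis norm_ge_zero less_imp_le power2_less_imp_less power_strict_mono zero_less_numeral)
  have df: "((\<lambda>t. f (line x i t)) has_real_derivative partial_deriv i f (line x i t)) (at t)" if "b + t\<^sup>2 < 1"
  proof -
    have "line x i t \<in> U" using lt1[of t] that ball_U by auto
    then have "f differentiable (at (line x i 0 + t *\<^sub>R axis i 1))"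
      using smooth_on_differentiable[OF open_U smooth] line_eq[of x i t] by simp
    from line_derivative[OF this] show ?thesis by (simp add: line_eq[of x i, symmetric])
  qed
  consider "b + t\<^sup>2 < r\<^sup>2" | "r\<^sup>2 < b + t\<^sup>2" "b + t\<^sup>2 < 1" | "1 < b + t\<^sup>2"
    using t unfolding n by linarith
  then show ?thesis
  proof cases
    case 1
    have "((\<lambda>t. cut r (line x i t)) has_real_derivative partial_deriv i f (line x i t)) (at t)"
    proof (rule has_field_derivative_transform_within_open[OF df])
      show "b + t\<^sup>2 < 1" using 1 r2 by linarith
      show "open {s. b + s\<^sup>2 < r\<^sup>2}" by (intro open_Collect_less continuous_intros)
      show "f (line x i s) = cut r (line x i s)" if "s \<in> {s. b + s\<^sup>2 < r\<^sup>2}" for s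
        using that ltr[of s] r cutoff_eq(2)[OF r, of "line x i s"] by (simp add: cut_eq)
    qed (use 1 in simp)
    moreover have "cut_deriv r i (line x i t) = partial_deriv i f (line x i t)"
      using 1 ltr[of t] r cutoff_eq(2)[OF r, of "line x i t"] by (simp add: cut_deriv_def shell_def)
    ultimately show ?thesis by simp
  next
    case 2
    define w where "w = 1 / (1 - r\<^sup>2)"
    have in_shell: "r \<le> norm (line x i s) \<and> norm (line x i s) < 1" if "r\<^sup>2 < b + s\<^sup>2" "b + s\<^sup>2 < 1" for s
      using that ltr[of s] lt1[of s] by auto
    have "((\<lambda>t. w * (1 - (b + t\<^sup>2)) * f (line x i t)) has_real_derivative
        w * (- (2 * t)) * f (line x i t) + partial_deriv i f (line x i t) * (w * (1 - (b + t\<^sup>2)))) (at t)"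
      by (rule DERIV_mult[OF _ df]) (use 2 in \<open>auto intro!: derivative_eq_intros\<close>)
    then have "((\<lambda>t. cut r (line x i t)) has_real_derivative
        w * (- (2 * t)) * f (line x i t) + partial_deriv i f (line x i t) * (w * (1 - (b + t\<^sup>2)))) (at t)"
    proof (rule has_field_derivative_transform_within_open)
      show "open {s. r\<^sup>2 < b + s\<^sup>2 \<and> b + s\<^sup>2 < 1}"
        by (intro open_Collect_conj open_Collect_less continuous_intros)
      show "w * (1 - (b + s\<^sup>2)) * f (line x i s) = cut r (line x i s)" if "s \<in> {s. r\<^sup>2 < b + s\<^sup>2 \<and> b + s\<^sup>2 < 1}" for s
        using that in_shell[of s] cutoff_eq(3)[OF r, of "line x i s"] by (simp add: cut_eq n w_def)
    qed (use 2 in simp)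
    moreover have "cut_deriv r i (line x i t) =
        w * (- (2 * t)) * f (line x i t) + partial_deriv i f (line x i t) * (w * (1 - (b + t\<^sup>2)))"
      using in_shell[of t] 2 cutoff_eq(3)[OF r, of "line x i t"]
      by (simp add: cut_deriv_def shell_def n w_def not_less algebra_simps)
    ultimately show ?thesis by simp
  next
    case 3
    have out: "cut r (line x i s) = 0" if "1 < b + s\<^sup>2" for s
      using that lt1[of s] by (simp add: cut_eq)
    have "((\<lambda>t. cut r (line x i t)) has_real_derivative 0) (at t)"
    proof (rule has_field_derivative_transform_within_open[OF DERIV_const])
      show "open {s. 1 < b + s\<^sup>2}" by (intro open_Collect_less continuous_intros)
    qed (use 3 out in auto)
    moreover have "cut_deriv r i (line x i t) = 0"
      using 3 lt1[of t] by (simp add: cut_deriv_def shell_def)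
    ultimately show ?thesis by simp
  qed
qed

text \<open>\<open>cut\<close> stays continuous across its kinks, and there are finitely many on a
  line, so the fundamental theorem with a finite exceptional set applies.\<close>

lemma cut_line_ftc:
  assumes "a \<le> b" "-1 \<le> a" "b \<le> 1"
  shows "(LINT t:{a..b}|lborel. cut_deriv r i (line x i t)) = cut r (line x i b) - cut r (line x i a)"
proof -
  define B where "B = (norm (line x i 0))\<^sup>2"
  have fin: "finite {t. t\<^sup>2 = c}" for c :: real
  proof (cases "\<exists>s. s\<^sup>2 = c")
    case True
    then obtain s where "s\<^sup>2 = c" by blast
    then have "{t. t\<^sup>2 = c} \<subseteq> {s, - s}" by (auto simp: power2_eq_iff)
    then show ?thesis by (rule finite_subset) simp
  qed simp
  have "((\<lambda>t. cut_deriv r i (line x i t)) has_integral (cut r (line x i b) - cut r (line x i a))) {a..b}"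
  proof (rule fundamental_theorem_of_calculus_strong[where S="{t. t\<^sup>2 = 1 - B} \<union> {t. t\<^sup>2 = r\<^sup>2 - B}"])
    show "finite ({t. t\<^sup>2 = 1 - B} \<union> {t. t\<^sup>2 = r\<^sup>2 - B})" by (intro finite_UnI fin)
    show "((\<lambda>t. cut r (line x i t)) has_vector_derivative cut_deriv r i (line x i t)) (at t)"
      if "t \<in> {a..b} - ({t. t\<^sup>2 = 1 - B} \<union> {t. t\<^sup>2 = r\<^sup>2 - B})" for t
      unfolding has_real_derivative_iff_has_vector_derivative[symmetric]
      using that by (intro cut_line_derivative) (auto simp: norm_line_squared[of x i t] B_def)
    show "continuous_on {a..b} (\<lambda>t. cut r (line x i t))"
      by (intro continuous_on_compose2[OF continuous_cut] continuous_intros) auto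
  qed (fact assms)
  moreover have "set_integrable lborel {a..b} (\<lambda>t. cut_deriv r i (line x i t))"
    by (intro set_integrable_bounded_borel bounded_borel_line bounded_borel_cut_deriv emeasure_bounded_finite) auto
  ultimately show ?thesis
    by (simp add: set_borel_integral_eq_integral(2) integral_unique)
qed

lemma cut_line_end: "\<bar>t\<bar> = 1 \<Longrightarrow> cut r (line x i t) = 0"
proof -
  assume "\<bar>t\<bar> = 1"
  then have "t\<^sup>2 = 1" by (metis abs_square_eq_1)
  then have "(norm (line x i t))\<^sup>2 \<ge> 1" by (simp add: norm_line_squared[of x i t])
  then have "norm (line x i t) \<ge> 1" by (metis abs_norm_cancel abs_square_less_1 not_le)
  then show ?thesis by (intro cut_eq) simp
qed

lemma line_int_cut_deriv: "line_int i (cut_deriv r i) x = 0"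
  unfolding line_int_def using cut_line_ftc[of "-1" 1 i x] by (simp add: cut_line_end)

lemma cut_le_line_int:
  assumes "x \<in> unit_cube"
  shows "cut r x \<le> line_int i (\<lambda>x. \<bar>cut_deriv r i x\<bar>) x"
proof -
  have x: "-1 \<le> x $ i" "x $ i \<le> 1" using assms by (auto simp: mem_unit_cube)
  have bb: "bounded_borel (\<lambda>t. cut_deriv r i (line x i t))"
    by (intro bounded_borel_line bounded_borel_cut_deriv)
  have int: "set_integrable lborel A (\<lambda>t. cut_deriv r i (line x i t))" if "A = {-1..x $ i} \<or> A = {-1..1}" for A
    using that by (intro set_integrable_bounded_borel bb emeasure_bounded_finite) auto
  have "cut r x = (LINT t:{-1..x $ i}|lborel. cut_deriv r i (line x i t))"
    using cut_line_ftc[of "-1" "x $ i" i x] x by (simp add: cut_line_end)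
  also have "\<dots> \<le> (LINT t:{-1..x $ i}|lborel. \<bar>cut_deriv r i (line x i t)\<bar>)"
    using int by (intro set_integral_mono set_integrable_abs) auto
  also have "\<dots> \<le> (LINT t:{-1..1}|lborel. \<bar>cut_deriv r i (line x i t)\<bar>)"
    using set_integrable_abs[OF int[of "{-1..x $ i}"]] set_integrable_abs[OF int[of "{-1..1}"]] x
    unfolding set_lebesgue_integral_def set_integrable_def
    by (intro integral_mono) (auto simp: indicator_def)
  finally show ?thesis by (simp add: line_int_def)
qed

text \<open>\<open>cut\<close> vanishes at both ends of every coordinate segment, so all line
  integrals of \<open>cut_deriv\<close> are 0 and so is its integral over the cube. Separating the
  two summands of \<open>cut_deriv\<close> gives a divergence theorem whose boundary is smeared over
  the shell.\<close>

lemma cut_divergence: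
  "(LINT x:ball 0 1|lborel. cutoff r x * partial_deriv i f x) = 2 / (1 - r\<^sup>2) * (LINT x:shell r|lborel. x $ i * f x)"
proof -
  have "(LINT x:unit_cube|lborel. cut_deriv r i x) = 0"
    using integral_line_int[OF bounded_borel_cut_deriv[where r=r and i=i], of i] by (simp add: line_int_cut_deriv)
  then have "(LINT x:unit_cube|lborel. indicator (ball 0 1) x * (cutoff r x * partial_deriv i f x))
      - (LINT x:unit_cube|lborel. indicator (shell r) x * (2 / (1 - r\<^sup>2) * (x $ i * f x))) = 0"
    unfolding cut_deriv_def
    by (subst (asm) set_integral_diff(2)) (intro set_integrable_cube bounded_borel_ball_partial bounded_borel_shell)+
  moreover have "ball 0 1 \<subseteq> (unit_cube :: (real ^ 'm) set)" "shell r \<subseteq> (unit_cube :: (real ^ 'm) set)"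
    using unit_ball_subset_cube shell_subset(1) ball_subset_cball by blast+
  ultimately show ?thesis by (simp add: integral_cube_indicator)
qed

end

text \<open>Let the shell in \<open>cut_divergence\<close> shrink to the sphere and compare the two
  limits of the left side.\<close>

lemma Gauss:
  "(LINT x:ball 0 1|lborel. partial_deriv i f x) = sphere_int (\<lambda>x. x $ i * f x)"
proof (rule LIMSEQ_unique)
  show "(\<lambda>k. LINT x:ball 0 1|lborel. cutoff (radii k) x * partial_deriv i f x)
      \<longlonglongrightarrow> sphere_int (\<lambda>x. x $ i * f x)"
    unfolding cut_divergence[OF radii]
    by (intro shell_integral_tendsto continuous_intros continuous_f)
  show "(\<lambda>k. LINT x:ball 0 1|lborel. cutoff (radii k) x * partial_deriv i f x)
      \<longlonglongrightarrow> (LINT x:ball 0 1|lborel. partial_deriv i f x)"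
    using cutoff_integral_tendsto[OF continuous_partial[of i], of 1] by (simp add: cutoff_bounds)
qed

text \<open>The zero extension of \<open>f\<close> jumps across the sphere, and
  \<open>sphere_int f\<close> is the contribution of this jump to its total variation. It arises as
  the limit of the gradient mass of \<open>cut (radii k)\<close> on the shell.\<close>

theorem Sobolev_zero_extension:
  assumes card: "CARD('m) \<ge> 2" and f: "\<And>x. x \<in> cball 0 1 \<Longrightarrow> f x \<ge> 0"
  defines "q \<equiv> real CARD('m) / (real CARD('m) - 1)"
  shows "(LINT x:ball 0 1|lborel. f x powr q)
      \<le> ((LINT x:ball 0 1|lborel. norm (gradient f x)) + sphere_int f) powr q"
proof (rule LIMSEQ_le)
  define N where "N k = (LINT x:ball 0 1|lborel. norm (gradient f x))
      + 2 / (1 - (radii k)\<^sup>2) * (LINT x:shell (radii k)|lborel. f x)" for k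
  have q: "q > 0" using card by (simp add: q_def)
  have grad: "continuous_on (cball 0 1) (\<lambda>x. norm (gradient f x))"
    unfolding gradient_def by (intro continuous_on_norm continuous_on_vec_lambda continuous_partial)
  have coef: "2 / (1 - (radii k)\<^sup>2) > 0" for k
    using radii[of k] by (simp add: power_less_one_iff)
  have sub: "ball 0 1 \<subseteq> (unit_cube :: (real ^ 'm) set)" "shell r \<subseteq> (unit_cube :: (real ^ 'm) set)" for r
    using unit_ball_subset_cube shell_subset(1) ball_subset_cball by blast+
  have N_bound: "(LINT x:unit_cube|lborel. \<bar>cut_deriv (radii k) i x\<bar>) \<le> N k" for i k
  proof -
    have bb1: "bounded_borel (\<lambda>x. indicator (ball 0 1) x * norm (gradient f x))"
      by (intro bounded_borel_indicator_ball grad) auto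
    have bb2: "bounded_borel (\<lambda>x. indicator (shell (radii k)) x * (2 / (1 - (radii k)\<^sup>2) * f x))"
      using shell_subset by (intro bounded_borel_indicator_ball continuous_intros continuous_f) auto
    have "\<bar>cut_deriv (radii k) i x\<bar> \<le> indicator (ball 0 1) x * norm (gradient f x)
        + indicator (shell (radii k)) x * (2 / (1 - (radii k)\<^sup>2) * f x)" for x
    proof -
      have 1: "\<bar>cutoff (radii k) x * partial_deriv i f x\<bar> \<le> norm (gradient f x)"
      proof -
        have "\<bar>partial_deriv i f x\<bar> \<le> norm (gradient f x)"
          using component_le_norm_cart[of "gradient f x" i] by (simp add: gradient_def)
        moreover have "\<bar>cutoff (radii k) x\<bar> \<le> 1" using cutoff_bounds[of "radii k" x] by simp
        ultimately show ?thesis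
          unfolding abs_mult using mult_mono[of "\<bar>cutoff (radii k) x\<bar>" 1 "\<bar>partial_deriv i f x\<bar>" "norm (gradient f x)"]
          by simp
      qed
      have 2: "\<bar>2 / (1 - (radii k)\<^sup>2) * (x $ i * f x)\<bar> \<le> 2 / (1 - (radii k)\<^sup>2) * f x" if "x \<in> shell (radii k)"
      proof -
        have x: "x \<in> cball 0 1" using that shell_subset by blast
        then have "\<bar>x $ i\<bar> \<le> 1" using component_le_norm_cart[of x i] by simp
        then have "\<bar>x $ i\<bar> * f x \<le> 1 * f x" using f[OF x] by (intro mult_right_mono)
        then show ?thesis
          using coef[of k] f[OF x] unfolding abs_mult abs_of_pos[OF coef] abs_of_nonneg[OF f[OF x]]
          by (intro mult_left_mono) auto
      qed
      show ?thesis
        unfolding cut_deriv_def using 1 2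
        by (intro order_trans[OF abs_triangle_ineq4 add_mono]) (auto simp: indicator_def)
    qed
    then have "(LINT x:unit_cube|lborel. \<bar>cut_deriv (radii k) i x\<bar>) \<le>
        (LINT x:unit_cube|lborel. indicator (ball 0 1) x * norm (gradient f x)
          + indicator (shell (radii k)) x * (2 / (1 - (radii k)\<^sup>2) * f x))"
      by (intro set_integral_mono set_integral_add(1) set_integrable_abs set_integrable_cube bb1 bb2 bounded_borel_cut_deriv)
    also have "\<dots> = N k"
      by (subst set_integral_add(2)) (auto simp: N_def integral_cube_indicator[OF sub(1)] integral_cube_indicator[OF sub(2)]
        simp del: times_divide_eq_left intro!: set_integrable_cube bb1 bb2)
    finally show ?thesis .
  qed
  have "(LINT x:unit_cube|lborel. cut (radii k) x powr q) \<le> N k powr q" for k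
    unfolding q_def
    by (rule Gagliardo_Nirenberg_unit_cube[OF card bounded_borel_cut _ bounded_borel_cut_deriv
          cut_le_line_int[OF radii] N_bound])
       (use f cutoff_bounds in \<open>auto simp: cut_def indicator_def intro!: mult_nonneg_nonneg\<close>)
  moreover have "(LINT x:unit_cube|lborel. cut (radii k) x powr q)
      = (LINT x:ball 0 1|lborel. cutoff (radii k) x powr q * f x powr q)" for k
  proof -
    have "cut (radii k) x powr q = indicator (ball 0 1) x * (cutoff (radii k) x powr q * f x powr q)" for x
      using f[of x] cutoff_bounds[of "radii k" x] by (auto simp: cut_def indicator_def powr_mult)
    then show ?thesis by (simp add: integral_cube_indicator[OF sub(1)])
  qed
  ultimately show "\<exists>n. \<forall>k\<ge>n. (LINT x:ball 0 1|lborel. cutoff (radii k) x powr q * f x powr q) \<le> N k powr q"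
    by simp
  show "(\<lambda>k. LINT x:ball 0 1|lborel. cutoff (radii k) x powr q * f x powr q) \<longlonglongrightarrow> (LINT x:ball 0 1|lborel. f x powr q)"
    using f q by (intro cutoff_integral_tendsto continuous_on_powr' continuous_f continuous_on_const) auto
  have "N \<longlonglongrightarrow> (LINT x:ball 0 1|lborel. norm (gradient f x)) + sphere_int f"
    unfolding N_def by (intro tendsto_intros shell_integral_tendsto continuous_f)
  \<comment> \<open>\<open>N k\<close> dominates the integral of a nonnegative function for every
    direction; \<open>undefined\<close> stands for an arbitrary one.\<close>
  moreover have "N k \<ge> 0" for k
    using N_bound[of k undefined] unfolding set_lebesgue_integral_def
    by (rule order_trans[rotated]) (auto intro!: Bochner_Integration.integral_nonneg)
  ultimately show "(\<lambda>k. N k powr q) \<longlonglongrightarrow> ((LINT x:ball 0 1|lborel. norm (gradient f x)) + sphere_int f) powr q"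
    using q by (intro tendsto_powr' tendsto_const) auto
qed

end

subsection \<open>Curvature of conformally flat metrics\<close>

abbreviation kron :: "'m \<Rightarrow> 'm \<Rightarrow> real" where
  "kron i j \<equiv> (if i = j then 1 else 0)"

lemma sum_kron:
  fixes f :: "'m::finite \<Rightarrow> real"
  shows "(\<Sum>i\<in>UNIV. kron i j * f i) = f j" "(\<Sum>i\<in>UNIV. kron j i * f i) = f j"
    "(\<Sum>i\<in>UNIV. f i * kron i j) = f j" "(\<Sum>i\<in>UNIV. f i * kron j i) = f j"
  by (simp_all add: if_distrib[where f="\<lambda>z. z * _"] if_distrib[where f="\<lambda>z. _ * z"] cong: if_cong)

lemma matrix_inv_scaled_mat:
  assumes "a \<noteq> 0"
  shows "matrix_inv (a *\<^sub>R mat 1 :: real ^ 'm ^ 'm::finite) = (1 / a) *\<^sub>R mat 1"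
proof -
  let ?A = "a *\<^sub>R mat 1 :: real ^ 'm ^ 'm" and ?B = "(1 / a) *\<^sub>R mat 1 :: real ^ 'm ^ 'm"
  have AB: "?A ** ?B = mat 1" "?B ** ?A = mat 1"
    using assms by (simp_all add: vec_eq_iff matrix_matrix_mult_def mat_def
        if_distrib[where f="\<lambda>z. z * _"] if_distrib[where f="\<lambda>z. _ * z"] cong: if_cong)
  then have "\<exists>A'. ?A ** A' = mat 1 \<and> A' ** ?A = mat 1" by blast
  from someI_ex[OF this] have "?A ** matrix_inv ?A = mat 1"
    unfolding matrix_inv_def by blast
  then have "?B ** (?A ** matrix_inv ?A) = ?B" by simp
  then show ?thesis by (simp only: matrix_mul_assoc AB matrix_mul_lid)
qed

lemma mat_nth: "(a *\<^sub>R mat 1 :: real ^ 'm ^ 'm::finite) $ i $ j = a * kron i j"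
  by (simp add: mat_def)

text \<open>The Christoffel symbols of \<open>exp (2 * f)\<close> times the Euclidean metric, with
  \<open>\<psi>\<close> the gradient of \<open>f\<close>.\<close>

definition flat_christoffel :: "('m \<Rightarrow> real) \<Rightarrow> 'm \<Rightarrow> 'm \<Rightarrow> 'm \<Rightarrow> real" where
  "flat_christoffel \<psi> k i j = \<psi> i * kron j k + \<psi> j * kron i k - \<psi> k * kron i j"

lemma sum_flat_christoffel:
  fixes \<psi> :: "'m::finite \<Rightarrow> real"
  defines "q \<equiv> \<Sum>p\<in>UNIV. (\<psi> p)\<^sup>2"
  shows "(\<Sum>p\<in>UNIV. A p * flat_christoffel \<psi> p i k) = \<psi> i * A k + \<psi> k * A i - kron i k * (\<Sum>p\<in>UNIV. A p * \<psi> p)"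
    and "(\<Sum>p\<in>UNIV. flat_christoffel \<psi> i j p * \<psi> p) = kron i j * q"
    and "flat_christoffel \<psi> i i k = \<psi> k"
    and "flat_christoffel \<psi> i j i = \<psi> j"
proof -
  have "(\<Sum>p\<in>UNIV. A p * flat_christoffel \<psi> p i k) =
      \<psi> i * (\<Sum>p\<in>UNIV. A p * kron k p) + \<psi> k * (\<Sum>p\<in>UNIV. A p * kron i p) - kron i k * (\<Sum>p\<in>UNIV. A p * \<psi> p)"
    unfolding flat_christoffel_def sum_distrib_left sum.distrib[symmetric] sum_subtractf[symmetric]
    by (intro sum.cong refl) (simp add: algebra_simps)
  then show "(\<Sum>p\<in>UNIV. A p * flat_christoffel \<psi> p i k) = \<psi> i * A k + \<psi> k * A i - kron i k * (\<Sum>p\<in>UNIV. A p * \<psi> p)"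
    unfolding sum_kron .
  have "(\<Sum>p\<in>UNIV. flat_christoffel \<psi> i j p * \<psi> p) =
      \<psi> j * (\<Sum>p\<in>UNIV. \<psi> p * kron p i) + kron i j * q - \<psi> i * (\<Sum>p\<in>UNIV. \<psi> p * kron j p)"
    unfolding flat_christoffel_def sum_distrib_left sum.distrib[symmetric] sum_subtractf[symmetric] q_def
    by (intro sum.cong refl) (simp add: algebra_simps power2_eq_square)
  then show "(\<Sum>p\<in>UNIV. flat_christoffel \<psi> i j p * \<psi> p) = kron i j * q"
    unfolding sum_kron by simp
  show "flat_christoffel \<psi> i i k = \<psi> k" "flat_christoffel \<psi> i j i = \<psi> j"
    by (simp_all add: flat_christoffel_def)
qed

text \<open>The classical conformal change formula, with \<open>\<psi>\<close> in the role of the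
  gradient of the exponent and \<open>sym\<close> that of the symmetry of its Hessian. The
  Christoffel symbols are prescribed on a neighbourhood because they get differentiated.\<close>

lemma ricci_conformally_flat:
  fixes g :: "'m::finite metric_field" and \<psi> :: "'m \<Rightarrow> real ^ 'm \<Rightarrow> real"
  assumes U: "open U" "x \<in> U"
    and \<Gamma>: "\<And>y k i j. y \<in> U \<Longrightarrow> christoffel g k i j y = flat_christoffel (\<lambda>i. \<psi> i y) k i j"
    and diff: "\<And>i. \<psi> i differentiable (at x)"
    and sym: "\<And>i j. partial_deriv i (\<psi> j) x = partial_deriv j (\<psi> i) x"
  defines "d \<equiv> real CARD('m)" and "q \<equiv> \<Sum>i\<in>UNIV. (\<psi> i x)\<^sup>2" and "D \<equiv> \<Sum>i\<in>UNIV. partial_deriv i (\<psi> i) x"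
  shows "ricci g x $ j $ k = - (d - 2) * (partial_deriv j (\<psi> k) x - \<psi> j x * \<psi> k x)
      - (D + (d - 2) * q) * kron j k"
proof -
  have d\<Gamma>: "partial_deriv l (christoffel g p i j) x =
      partial_deriv l (\<psi> i) x * kron j p + partial_deriv l (\<psi> j) x * kron i p - partial_deriv l (\<psi> p) x * kron i j" for l p i j
  proof -
    have "partial_deriv l (christoffel g p i j) x
        = partial_deriv l (\<lambda>y. kron j p * \<psi> i y + kron i p * \<psi> j y - kron i j * \<psi> p y) x"
      by (rule partial_deriv_cong[OF U]) (simp add: \<Gamma> flat_christoffel_def)
    also have "\<dots> = partial_deriv l (\<lambda>y. kron j p * \<psi> i y) x + partial_deriv l (\<lambda>y. kron i p * \<psi> j y) x
        - partial_deriv l (\<lambda>y. kron i j * \<psi> p y) x"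
      using diff by (subst partial_deriv_diff, simp, simp, subst partial_deriv_add) auto
    also have "\<dots> = kron j p * partial_deriv l (\<psi> i) x + kron i p * partial_deriv l (\<psi> j) x - kron i j * partial_deriv l (\<psi> p) x"
      by (simp only: partial_deriv_cmult[OF diff])
    finally show ?thesis by (simp add: mult.commute)
  qed
  have first: "(\<Sum>i\<in>UNIV. partial_deriv i (christoffel g i j k) x - partial_deriv j (christoffel g i i k) x)
      = 2 * partial_deriv j (\<psi> k) x - D * kron j k - d * partial_deriv j (\<psi> k) x"
  proof -
    have "(\<Sum>i\<in>UNIV. partial_deriv i (christoffel g i j k) x - partial_deriv j (christoffel g i i k) x)
      = (\<Sum>i\<in>UNIV. partial_deriv i (\<psi> j) x * kron k i + partial_deriv i (\<psi> k) x * kron j i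
          - kron j k * partial_deriv i (\<psi> i) x - partial_deriv j (\<psi> k) x)"
      by (intro sum.cong refl) (simp add: d\<Gamma>)
    also have "\<dots> = partial_deriv k (\<psi> j) x + partial_deriv j (\<psi> k) x - kron j k * D - d * partial_deriv j (\<psi> k) x"
      unfolding sum.distrib sum_subtractf sum_kron sum_distrib_left[symmetric] D_def d_def by simp
    finally show ?thesis by (simp add: sym[of k j])
  qed
  let ?G = "flat_christoffel (\<lambda>i. \<psi> i x)"
  note S = sum_flat_christoffel[where \<psi>="\<lambda>i. \<psi> i x", folded q_def]
  have q': "(\<Sum>p\<in>UNIV. \<psi> p x * \<psi> p x) = q" by (simp add: q_def power2_eq_square)
  have quad1: "(\<Sum>p\<in>UNIV. ?G i i p * ?G p j k) = 2 * \<psi> j x * \<psi> k x - kron j k * q" for i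
    unfolding S(3) S(1) q' by simp
  have quad2: "(\<Sum>p\<in>UNIV. ?G i j p * ?G p i k)
      = \<psi> i x * ?G i j k + \<psi> k x * \<psi> j x - kron i k * (kron i j * q)" for i
    unfolding S(1) S(2) S(4) ..
  have "(\<Sum>i\<in>UNIV. \<Sum>p\<in>UNIV. ?G i i p * ?G p j k - ?G i j p * ?G p i k)
      = (\<Sum>i\<in>UNIV. (2 * \<psi> j x * \<psi> k x - kron j k * q)
          - (\<psi> i x * ?G i j k + \<psi> k x * \<psi> j x - (kron i k * (kron i j * q))))"
    by (intro sum.cong refl) (simp only: sum_subtractf quad1 quad2)
  also have "\<dots> = (d - 2) * \<psi> j x * \<psi> k x - (d - 2) * q * kron j k"
  proof -
    \<comment> \<open>Hiding the case distinction behind \<open>K\<close> presents a polynomial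
      identity to \<open>algebra\<close>.\<close>
    define K where "K = kron j k"
    have K: "kron k j = K" "kron j k = K" by (simp_all add: K_def)
    show ?thesis
      unfolding sum_subtractf sum.distrib sum_kron S(1) q' K sum_constant d_def by algebra
  qed
  finally have second: "(\<Sum>i\<in>UNIV. \<Sum>p\<in>UNIV. ?G i i p * ?G p j k - ?G i j p * ?G p i k)
      = (d - 2) * \<psi> j x * \<psi> k x - (d - 2) * q * kron j k" .
  show ?thesis
    unfolding ricci_def by (simp only: vec_lambda_beta first \<Gamma>[OF U(2)] second) (simp add: algebra_simps)
qed

text \<open>Subtracting the scalar curvature term cancels the divergence \<open>D\<close> in the
  diagonal part of the Ricci tensor, and every remaining term is divisible by
  \<open>CARD('m) - 2\<close>.\<close>

lemma schouten_conformally_flat: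
  fixes g :: "'m::finite metric_field" and \<psi> :: "'m \<Rightarrow> real ^ 'm \<Rightarrow> real"
  assumes card: "CARD('m) > 2"
    and U: "open U" "x \<in> U"
    and \<Gamma>: "\<And>y k i j. y \<in> U \<Longrightarrow> christoffel g k i j y = flat_christoffel (\<lambda>i. \<psi> i y) k i j"
    and diff: "\<And>i. \<psi> i differentiable (at x)"
    and sym: "\<And>i j. partial_deriv i (\<psi> j) x = partial_deriv j (\<psi> i) x"
    and g: "g x = \<phi> *\<^sub>R mat 1" "\<phi> \<noteq> 0"
  defines "q \<equiv> \<Sum>i\<in>UNIV. (\<psi> i x)\<^sup>2" and "D \<equiv> \<Sum>i\<in>UNIV. partial_deriv i (\<psi> i) x"
    and "P \<equiv> \<lambda>j k. \<psi> j x * \<psi> k x - partial_deriv j (\<psi> k) x - (\<Sum>i\<in>UNIV. (\<psi> i x)\<^sup>2) / 2 * kron j k"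
  shows "schouten g x $ j $ k = P j k"
    and "schouten_trace g x = - (D + (real CARD('m) - 2) / 2 * q) / \<phi>"
    and "schouten_norm_sq g x = (\<Sum>i\<in>UNIV. \<Sum>j\<in>UNIV. (P i j)\<^sup>2) / \<phi>\<^sup>2"
proof -
  define d where "d = real CARD('m)"
  have d: "d > 2" using card by (simp add: d_def)
  have ric: "ricci g x $ j $ k = - (d - 2) * (partial_deriv j (\<psi> k) x - \<psi> j x * \<psi> k x)
      - (D + (d - 2) * q) * kron j k" for j k
    unfolding d_def q_def D_def by (rule ricci_conformally_flat[OF U \<Gamma> diff sym])
  have inv: "matrix_inv (g x) $ i $ j = (1 / \<phi>) * kron i j" for i j
    unfolding g matrix_inv_scaled_mat[OF g(2)] mat_nth ..
  have scal: "scalar_curvature g x = (1 / \<phi>) * (\<Sum>i\<in>UNIV. ricci g x $ i $ i)"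
    unfolding scalar_curvature_def inv mult.assoc sum_kron sum_distrib_left[symmetric] ..
  have tr: "(\<Sum>i\<in>UNIV. ricci g x $ i $ i) = - (d - 1) * (2 * D + (d - 2) * q)"
  proof -
    have "(\<Sum>i\<in>UNIV. ricci g x $ i $ i) =
        (\<Sum>i\<in>UNIV. - (d - 2) * partial_deriv i (\<psi> i) x + (d - 2) * (\<psi> i x)\<^sup>2 - (D + (d - 2) * q))"
      unfolding ric by (intro sum.cong refl) (simp add: algebra_simps power2_eq_square)
    also have "\<dots> = - (d - 2) * D + (d - 2) * q - d * (D + (d - 2) * q)"
      unfolding sum.distrib sum_subtractf sum_distrib_left[symmetric] D_def[symmetric] q_def[symmetric] d_def
      by (simp add: algebra_simps)
    finally show ?thesis by (simp add: algebra_simps)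
  qed
  have J: "scalar_curvature g x / (2 * (d - 1)) = - (D + (d - 2) / 2 * q) / \<phi>"
    unfolding scal tr using d g(2) by (simp add: field_simps)
  then show "schouten_trace g x = - (D + (real CARD('m) - 2) / 2 * q) / \<phi>"
    by (simp add: schouten_trace_def d_def)
  have P: "schouten g x $ j $ k = P j k" for j k
  proof -
    have "schouten g x $ j $ k = (1 / (d - 2)) * (ricci g x $ j $ k + (D + (d - 2) / 2 * q) * kron j k)"
    proof -
      have "schouten g x $ j $ k = (1 / (d - 2)) * (ricci g x $ j $ k
          - scalar_curvature g x / (2 * (d - 1)) * (\<phi> * kron j k))"
        by (simp add: schouten_def d_def g(1) mat_def)
      then show ?thesis unfolding J using g(2) by simp
    qed
    also have "\<dots> = P j k"
      unfolding ric P_def q_def[symmetric] using d by (simp add: field_simps)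
    finally show ?thesis .
  qed
  then show "schouten g x $ j $ k = P j k" .
  have "schouten_norm_sq g x = (\<Sum>i\<in>UNIV. \<Sum>j\<in>UNIV. \<Sum>k\<in>UNIV. \<Sum>l\<in>UNIV.
      ((1 / \<phi>) * (1 / \<phi>) * P i j) * (kron i k * (kron j l * P k l)))"
    unfolding schouten_norm_sq_def inv P by (simp only: mult_ac)
  also have "\<dots> = (\<Sum>i\<in>UNIV. \<Sum>j\<in>UNIV. (1 / \<phi>) * (1 / \<phi>) * P i j * P i j)"
    unfolding sum_distrib_left[symmetric] sum_kron ..
  also have "\<dots> = (\<Sum>i\<in>UNIV. \<Sum>j\<in>UNIV. (P i j)\<^sup>2) / \<phi>\<^sup>2"
    by (simp add: power2_eq_square sum_divide_distrib mult.assoc)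
  finally show "schouten_norm_sq g x = (\<Sum>i\<in>UNIV. \<Sum>j\<in>UNIV. (P i j)\<^sup>2) / \<phi>\<^sup>2" .
qed

text \<open>The Schouten tensor of \<open>conf_metric u\<close> has exactly this shape: a multiple
  of the squared gradient, one of the Hessian and one of the identity.\<close>

lemma sum_square_rank_one_plus:
  fixes v :: "'m::finite \<Rightarrow> real"
  shows "(\<Sum>i\<in>UNIV. \<Sum>j\<in>UNIV. (\<alpha> * (v i * v j) - \<beta> * a i j - \<gamma> * kron i j)\<^sup>2)
    = \<alpha>\<^sup>2 * (\<Sum>i\<in>UNIV. (v i)\<^sup>2)\<^sup>2 + \<beta>\<^sup>2 * (\<Sum>i\<in>UNIV. \<Sum>j\<in>UNIV. (a i j)\<^sup>2) + \<gamma>\<^sup>2 * real CARD('m)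
      - 2 * \<alpha> * \<beta> * (\<Sum>i\<in>UNIV. \<Sum>j\<in>UNIV. a i j * (v i * v j))
      - 2 * \<alpha> * \<gamma> * (\<Sum>i\<in>UNIV. (v i)\<^sup>2) + 2 * \<beta> * \<gamma> * (\<Sum>i\<in>UNIV. a i i)"
proof -
  have "(\<Sum>i\<in>UNIV. \<Sum>j\<in>UNIV. (\<alpha> * (v i * v j) - \<beta> * a i j - \<gamma> * kron i j)\<^sup>2)
    = (\<Sum>i\<in>UNIV. \<Sum>j\<in>UNIV. \<alpha>\<^sup>2 * ((v i)\<^sup>2 * (v j)\<^sup>2) + \<beta>\<^sup>2 * (a i j)\<^sup>2 + \<gamma>\<^sup>2 * (1 * kron i j)
      - 2 * \<alpha> * \<beta> * (a i j * (v i * v j)) - 2 * \<alpha> * \<gamma> * (v i * v j * kron i j) + 2 * \<beta> * \<gamma> * (a i j * kron i j))"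
    by (intro sum.cong refl) (simp add: power2_eq_square algebra_simps)
  also have "\<dots> = (\<Sum>i\<in>UNIV. \<alpha>\<^sup>2 * ((v i)\<^sup>2 * (\<Sum>j\<in>UNIV. (v j)\<^sup>2)) + \<beta>\<^sup>2 * (\<Sum>j\<in>UNIV. (a i j)\<^sup>2) + \<gamma>\<^sup>2 * 1
      - 2 * \<alpha> * \<beta> * (\<Sum>j\<in>UNIV. a i j * (v i * v j)) - 2 * \<alpha> * \<gamma> * (v i * v i) + 2 * \<beta> * \<gamma> * a i i)"
    unfolding sum.distrib sum_subtractf sum_distrib_left[symmetric] sum_kron by simp
  also have "\<dots> = \<alpha>\<^sup>2 * ((\<Sum>i\<in>UNIV. (v i)\<^sup>2) * (\<Sum>i\<in>UNIV. (v i)\<^sup>2)) + \<beta>\<^sup>2 * (\<Sum>i\<in>UNIV. \<Sum>j\<in>UNIV. (a i j)\<^sup>2) + \<gamma>\<^sup>2 * real CARD('m)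
      - 2 * \<alpha> * \<beta> * (\<Sum>i\<in>UNIV. \<Sum>j\<in>UNIV. a i j * (v i * v j))
      - 2 * \<alpha> * \<gamma> * (\<Sum>i\<in>UNIV. (v i)\<^sup>2) + 2 * \<beta> * \<gamma> * (\<Sum>i\<in>UNIV. a i i)"
    unfolding sum.distrib sum_subtractf sum_distrib_left[symmetric] sum_distrib_right[symmetric] power2_eq_square
    by simp
  finally show ?thesis by (simp only: power2_eq_square[of "\<Sum>i\<in>UNIV. (v i)\<^sup>2"])
qed

section \<open>The metric with conformal factor a power of u, in the interior\<close>

definition grad_sq :: "(real ^ 'm::finite \<Rightarrow> real) \<Rightarrow> real ^ 'm \<Rightarrow> real" where
  "grad_sq u x = (\<Sum>i\<in>UNIV. (partial_deriv i u x)\<^sup>2)"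

definition hess :: "(real ^ 'm::finite \<Rightarrow> real) \<Rightarrow> 'm \<Rightarrow> 'm \<Rightarrow> real ^ 'm \<Rightarrow> real" where
  "hess u i j = partial_deriv i (partial_deriv j u)"

definition hess_sq :: "(real ^ 'm::finite \<Rightarrow> real) \<Rightarrow> real ^ 'm \<Rightarrow> real" where
  "hess_sq u x = (\<Sum>i\<in>UNIV. \<Sum>j\<in>UNIV. (hess u i j x)\<^sup>2)"

definition hess_grad_grad :: "(real ^ 'm::finite \<Rightarrow> real) \<Rightarrow> real ^ 'm \<Rightarrow> real" where
  "hess_grad_grad u x = (\<Sum>i\<in>UNIV. \<Sum>j\<in>UNIV. hess u i j x * (partial_deriv i u x * partial_deriv j u x))"

definition radial_deriv :: "(real ^ 'm::finite \<Rightarrow> real) \<Rightarrow> real ^ 'm \<Rightarrow> real" where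
  "radial_deriv u x = (\<Sum>i\<in>UNIV. x $ i * partial_deriv i u x)"

definition radial_hess :: "(real ^ 'm::finite \<Rightarrow> real) \<Rightarrow> real ^ 'm \<Rightarrow> real" where
  "radial_hess u x = (\<Sum>i\<in>UNIV. \<Sum>j\<in>UNIV. hess u i j x * (x $ i * x $ j))"

lemma laplacian_hess: "laplacian u x = (\<Sum>i\<in>UNIV. hess u i i x)"
  by (simp add: laplacian_def hess_def)

lemma grad_sq_norm: "(norm (gradient u x))\<^sup>2 = grad_sq u x"
  by (simp add: gradient_def grad_sq_def norm_vec_def L2_set_def sum_nonneg)

locale conformal_factor = smooth_near_ball U u for U :: "(real ^ 'm::finite) set" and u +
  assumes pos: "\<And>x. x \<in> U \<Longrightarrow> u x > 0" and card: "CARD('m) \<ge> 5"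
begin

text \<open>Equal to \<open>4 / (n - 3)\<close> for \<open>n = CARD('m) - 1\<close>. All exponents
  become multiples of \<open>c\<close>, and by \<open>card_c\<close> the dimension is a rational
  function of it, so that the curvature identities reduce to field arithmetic.\<close>

definition c :: real where "c = 4 / (real CARD('m) - 4)"

lemma c_pos: "c > 0"
  using card by (simp add: c_def)

lemma card_c: "real CARD('m) = 4 + 4 / c"
  using card by (simp add: c_def divide_simps)

lemma exponents: "8 / (real CARD('m) - 1 - 3) = 2 * c" "16 / (real CARD('m) - 1 - 3) = 4 * c"
    "12 / (real CARD('m) - 1 - 3) = 3 * c" "(real CARD('m) - 1 - 3) / 4 = 1 / c"
  by (simp_all add: c_def)

text \<open>The gradient of \<open>c * ln u\<close>, since the conformal factor is
  \<open>exp (2 * c * ln u)\<close>.\<close>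

definition \<psi> :: "'m \<Rightarrow> real ^ 'm \<Rightarrow> real" where
  "\<psi> i x = c * (partial_deriv i u x * inverse (u x))"

lemma differentiable_u: "x \<in> U \<Longrightarrow> u differentiable (at x)"
  by (rule smooth_on_differentiable[OF open_U smooth])

lemma differentiable_du: "x \<in> U \<Longrightarrow> partial_deriv i u differentiable (at x)"
  by (rule smooth_on_differentiable[OF open_U smooth_on_partial_deriv[OF open_U smooth]])

lemma conf_metric_nth: "conf_metric u x $ i $ j = u x powr (2 * c) * kron i j"
  unfolding conf_metric_def exponents mat_nth ..

lemma matrix_inv_conf_metric: "x \<in> U \<Longrightarrow> matrix_inv (conf_metric u x) $ i $ j = (1 / u x powr (2 * c)) * kron i j"
  using pos[of x] unfolding conf_metric_def exponents by (subst matrix_inv_scaled_mat) (auto simp: mat_def)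

lemma christoffel_conf_metric:
  assumes x: "x \<in> U"
  shows "christoffel (conf_metric u) k i j x = flat_christoffel (\<lambda>i. \<psi> i x) k i j"
proof -
  define \<phi> where "\<phi> = u x powr (2 * c)"
  have \<phi>: "\<phi> > 0" using pos[OF x] by (simp add: \<phi>_def)
  have pd: "partial_deriv i (\<lambda>y. conf_metric u y $ j $ l) x = 2 * \<phi> * \<psi> i x * kron j l" for i j l
  proof -
    have "partial_deriv i (\<lambda>y. conf_metric u y $ j $ l) x = partial_deriv i (\<lambda>y. kron j l * u y powr (2 * c)) x"
      by (simp only: conf_metric_nth mult.commute)
    also have "\<dots> = kron j l * (2 * c * u x powr (2 * c - 1) * partial_deriv i u x)"
      using powr_has_partial_deriv[OF open_U differentiable_u[OF x] pos[OF x]]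
      by (subst partial_deriv_cmult) (auto simp: mult.assoc)
    also have "u x powr (2 * c - 1) = \<phi> * inverse (u x)"
      using pos[OF x] by (simp add: \<phi>_def powr_diff divide_inverse)
    finally show ?thesis by (simp add: \<psi>_def)
  qed
  have "christoffel (conf_metric u) k i j x = (\<Sum>l\<in>UNIV. kron k l * (flat_christoffel (\<lambda>i. \<psi> i x) l i j))"
    unfolding christoffel_def matrix_inv_conf_metric[OF x] \<phi>_def[symmetric] pd sum_divide_distrib
    by (intro sum.cong refl) (use \<phi> in \<open>auto simp: flat_christoffel_def field_simps\<close>)
  then show ?thesis unfolding sum_kron .
qed

lemma partial_deriv_\<psi>:
  assumes x: "x \<in> U"
  shows "partial_deriv j (\<psi> k) x = c * (hess u j k x / u x - partial_deriv j u x * partial_deriv k u x / (u x)\<^sup>2)"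
    and "\<psi> k differentiable (at x)"
proof -
  note du = differentiable_u[OF x] and ddu = differentiable_du[OF x, of k]
  have dinv: "(inverse has_real_derivative - (inverse (u x))\<^sup>2) (at (u x))"
    using DERIV_inverse[of "u x"] pos[OF x] by (simp add: numeral_2_eq_2)
  have inv: "partial_deriv j (\<lambda>y. inverse (u y)) x = - (inverse (u x))\<^sup>2 * partial_deriv j u x"
      "(\<lambda>y. inverse (u y)) differentiable (at x)" for j
    using partial_deriv_chain[OF du dinv] by auto
  have prod: "(\<lambda>y. partial_deriv k u y * inverse (u y)) differentiable (at x)"
    by (intro differentiable_mult ddu inv)
  then show "\<psi> k differentiable (at x)"
    unfolding \<psi>_def[abs_def] by (rule differentiable_mult[OF differentiable_const])
  have "partial_deriv j (\<psi> k) x = c * (hess u j k x * inverse (u x) - partial_deriv k u x * ((inverse (u x))\<^sup>2 * partial_deriv j u x))"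
    unfolding \<psi>_def[abs_def] partial_deriv_cmult[OF prod] partial_deriv_mult[OF ddu inv(2)] inv(1) hess_def by simp
  then show "partial_deriv j (\<psi> k) x = c * (hess u j k x / u x - partial_deriv j u x * partial_deriv k u x / (u x)\<^sup>2)"
    by (simp add: field_simps power2_eq_square)
qed

lemma hess_symmetric: "x \<in> U \<Longrightarrow> hess u i j x = hess u j i x"
  unfolding hess_def by (rule partial_deriv_commute[OF open_U smooth])

context
  fixes x assumes x: "x \<in> U"
begin

lemma schouten_conf_metric:
  shows "schouten (conf_metric u) x $ j $ k = ((c + c\<^sup>2) / (u x)\<^sup>2) * (partial_deriv j u x * partial_deriv k u x)
      - (c / u x) * hess u j k x - (c\<^sup>2 * grad_sq u x / (2 * (u x)\<^sup>2)) * kron j k" (is ?P)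
    and "schouten_trace (conf_metric u) x = - (c * laplacian u x / u x + (c + c\<^sup>2) * grad_sq u x / (u x)\<^sup>2) / u x powr (2 * c)" (is ?J)
    and "schouten_norm_sq (conf_metric u) x = (\<Sum>i\<in>UNIV. \<Sum>j\<in>UNIV. (schouten (conf_metric u) x $ i $ j)\<^sup>2) / (u x powr (2 * c))\<^sup>2" (is ?N)
proof -
  note u = pos[OF x]
  have q: "(\<Sum>i\<in>UNIV. (\<psi> i x)\<^sup>2) = c\<^sup>2 * grad_sq u x / (u x)\<^sup>2"
    unfolding grad_sq_def sum_distrib_left sum_divide_distrib
    by (intro sum.cong refl) (simp add: \<psi>_def power_mult_distrib divide_inverse power_inverse)
  have D: "(\<Sum>i\<in>UNIV. partial_deriv i (\<psi> i) x) = c * (laplacian u x / u x - grad_sq u x / (u x)\<^sup>2)"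
    unfolding partial_deriv_\<psi>[OF x] laplacian_hess grad_sq_def
    by (simp add: sum_distrib_left sum_subtractf sum_divide_distrib power2_eq_square right_diff_distrib)
  have sym: "partial_deriv i (\<psi> j) x = partial_deriv j (\<psi> i) x" for i j
    unfolding partial_deriv_\<psi>[OF x] hess_symmetric[OF x, of i j] by (simp add: mult.commute)
  have card2: "CARD('m) > 2" using card by simp
  have g: "conf_metric u x = (u x powr (2 * c)) *\<^sub>R mat 1" unfolding conf_metric_def exponents ..
  note S = schouten_conformally_flat[OF card2 open_U x christoffel_conf_metric partial_deriv_\<psi>(2)[OF x] sym g]
  have nz: "u x powr (2 * c) \<noteq> 0" using u by simp
  show P: ?P for j k
    unfolding S(1)[OF _ nz, simplified] partial_deriv_\<psi>[OF x] q unfolding \<psi>_def using u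
    by (simp add: field_simps power2_eq_square)
  have "schouten_trace (conf_metric u) x = - (c * (laplacian u x / u x - grad_sq u x / (u x)\<^sup>2)
      + (real CARD('m) - 2) / 2 * (c\<^sup>2 * grad_sq u x / (u x)\<^sup>2)) / u x powr (2 * c)"
    unfolding S(2)[OF _ nz, simplified] D q by simp
  \<comment> \<open>The dimension d is \<open>4 + 4 / c\<close>, hence
    \<open>(d - 2) / 2 * c\<^sup>2 - c = c + c\<^sup>2\<close>.\<close>
  also have "c * (laplacian u x / u x - grad_sq u x / (u x)\<^sup>2) + (real CARD('m) - 2) / 2 * (c\<^sup>2 * grad_sq u x / (u x)\<^sup>2)
     = c * laplacian u x / u x + (c + c\<^sup>2) * grad_sq u x / (u x)\<^sup>2"
    using c_pos u unfolding card_c by (simp add: field_simps power2_eq_square)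
  finally show ?J .
  show ?N
    unfolding S(3)[OF _ nz, simplified] S(1)[OF _ nz, simplified] ..
qed

text \<open>For this power of \<open>u\<close> the terms with the fourth power of the gradient
  cancel between the squared trace and the squared norm of the Schouten tensor, so every surviving
  term contains a second derivative.\<close>

lemma L4_formula:
  "u x * L4 u x = (1 / c) * ((u x)\<^sup>2 * ((laplacian u x)\<^sup>2 - hess_sq u x) / 2
      + (1 + c / 2) * u x * grad_sq u x * laplacian u x + (1 + c) * u x * hess_grad_grad u x)"
proof -
  define w where "w = u x powr (2 * c)"
  define g L A V where "g = grad_sq u x" and "L = laplacian u x" and "A = hess_sq u x" and "V = hess_grad_grad u x"
  define t where "t = u x"
  have t: "t > 0" using pos[OF x] by (simp add: t_def)
  have w: "w > 0" using pos[OF x] by (simp add: w_def)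
  have w2: "u x powr (4 * c) = w\<^sup>2"
    using pos[OF x] unfolding w_def by (simp add: power2_eq_square powr_add[symmetric])
  note cp = c_pos
  have N: "(\<Sum>i\<in>UNIV. \<Sum>j\<in>UNIV. (schouten (conf_metric u) x $ i $ j)\<^sup>2)
      = ((c + c\<^sup>2) / t\<^sup>2)\<^sup>2 * g\<^sup>2 + (c / t)\<^sup>2 * A + (c\<^sup>2 * g / (2 * t\<^sup>2))\<^sup>2 * (4 + 4 / c)
      - 2 * ((c + c\<^sup>2) / t\<^sup>2) * (c / t) * V - 2 * ((c + c\<^sup>2) / t\<^sup>2) * (c\<^sup>2 * g / (2 * t\<^sup>2)) * g
      + 2 * (c / t) * (c\<^sup>2 * g / (2 * t\<^sup>2)) * L"
    unfolding schouten_conf_metric sum_square_rank_one_plus card_c g_def L_def A_def V_def t_def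
    unfolding grad_sq_def[symmetric] hess_sq_def[symmetric] hess_grad_grad_def[symmetric] laplacian_hess[symmetric] ..
  have "u x * L4 u x = t * ((1 / c * t) ^ 3 * w\<^sup>2 * (((- (c * L / t + (c + c\<^sup>2) * g / t\<^sup>2) / w)\<^sup>2
      - (((c + c\<^sup>2) / t\<^sup>2)\<^sup>2 * g\<^sup>2 + (c / t)\<^sup>2 * A + (c\<^sup>2 * g / (2 * t\<^sup>2))\<^sup>2 * (4 + 4 / c)
      - 2 * ((c + c\<^sup>2) / t\<^sup>2) * (c / t) * V - 2 * ((c + c\<^sup>2) / t\<^sup>2) * (c\<^sup>2 * g / (2 * t\<^sup>2)) * g
      + 2 * (c / t) * (c\<^sup>2 * g / (2 * t\<^sup>2)) * L) / w\<^sup>2) / 2))"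
    unfolding L4_def sigma2_def exponents schouten_conf_metric(3) N schouten_conf_metric(2) w2
    unfolding g_def L_def A_def V_def t_def w_def ..
  also have "\<dots> = (1 / c) * (t\<^sup>2 * (L\<^sup>2 - A) / 2 + (1 + c / 2) * t * g * L + (1 + c) * t * V)"
    using t w cp by (simp add: field_simps power2_eq_square power3_eq_cube)
  finally show ?thesis unfolding g_def L_def A_def V_def t_def .
qed

end

section \<open>Boundary geometry of the conformal metric\<close>

lemma outward_normal_conf_metric:
  assumes y: "y \<in> U"
  shows "outward_normal (conf_metric u) y $ i = y $ i / (sqrt (u y powr (2 * c)) * norm y)"
proof -
  define w where "w = u y powr (2 * c)"
  have w: "w > 0" using pos[OF y] by (simp add: w_def)
  have inv: "matrix_inv (conf_metric u y) *v y = (1 / w) *\<^sub>R y"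
    unfolding vec_eq_iff matrix_vector_mult_def
    by (simp add: matrix_inv_conf_metric[OF y] w_def[symmetric] sum_kron mult.assoc flip: sum_distrib_left)
       (simp add: sum_divide_distrib[symmetric] if_distrib[where f="\<lambda>z. z * _"] cong: if_cong)
  have "sqrt (y \<bullet> ((1 / w) *\<^sub>R y)) = norm y / sqrt w"
    using w by (simp add: real_sqrt_divide norm_eq_sqrt_inner)
  then have "outward_normal (conf_metric u) y $ i = ((1 / w) * y $ i) / (norm y / sqrt w)"
    unfolding outward_normal_def inv by (simp only: vector_scaleR_component real_scaleR_def divide_inverse mult_ac)
  also have "\<dots> = y $ i / (sqrt w * norm y)"
  proof -
    define r where "r = sqrt w"
    have "r > 0" "w = r * r" using w by (simp_all add: r_def)
    then show ?thesis unfolding r_def[symmetric] by (simp add: field_simps)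
  qed
  finally show ?thesis by (simp only: w_def)
qed

lemma bdry_trace_conf_metric:
  assumes x: "x \<in> sphere 0 1"
  shows "bdry_trace (conf_metric u) x b
    = ((\<Sum>i\<in>UNIV. b $ i $ i) - (\<Sum>i\<in>UNIV. \<Sum>j\<in>UNIV. x $ i * x $ j * b $ i $ j)) / u x powr (2 * c)"
proof -
  have xU: "x \<in> U" using x ball_U by auto
  define w where "w = u x powr (2 * c)"
  have w: "w > 0" using pos[OF xU] by (simp add: w_def)
  have n: "outward_normal (conf_metric u) x $ i = x $ i / sqrt w" for i
    using outward_normal_conf_metric[OF xU, of i] x w by (auto simp: w_def)
  have "bdry_trace (conf_metric u) x b
      = (\<Sum>i\<in>UNIV. \<Sum>j\<in>UNIV. (1 / w) * (kron i j * b $ i $ j) - (1 / w) * (x $ i * x $ j * b $ i $ j))"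
    unfolding bdry_trace_def n matrix_inv_conf_metric[OF xU] w_def[symmetric]
    using w by (intro sum.cong refl) (auto simp: divide_simps algebra_simps)
  also have "\<dots> = (1 / w) * (\<Sum>i\<in>UNIV. b $ i $ i) - (1 / w) * (\<Sum>i\<in>UNIV. \<Sum>j\<in>UNIV. x $ i * x $ j * b $ i $ j)"
    unfolding sum_subtractf sum_distrib_left[symmetric] sum_kron ..
  finally show ?thesis by (simp add: w_def diff_divide_distrib)
qed

context
  fixes x :: "real ^ 'm" assumes x: "x \<in> sphere 0 1"
begin

lemma in_U: "x \<in> U"
  using x ball_U by auto

lemma sum_x: "(\<Sum>i\<in>UNIV. x $ i * x $ i) = 1" "(\<Sum>i\<in>UNIV. (x $ i)\<^sup>2) = 1"
proof -
  have "x \<bullet> x = 1" using x by (simp add: dot_square_norm)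
  then show "(\<Sum>i\<in>UNIV. x $ i * x $ i) = 1" "(\<Sum>i\<in>UNIV. (x $ i)\<^sup>2) = 1"
    by (simp_all add: inner_vec_def power2_eq_square)
qed

text \<open>Near the sphere the normal is \<open>u powr (- c)\<close> times the Euclidean radial
  unit vector. Writing the inverse norm as the power \<open>-1/2\<close> of a polynomial reduces the
  computation to the product and power rules.\<close>

lemma partial_deriv_normal:
  "partial_deriv i (\<lambda>y. outward_normal (conf_metric u) y $ k) x
    = u x powr (- c) * (kron i k - x $ i * x $ k - \<psi> i x * x $ k)"
proof -
  define \<rho> where "\<rho> y = (\<Sum>j\<in>UNIV. y $ j * y $ j)" for y :: "real ^ 'm"
  have dnth: "(\<lambda>y::real ^ 'm. y $ j) differentiable (at y)" for j y
    using smooth_on_differentiable[OF open_UNIV smooth_on_nth[OF open_UNIV]] by auto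
  have d\<rho>: "\<rho> differentiable (at x)"
    unfolding \<rho>_def[abs_def] by (intro differentiable_sum) (auto intro!: differentiable_mult dnth)
  have pd\<rho>: "partial_deriv i \<rho> x = 2 * x $ i"
  proof -
    have "partial_deriv i \<rho> x = (\<Sum>j\<in>UNIV. kron i j * x $ j + x $ j * kron i j)"
      unfolding \<rho>_def[abs_def] by (simp add: partial_deriv_sum partial_deriv_mult dnth)
    then show ?thesis unfolding sum.distrib sum_kron by simp
  qed
  have \<rho>x: "\<rho> x = 1" unfolding \<rho>_def by (rule sum_x)
  have \<rho>n: "\<rho> y = (norm y)\<^sup>2" for y
    unfolding \<rho>_def power2_norm_eq_inner inner_vec_def by simp
  have \<rho>0: "\<rho> x > 0" unfolding \<rho>x by simp
  have e\<rho>: "partial_deriv i (\<lambda>y. \<rho> y powr (-1/2)) x = - (x $ i)" "(\<lambda>y. \<rho> y powr (-1/2)) differentiable (at x)"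
    unfolding powr_has_partial_deriv(1)[OF open_UNIV d\<rho> \<rho>0] pd\<rho>
    by (simp add: \<rho>x) (rule powr_has_partial_deriv(2)[OF open_UNIV d\<rho> \<rho>0])
  note pu = powr_has_partial_deriv[OF open_U differentiable_u[OF in_U] pos[OF in_U], where a="- c"]
  have "u x powr (- c - 1) = u x powr (- c) * inverse (u x)"
    unfolding powr_diff using pos[OF in_U] by (simp add: divide_inverse)
  then have eu: "partial_deriv i (\<lambda>y. u y powr (- c)) x = - (u x powr (- c)) * \<psi> i x"
    unfolding pu(1) by (simp add: \<psi>_def)
  have "partial_deriv i (\<lambda>y. outward_normal (conf_metric u) y $ k) x
      = partial_deriv i (\<lambda>y. u y powr (- c) * (y $ k * \<rho> y powr (-1/2))) x"
  proof (rule partial_deriv_cong)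
    show "open (U \<inter> - {0})" using open_U by auto
    show "x \<in> U \<inter> - {0}" using in_U x by auto
    fix y assume y: "y \<in> U \<inter> - {0}"
    then have "norm y > 0" by simp
    then have "\<rho> y = norm y powr 2" unfolding \<rho>n by simp
    then have "\<rho> y powr (-1/2) = norm y powr (-1)" by (simp only: powr_powr) simp
    also have "\<dots> = inverse (norm y)" using \<open>norm y > 0\<close> by (simp add: powr_neg_one divide_inverse)
    finally have "\<rho> y powr (-1/2) = inverse (norm y)" .
    moreover have "sqrt (u y powr (2 * c)) = u y powr c"
      using pos[of y] y by (subst powr_half_sqrt[symmetric]) (auto simp: powr_powr)
    ultimately show "outward_normal (conf_metric u) y $ k = u y powr (- c) * (y $ k * \<rho> y powr (-1/2))"
      using y by (simp only: outward_normal_conf_metric IntD1 powr_minus divide_inverse inverse_mult_distrib mult_ac)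
  qed
  also have "\<dots> = - (u x powr (- c)) * \<psi> i x * x $ k + u x powr (- c) * (kron i k + x $ k * - (x $ i))"
    unfolding partial_deriv_mult[OF pu(2) differentiable_mult[OF dnth e\<rho>(2)]]
      partial_deriv_mult[OF dnth e\<rho>(2)] e\<rho>(1) eu partial_deriv_nth by (simp add: \<rho>x)
  also have "\<dots> = u x powr (- c) * (kron i k - x $ i * x $ k - \<psi> i x * x $ k)"
  proof -
    have "- W * p * b + W * (K + b * - a) = W * (K - a * b - p * b)" for W p b K a :: real
      by (simp add: algebra_simps)
    then show ?thesis .
  qed
  finally show ?thesis .
qed

text \<open>The Euclidean mean curvature 1 of the sphere plus the normal derivative of
  \<open>c * ln u\<close>, rescaled by the conformal factor.\<close>

lemma mean_curvature_conf_metric: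
  "mean_curvature (conf_metric u) x = u x powr (- c) * (1 + (\<Sum>i\<in>UNIV. x $ i * \<psi> i x))"
proof -
  define s where "s = (\<Sum>i\<in>UNIV. x $ i * \<psi> i x)"
  define w where "w = u x powr (- c)"
  have normal: "outward_normal (conf_metric u) x $ j = w * x $ j" for j
  proof -
    have "sqrt (u x powr (2 * c)) = u x powr c"
      using pos[OF in_U] by (subst powr_half_sqrt[symmetric]) (auto simp: powr_powr)
    then show ?thesis
      using outward_normal_conf_metric[OF in_U, of j] x by (auto simp: w_def powr_minus divide_inverse)
  qed
  have cov: "cov_deriv (conf_metric u) i (outward_normal (conf_metric u)) x $ k
      = w * ((1 + s) * kron i k - x $ i * x $ k - \<psi> k x * x $ i)" for i k
  proof -
    have "(\<Sum>j\<in>UNIV. christoffel (conf_metric u) k i j x * outward_normal (conf_metric u) x $ j)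
        = (\<Sum>j\<in>UNIV. w * (\<psi> i x * (x $ j * kron j k)) + w * (kron i k * (x $ j * \<psi> j x)) - w * (\<psi> k x * (x $ j * kron i j)))"
      unfolding christoffel_conf_metric[OF in_U] normal flat_christoffel_def
      by (intro sum.cong refl) (simp add: algebra_simps)
    also have "\<dots> = w * (\<psi> i x * x $ k) + w * (kron i k * s) - w * (\<psi> k x * x $ i)"
      unfolding sum.distrib sum_subtractf sum_distrib_left[symmetric] sum_kron s_def[symmetric] ..
    finally show ?thesis
      unfolding cov_deriv_def by (simp add: partial_deriv_normal w_def[symmetric] algebra_simps)
  qed
  define \<phi> where "\<phi> = u x powr (2 * c)"
  have \<phi>: "\<phi> > 0" using pos[OF in_U] by (simp add: \<phi>_def)
  have b: "(\<Sum>k\<in>UNIV. conf_metric u x $ j $ k * cov_deriv (conf_metric u) i (outward_normal (conf_metric u)) x $ k)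
      = \<phi> * w * ((1 + s) * kron i j - x $ i * x $ j - \<psi> j x * x $ i)" for i j
    unfolding conf_metric_nth cov \<phi>_def[symmetric] mult.assoc sum_distrib_left[symmetric] sum_kron ..
  have diag: "(\<Sum>i\<in>UNIV. \<phi> * w * ((1 + s) * kron i i - x $ i * x $ i - \<psi> i x * x $ i))
      = \<phi> * w * ((real CARD('m) - 1) * (1 + s))"
    unfolding sum_distrib_left[symmetric] sum_subtractf sum_x
    by (simp add: s_def algebra_simps)
  \<comment> \<open>The normal-normal component vanishes, as it must for the derivative of a unit
    field, so the boundary trace is the full trace \<open>diag\<close>.\<close>
  have "(\<Sum>i\<in>UNIV. \<Sum>j\<in>UNIV. x $ i * x $ j * (\<phi> * w * ((1 + s) * kron i j - x $ i * x $ j - \<psi> j x * x $ i)))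
      = (\<Sum>i\<in>UNIV. \<Sum>j\<in>UNIV. \<phi> * w * ((1 + s) * (x $ i * (x $ j * kron i j))
          - (x $ i * x $ i) * (x $ j * x $ j) - (x $ i * x $ i) * (x $ j * \<psi> j x)))"
    by (intro sum.cong refl) (simp add: algebra_simps)
  also have "\<dots> = \<phi> * w * ((1 + s) * 1 - 1 - 1 * s)"
    unfolding sum_distrib_left[symmetric] sum_subtractf sum_kron sum_x s_def[symmetric]
    unfolding sum_distrib_right[symmetric] sum_x by simp
  finally have off: "(\<Sum>i\<in>UNIV. \<Sum>j\<in>UNIV. x $ i * x $ j * (\<phi> * w * ((1 + s) * kron i j - x $ i * x $ j - \<psi> j x * x $ i))) = 0"
    by simp
  show ?thesis
    unfolding mean_curvature_def bdry_trace_conf_metric[OF x] vec_lambda_beta b diag off \<phi>_def[symmetric]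
    using \<phi> card by (simp add: w_def s_def)
qed

lemma H_op_eq: "H_op u x = radial_deriv u x + u x / c"
proof -
  have "frechet_derivative u (at x) = (\<lambda>h. (\<chi> i. partial_deriv i u x) \<bullet> h)"
    using has_derivative_partial_deriv[OF differentiable_u[OF in_U]] by (rule frechet_derivative_at[symmetric])
  then show ?thesis
    unfolding H_op_def exponents by (simp add: radial_deriv_def inner_vec_def mult.commute)
qed

text \<open>The mean curvature is \<open>H_op u x\<close> times \<open>c / u x\<close> and a power
  of \<open>u\<close>. The tangential trace of the Schouten tensor carries twice the weight of the
  mean curvature, so all non-integral powers of \<open>u\<close> cancel against the
  prefactor.\<close>

lemma B3_formula:
  "B3 u x = H_op u x * ((1 / c + 1) * (grad_sq u x - (radial_deriv u x)\<^sup>2)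
      - u x / c * (laplacian u x - radial_hess u x) - (real CARD('m) - 1) / 2 * grad_sq u x)
      + (real CARD('m) - 1) / 3 * H_op u x ^ 3"
proof -
  define w where "w = u x powr c"
  define t where "t = u x"
  define m where "m = real CARD('m) - 1"
  have t: "t > 0" using pos[OF in_U] by (simp add: t_def)
  have w: "w > 0" using pos[OF in_U] by (simp add: w_def)
  have ws: "u x powr (3 * c) = w ^ 3" "u x powr (2 * c) = w\<^sup>2" "u x powr (- c) = 1 / w"
    using pos[OF in_U] unfolding w_def
    by (simp_all add: power2_eq_square power3_eq_cube powr_add[symmetric] powr_minus divide_inverse)
  define g L h X where "g = grad_sq u x" and "L = laplacian u x" and "h = radial_deriv u x" and "X = radial_hess u x"
  have s: "(\<Sum>i\<in>UNIV. x $ i * \<psi> i x) = c * h / t"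
    unfolding \<psi>_def h_def t_def radial_deriv_def sum_distrib_left sum_divide_distrib
    by (intro sum.cong refl) (simp add: divide_inverse mult_ac)
  have tr: "(\<Sum>i\<in>UNIV. schouten (conf_metric u) x $ i $ i) = (c + c\<^sup>2) / t\<^sup>2 * g - c / t * L - c\<^sup>2 * g / (2 * t\<^sup>2) * (m + 1)"
    unfolding schouten_conf_metric(1)[OF in_U] sum_subtractf sum_distrib_left[symmetric] laplacian_hess[symmetric]
    unfolding g_def L_def t_def m_def by (simp add: grad_sq_def power2_eq_square)
  have "(\<Sum>i\<in>UNIV. \<Sum>j\<in>UNIV. x $ i * x $ j * schouten (conf_metric u) x $ i $ j)
      = (\<Sum>i\<in>UNIV. \<Sum>j\<in>UNIV. (c + c\<^sup>2) / t\<^sup>2 * ((x $ i * partial_deriv i u x) * (x $ j * partial_deriv j u x))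
        - c / t * (hess u i j x * (x $ i * x $ j)) - c\<^sup>2 * g / (2 * t\<^sup>2) * (x $ i * (x $ j * kron i j)))"
    unfolding schouten_conf_metric(1)[OF in_U] g_def t_def
    by (intro sum.cong refl) (simp add: algebra_simps)
  also have "\<dots> = (c + c\<^sup>2) / t\<^sup>2 * (h * h) - c / t * X - c\<^sup>2 * g / (2 * t\<^sup>2) * 1"
    unfolding sum_subtractf sum_distrib_left[symmetric] sum_distrib_right[symmetric] sum_kron sum_x
    unfolding h_def X_def radial_hess_def radial_deriv_def ..
  finally have xx: "(\<Sum>i\<in>UNIV. \<Sum>j\<in>UNIV. x $ i * x $ j * schouten (conf_metric u) x $ i $ j)
      = (c + c\<^sup>2) / t\<^sup>2 * (h * h) - c / t * X - c\<^sup>2 * g / (2 * t\<^sup>2) * 1" .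
  have "B3 u x = (1 / c * t) ^ 3 * w ^ 3 * (1 / w * (1 + c * h / t) *
      (((c + c\<^sup>2) / t\<^sup>2 * g - c / t * L - c\<^sup>2 * g / (2 * t\<^sup>2) * (m + 1)
        - ((c + c\<^sup>2) / t\<^sup>2 * (h * h) - c / t * X - c\<^sup>2 * g / (2 * t\<^sup>2) * 1)) / w\<^sup>2)
      + m / 3 * (1 / w * (1 + c * h / t)) ^ 3)"
    unfolding B3_def H2_def exponents mean_curvature_conf_metric bdry_trace_conf_metric[OF x] tr xx ws s
    unfolding t_def m_def ..
  also have "\<dots> = (h + t / c) * ((1 / c + 1) * (g - h\<^sup>2) - t / c * (L - X) - m / 2 * g) + m / 3 * (h + t / c) ^ 3"
  proof -
    have H: "h + t / c = (1 / c * t) * (1 + c * h / t)"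
      using t c_pos by (simp add: field_simps)
    have T: "(1 / c + 1) * (g - h\<^sup>2) - t / c * (L - X) - m / 2 * g = (1 / c * t)\<^sup>2 *
      ((c + c\<^sup>2) / t\<^sup>2 * g - c / t * L - c\<^sup>2 * g / (2 * t\<^sup>2) * (m + 1)
        - ((c + c\<^sup>2) / t\<^sup>2 * (h * h) - c / t * X - c\<^sup>2 * g / (2 * t\<^sup>2) * 1))"
      using t c_pos by (simp add: field_simps power2_eq_square)
    have "A ^ 3 * w ^ 3 * (1 / w * K * (\<tau> / w\<^sup>2) + m / 3 * (1 / w * K) ^ 3) = A * K * (A\<^sup>2 * \<tau>) + m / 3 * (A * K) ^ 3" for A K \<tau>
      using w by (simp add: field_simps power2_eq_square power3_eq_cube)
    then show ?thesis
      unfolding T unfolding H .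
  qed
  finally show ?thesis
    unfolding H_op_eq g_def L_def h_def X_def t_def m_def .
qed

end

end

text \<open>By convention the real \<open>ln\<close> is even, so \<open>powr\<close> sees only the
  absolute value of its base. This covers points away from the ball where the sign of
  \<open>u\<close> is unknown.\<close>

lemma powr_abs: "\<bar>x\<bar> powr a = (x::real) powr a"
  by (simp add: powr_def abs_if ln_minus)

section \<open>Borel measurability of the boundary integrand\<close>

context
  fixes g :: "'m::finite metric_field"
  assumes g [measurable]: "\<And>i j. (\<lambda>x. g x $ i $ j) \<in> borel_measurable borel"
    and g_inv [measurable]: "\<And>i j. (\<lambda>x. matrix_inv (g x) $ i $ j) \<in> borel_measurable borel"
begin

lemma borel_measurable_christoffel [measurable]: "christoffel g k i j \<in> borel_measurable borel"
  unfolding christoffel_def[abs_def] by measurable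

lemma borel_measurable_ricci [measurable]: "(\<lambda>x. ricci g x $ i $ j) \<in> borel_measurable borel"
  unfolding ricci_def by simp

lemma borel_measurable_scalar_curvature [measurable]: "scalar_curvature g \<in> borel_measurable borel"
  unfolding scalar_curvature_def[abs_def] by measurable

lemma borel_measurable_schouten [measurable]: "(\<lambda>x. schouten g x $ i $ j) \<in> borel_measurable borel"
  unfolding schouten_def by simp

lemma borel_measurable_outward_normal [measurable]: "(\<lambda>x. outward_normal g x $ i) \<in> borel_measurable borel"
  unfolding outward_normal_def matrix_vector_mult_def inner_vec_def by simp

lemma borel_measurable_cov_deriv [measurable]:
  "(\<lambda>x. cov_deriv g i (outward_normal g) x $ k) \<in> borel_measurable borel"
  unfolding cov_deriv_def by simp

lemma borel_measurable_bdry_trace: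
  assumes [measurable]: "\<And>i j. (\<lambda>x. b x $ i $ j) \<in> borel_measurable borel"
  shows "(\<lambda>x. bdry_trace g x (b x)) \<in> borel_measurable borel"
  unfolding bdry_trace_def by measurable

lemma borel_measurable_mean_curvature [measurable]: "mean_curvature g \<in> borel_measurable borel"
  unfolding mean_curvature_def[abs_def]
  by (intro borel_measurable_divide borel_measurable_bdry_trace borel_measurable_const) simp

lemma borel_measurable_H2: "H2 g \<in> borel_measurable borel"
  unfolding H2_def[abs_def]
  by (intro borel_measurable_add borel_measurable_times borel_measurable_bdry_trace borel_measurable_const
      borel_measurable_power borel_measurable_mean_curvature borel_measurable_schouten)

end

text \<open>At \<open>s = 0\<close> the inverse is an unspecified but fixed matrix, so the entries
  are still given by a two-case formula in \<open>s\<close>.\<close>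

lemma borel_measurable_matrix_inv_scaled_mat:
  "(\<lambda>s::real. matrix_inv (s *\<^sub>R mat 1 :: real ^ 'm ^ 'm::finite) $ i $ j) \<in> borel_measurable borel"
proof -
  have "matrix_inv (s *\<^sub>R mat 1 :: real ^ 'm ^ 'm) $ i $ j
      = (if s = 0 then matrix_inv (0 :: real ^ 'm ^ 'm) $ i $ j else 1 / s * kron i j)" for s :: real
  proof (cases "s = 0")
    case False
    then show ?thesis unfolding matrix_inv_scaled_mat[OF False] mat_nth by simp
  qed simp
  then show ?thesis by simp
qed

text \<open>Outside the neighbourhood of the ball on which it is smooth, \<open>u\<close> is arbitrary; only the
  measurability of \<open>\<bar>u\<bar>\<close> is available there.\<close>

lemma borel_measurable_B3:
  fixes u :: "real ^ 'm::finite \<Rightarrow> real"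
  assumes u [measurable]: "(\<lambda>x. \<bar>u x\<bar>) \<in> borel_measurable borel"
  shows "(\<lambda>x. u x * B3 u x) \<in> borel_measurable borel"
proof -
  define k where "k = (real CARD('m) - 1 - 3) / 4"
  have powr [measurable]: "(\<lambda>x. u x powr a) \<in> borel_measurable borel" for a
    by (subst powr_abs[symmetric]) measurable
  have "(\<lambda>x. conf_metric u x $ i $ j) \<in> borel_measurable borel" for i j
    unfolding conf_metric_def mat_nth by measurable
  moreover have "(\<lambda>x. matrix_inv (conf_metric u x) $ i $ j) \<in> borel_measurable borel" for i j
    unfolding conf_metric_def by (rule measurable_compose[OF powr borel_measurable_matrix_inv_scaled_mat])
  ultimately have [measurable]: "H2 (conf_metric u) \<in> borel_measurable borel"
    by (rule borel_measurable_H2)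
  \<comment> \<open>The additional factor \<open>u\<close> turns the cube into an even power, and
    therefore only \<open>\<bar>u\<bar>\<close> remains.\<close>
  have eq: "u x * B3 u x = k ^ 3 * \<bar>u x\<bar> ^ 4 * u x powr (12 / (real CARD('m) - 1 - 3)) * H2 (conf_metric u) x" for x
    unfolding B3_def k_def[symmetric] by (simp add: power_mult_distrib eval_nat_numeral)
  show ?thesis unfolding eq by measurable
qed

subsection \<open>The energy identity\<close>

lemma integral_cball_eq_ball:
  fixes f :: "real ^ 'm::finite \<Rightarrow> real"
  assumes f: "continuous_on (cball 0 1) f"
  shows "(LINT x:cball 0 1|lborel. f x) = (LINT x:ball 0 1|lborel. f x)"
proof -
  have "emeasure lborel (cball 0 1 - ball 0 1 :: (real ^ 'm) set) = 0"
    by (subst emeasure_Diff) (auto simp: emeasure_cball emeasure_ball)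
  then have "cball 0 1 - ball 0 1 \<in> null_sets (lborel :: (real ^ 'm) measure)"
    by (auto simp: null_sets_def)
  then have "AE x::real ^ 'm in lborel. x \<notin> cball 0 1 - ball 0 1"
    by (rule AE_not_in)
  then have "AE x::real ^ 'm in lborel. x \<in> cball 0 1 \<longleftrightarrow> x \<in> ball 0 1"
    by eventually_elim auto
  then show ?thesis
    using set_integrable_continuous_cball[OF f] unfolding set_integrable_def
    by (intro set_integral_cong_set)
      (auto simp: set_borel_measurable_def intro: borel_measurable_integrable)
qed

text \<open>Rotation fields preserve the measure of the sphere. Here this comes from
  \<open>Gauss\<close> applied to both first derivatives, since the mixed second derivatives
  agree.\<close>

lemma (in smooth_near_ball) rotation_integral:
  "sphere_int (\<lambda>x. x $ i * partial_deriv j f x) = sphere_int (\<lambda>x. x $ j * partial_deriv i f x)"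
proof -
  have snb: "smooth_near_ball U (partial_deriv k f)" for k
    using open_U ball_U smooth by (simp add: smooth_near_ball_def smooth_on_partial_deriv)
  have "(LINT x:ball 0 1|lborel. partial_deriv i (partial_deriv j f) x) = (LINT x:ball 0 1|lborel. partial_deriv j (partial_deriv i f) x)"
    using ball_U by (intro set_lebesgue_integral_cong) (auto intro!: partial_deriv_commute[OF open_U smooth])
  then show ?thesis
    by (simp add: smooth_near_ball.Gauss[OF snb])
qed

text \<open>The integrand is the divergence, on the sphere, of the tangential part of the field
  \<open>T\<close>; the last term is due to the mean curvature of the sphere. It can be written as a
  sum of rotation derivatives of the products \<open>x $ i * T j x\<close>, each of which integrates
  to 0.\<close>

lemma tangential_divergence:
  fixes T :: "'m::finite \<Rightarrow> real ^ 'm \<Rightarrow> real"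
  assumes U: "open U" "cball 0 1 \<subseteq> U" and T: "\<And>j. smooth_on U (T j)"
  shows "sphere_int (\<lambda>x. (\<Sum>j\<in>UNIV. partial_deriv j (T j) x)
      - (\<Sum>i\<in>UNIV. \<Sum>j\<in>UNIV. x $ i * x $ j * partial_deriv i (T j) x)
      - (real CARD('m) - 1) * (\<Sum>j\<in>UNIV. x $ j * T j x)) = 0" (is "sphere_int ?D = 0")
proof -
  have xT: "smooth_near_ball U (\<lambda>x. x $ i * T j x)" for i j
    using U T by (auto simp: smooth_near_ball_def intro!: smooth_on_mult smooth_on_nth)
  have cont: "continuous_on (sphere 0 1) (\<lambda>x. x $ k * partial_deriv l (\<lambda>x. x $ i * T j x) x)" for i j k l
    by (intro continuous_intros continuous_on_subset[OF smooth_near_ball.continuous_partial[OF xT]]) auto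
  have "sphere_int ?D = sphere_int (\<lambda>x. \<Sum>i\<in>UNIV. \<Sum>j\<in>UNIV. x $ i * partial_deriv j (\<lambda>x. x $ i * T j x) x
      - x $ j * partial_deriv i (\<lambda>x. x $ i * T j x) x)"
  proof (rule sphere_int_cong)
    fix x :: "real ^ 'm" assume x: "x \<in> sphere 0 1"
    then have xU: "x \<in> U" using U by auto
    have "x \<bullet> x = 1" using x by (simp add: dot_square_norm)
    then have s: "(\<Sum>i\<in>UNIV. x $ i * x $ i) = 1" by (simp add: inner_vec_def)
    have pd: "partial_deriv k (\<lambda>x. x $ i * T j x) x = kron k i * T j x + x $ i * partial_deriv k (T j) x" for i j k
      using smooth_on_differentiable[OF U(1) T xU] smooth_on_differentiable[OF U(1) smooth_on_nth[OF U(1)] xU]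
      by (simp add: partial_deriv_mult)
    have "(\<Sum>i\<in>UNIV. \<Sum>j\<in>UNIV. x $ i * partial_deriv j (\<lambda>x. x $ i * T j x) x
      - x $ j * partial_deriv i (\<lambda>x. x $ i * T j x) x)
      = (\<Sum>i\<in>UNIV. \<Sum>j\<in>UNIV. x $ i * (kron j i * T j x) + (x $ i * x $ i) * partial_deriv j (T j) x
      - x $ j * T j x - x $ i * x $ j * partial_deriv i (T j) x)"
      unfolding pd by (intro sum.cong refl) (simp add: algebra_simps)
    also have "\<dots> = (\<Sum>i\<in>UNIV. x $ i * T i x) + (\<Sum>i\<in>UNIV. x $ i * x $ i) * (\<Sum>j\<in>UNIV. partial_deriv j (T j) x)
       - real CARD('m) * (\<Sum>j\<in>UNIV. x $ j * T j x) - (\<Sum>i\<in>UNIV. \<Sum>j\<in>UNIV. x $ i * x $ j * partial_deriv i (T j) x)"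
      unfolding sum.distrib sum_subtractf sum_distrib_left[symmetric] sum_distrib_right[symmetric] sum_kron by simp
    also have "\<dots> = ?D x" unfolding s by (simp add: algebra_simps)
    finally show "?D x = (\<Sum>i\<in>UNIV. \<Sum>j\<in>UNIV. x $ i * partial_deriv j (\<lambda>x. x $ i * T j x) x
      - x $ j * partial_deriv i (\<lambda>x. x $ i * T j x) x)" ..
  qed
  also have "\<dots> = 0"
    by (simp add: sphere_int_sum sphere_int_diff continuous_on_sum continuous_on_diff cont smooth_near_ball.rotation_integral[OF xT])
  finally show ?thesis .
qed

section \<open>The interior integrand as a divergence plus a first-order remainder\<close>

context conformal_factor
begin

lemma smooth_hess [intro]: "smooth_on U (hess u i j)"
  unfolding hess_def by (intro smooth_on_partial_deriv open_U smooth)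

lemma smooth_invariants:
  "smooth_on U (grad_sq u)" "smooth_on U (laplacian u)" "smooth_on U (radial_deriv u)" "smooth_on U (radial_hess u)"
proof -
  show "smooth_on U (grad_sq u)" unfolding grad_sq_def[abs_def]
    by (intro smooth_on_sum smooth_on_power smooth_on_partial_deriv open_U smooth)
  show "smooth_on U (laplacian u)" unfolding laplacian_hess[abs_def]
    by (intro smooth_on_sum smooth_hess open_U)
  show "smooth_on U (radial_deriv u)" unfolding radial_deriv_def[abs_def]
    by (intro smooth_on_sum smooth_on_mult smooth_on_nth smooth_on_partial_deriv open_U smooth)
  show "smooth_on U (radial_hess u)" unfolding radial_hess_def[abs_def]
    by (intro smooth_on_sum smooth_on_mult smooth_on_nth smooth_hess open_U)
qed

text \<open>The field \<Delta>u \<nabla>u - Hess(u) \<nabla>u has divergence (\<Delta>u)^2 -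
  |Hess(u)|^2, which is the leading part of \<open>L4_formula\<close>. The coefficient
  \<open>1 + c / 2\<close> of the second summand is the one that cancels
  \<open>hess_grad_grad\<close>: it has to satisfy 2k - 1 = 1 + c.\<close>

definition Z :: "'m \<Rightarrow> real ^ 'm \<Rightarrow> real" where
  "Z i x = u x ^ 2 * (1 / 2) * (laplacian u x * partial_deriv i u x - (\<Sum>j\<in>UNIV. hess u i j x * partial_deriv j u x))
     + (1 + c / 2) * (u x * (grad_sq u x * partial_deriv i u x))"

definition hess_radial_grad :: "real ^ 'm \<Rightarrow> real" where
  "hess_radial_grad x = (\<Sum>i\<in>UNIV. \<Sum>j\<in>UNIV. hess u i j x * (partial_deriv i u x * x $ j))"

lemma smooth_Z: "smooth_on U (Z i)"
  unfolding Z_def[abs_def]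
  by (intro smooth_on_add smooth_on_mult smooth_on_diff smooth_on_sum smooth_on_power smooth_on_const
      smooth_on_partial_deriv smooth_hess smooth_invariants open_U smooth)

text \<open>This is what cancels the third derivatives of \<open>u\<close> in the divergence of
  \<open>Z\<close>.\<close>

lemma third_derivative:
  assumes x: "x \<in> U"
  shows "partial_deriv i (hess u j j) x = partial_deriv j (hess u j i) x"
proof -
  have "partial_deriv j (hess u j i) x = partial_deriv j (hess u i j) x"
    using hess_symmetric by (rule partial_deriv_cong[OF open_U x])
  also have "\<dots> = partial_deriv i (hess u j j) x"
    unfolding hess_def by (rule partial_deriv_commute[OF open_U smooth_on_partial_deriv[OF open_U smooth] x])
  finally show ?thesis ..
qed

lemma divergence_Z:
  assumes x: "x \<in> U"
  shows "(\<Sum>i\<in>UNIV. partial_deriv i (Z i) x)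
    = u x * (laplacian u x * grad_sq u x - hess_grad_grad u x) + (u x)\<^sup>2 * ((laplacian u x)\<^sup>2 - hess_sq u x) / 2
      + (1 + c / 2) * ((grad_sq u x)\<^sup>2 + 2 * u x * hess_grad_grad u x + u x * grad_sq u x * laplacian u x)"
proof -
  define t where "t = u x"
  define v where "v i = partial_deriv i u x" for i
  define a where "a i j = hess u i j x" for i j
  define L g A V where "L = laplacian u x" and "g = grad_sq u x" and "A = hess_sq u x" and "V = hess_grad_grad u x"
  have sums: "L = (\<Sum>i\<in>UNIV. a i i)" "g = (\<Sum>i\<in>UNIV. v i * v i)" "A = (\<Sum>i\<in>UNIV. \<Sum>j\<in>UNIV. a i j * a i j)"
    "V = (\<Sum>i\<in>UNIV. \<Sum>j\<in>UNIV. a i j * (v i * v j))"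
    unfolding L_def g_def A_def V_def a_def v_def laplacian_hess grad_sq_def hess_sq_def hess_grad_grad_def power2_eq_square
    by (rule refl)+
  note D = smooth_on_differentiable[OF open_U _ x]
  note du = D[OF smooth] and dv = D[OF smooth_on_partial_deriv[OF open_U smooth]] and da = D[OF smooth_hess]
    and dL = D[OF smooth_invariants(2)] and dg = D[OF smooth_invariants(1)]
  have pdL: "partial_deriv i (laplacian u) x = (\<Sum>j\<in>UNIV. partial_deriv i (hess u j j) x)" for i
    unfolding laplacian_hess[abs_def] by (rule partial_deriv_sum) (rule da)
  have pdg: "partial_deriv i (grad_sq u) x = 2 * (\<Sum>j\<in>UNIV. a i j * v j)" for i
  proof -
    have "partial_deriv i (grad_sq u) x = (\<Sum>j\<in>UNIV. partial_deriv i (\<lambda>x. partial_deriv j u x * partial_deriv j u x) x)"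
      unfolding grad_sq_def[abs_def] power2_eq_square by (rule partial_deriv_sum) (rule differentiable_mult[OF dv dv])
    then show ?thesis
      unfolding partial_deriv_mult[OF dv dv] by (simp add: a_def v_def hess_def sum_distrib_left mult.commute)
  qed
  have ds: "(\<lambda>x. \<Sum>j\<in>UNIV. hess u i j x * partial_deriv j u x) differentiable (at x)" for i
    by (intro differentiable_sum finite ballI differentiable_mult da dv)
  have pds: "partial_deriv i (\<lambda>x. \<Sum>j\<in>UNIV. hess u i j x * partial_deriv j u x) x
      = (\<Sum>j\<in>UNIV. partial_deriv i (hess u i j) x * v j) + (\<Sum>j\<in>UNIV. a i j * a i j)" for i
    unfolding partial_deriv_sum[OF differentiable_mult[OF da dv]] partial_deriv_mult[OF da dv]
    by (simp add: v_def a_def hess_def sum.distrib)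
  have du2: "(\<lambda>x. u x ^ 2 * (1 / 2)) differentiable (at x)" "partial_deriv i (\<lambda>x. u x ^ 2 * (1 / 2)) x = t * v i" for i
    unfolding power2_eq_square partial_deriv_mult[OF differentiable_mult[OF du du] differentiable_const] partial_deriv_mult[OF du du]
    by (rule differentiable_mult[OF differentiable_mult[OF du du] differentiable_const]) (simp add: v_def t_def)
  have pdZ: "partial_deriv i (Z i) x =
      t * (L * (v i * v i) - (\<Sum>j\<in>UNIV. a i j * (v i * v j)))
      + t\<^sup>2 / 2 * (((\<Sum>j\<in>UNIV. partial_deriv i (hess u j j) x * v i) + L * a i i)
          - ((\<Sum>j\<in>UNIV. partial_deriv i (hess u i j) x * v j) + (\<Sum>j\<in>UNIV. a i j * a i j)))
      + (1 + c / 2) * (g * (v i * v i) + 2 * t * (\<Sum>j\<in>UNIV. a i j * (v i * v j)) + t * g * a i i)" for i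
  proof -
    have 1: "(\<lambda>x. laplacian u x * partial_deriv i u x - (\<Sum>j\<in>UNIV. hess u i j x * partial_deriv j u x)) differentiable (at x)"
      by (intro differentiable_diff differentiable_mult dL dv ds)
    have 2: "(\<lambda>x. grad_sq u x * partial_deriv i u x) differentiable (at x)"
      by (intro differentiable_mult dg dv)
    have 3: "(\<lambda>x. u x * (grad_sq u x * partial_deriv i u x)) differentiable (at x)"
      by (intro differentiable_mult du 2)
    have "partial_deriv i (Z i) x = t * v i * (L * v i - (\<Sum>j\<in>UNIV. a i j * v j))
      + t\<^sup>2 * (1 / 2) * (((\<Sum>j\<in>UNIV. partial_deriv i (hess u j j) x) * v i + L * a i i)
          - ((\<Sum>j\<in>UNIV. partial_deriv i (hess u i j) x * v j) + (\<Sum>j\<in>UNIV. a i j * a i j)))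
      + (1 + c / 2) * (v i * (g * v i) + t * (2 * (\<Sum>j\<in>UNIV. a i j * v j) * v i + g * a i i))"
      unfolding Z_def[abs_def] partial_deriv_add[OF differentiable_mult[OF du2(1) 1] differentiable_mult[OF differentiable_const 3]]
        partial_deriv_mult[OF du2(1) 1] partial_deriv_cmult[OF 3] partial_deriv_mult[OF du 2] partial_deriv_mult[OF dg dv]
        partial_deriv_diff[OF differentiable_mult[OF dL dv] ds] partial_deriv_mult[OF dL dv] du2(2) pds pdL pdg
      by (simp add: v_def a_def t_def L_def g_def hess_def)
    also have "\<dots> = t * (L * (v i * v i) - (\<Sum>j\<in>UNIV. a i j * v j) * v i)
      + t\<^sup>2 / 2 * (((\<Sum>j\<in>UNIV. partial_deriv i (hess u j j) x) * v i + L * a i i)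
          - ((\<Sum>j\<in>UNIV. partial_deriv i (hess u i j) x * v j) + (\<Sum>j\<in>UNIV. a i j * a i j)))
      + (1 + c / 2) * (g * (v i * v i) + 2 * t * ((\<Sum>j\<in>UNIV. a i j * v j) * v i) + t * g * a i i)"
      by (simp add: algebra_simps)
    also have "(\<Sum>j\<in>UNIV. a i j * v j) * v i = (\<Sum>j\<in>UNIV. a i j * (v i * v j))"
      unfolding sum_distrib_right by (intro sum.cong refl) (simp only: mult_ac)
    also have "(\<Sum>j\<in>UNIV. partial_deriv i (hess u j j) x) * v i = (\<Sum>j\<in>UNIV. partial_deriv i (hess u j j) x * v i)"
      by (rule sum_distrib_right)
    finally show ?thesis .
  qed
  have third: "(\<Sum>i\<in>UNIV. \<Sum>j\<in>UNIV. partial_deriv i (hess u j j) x * v i) = (\<Sum>i\<in>UNIV. \<Sum>j\<in>UNIV. partial_deriv i (hess u i j) x * v j)"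
  proof -
    have "(\<Sum>i\<in>UNIV. \<Sum>j\<in>UNIV. partial_deriv i (hess u j j) x * v i) = (\<Sum>i\<in>UNIV. \<Sum>j\<in>UNIV. partial_deriv j (hess u j i) x * v i)"
      by (intro sum.cong refl arg_cong2[where f="(*)"] third_derivative[OF x])
    also have "\<dots> = (\<Sum>i\<in>UNIV. \<Sum>j\<in>UNIV. partial_deriv i (hess u i j) x * v j)"
      by (rule sum.swap)
    finally show ?thesis .
  qed
  have "(\<Sum>i\<in>UNIV. partial_deriv i (Z i) x) = t * (L * g - V) + t\<^sup>2 / 2 * ((L * L) - A)
      + (1 + c / 2) * (g * g + 2 * t * V + t * g * L)"
    unfolding pdZ sum.distrib sum_subtractf sum_distrib_left[symmetric] third
    by (simp add: sums[symmetric])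
  then show ?thesis
    by (simp add: t_def L_def g_def A_def V_def power2_eq_square)
qed

end

lemma radial_deriv_le:
  fixes x :: "real ^ 'm::finite"
  shows "\<bar>radial_deriv u x\<bar> \<le> norm x * norm (gradient u x)"
proof -
  have "radial_deriv u x = x \<bullet> gradient u x"
    by (simp add: radial_deriv_def gradient_def inner_vec_def)
  then show ?thesis using Cauchy_Schwarz_ineq2[of x "gradient u x"] by simp
qed

text \<open>The divergence theorem for \<open>f\<close> times the position vector, whose normal
  component on the unit sphere is \<open>f\<close>.\<close>

lemma (in smooth_near_ball) sphere_int_eq_ball:
  "sphere_int f = real CARD('m) * (LINT x:ball 0 1|lborel. f x) + (LINT x:ball 0 1|lborel. radial_deriv f x)"
proof -
  have snb: "smooth_near_ball U (\<lambda>x. x $ i * f x)" for i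
    using open_U ball_U smooth by (auto simp: smooth_near_ball_def intro!: smooth_on_mult smooth_on_nth)
  note int = set_integrable_ball
  have rad: "continuous_on (cball 0 1) (radial_deriv f)"
    unfolding radial_deriv_def[abs_def] by (intro continuous_intros continuous_partial)
  have "sphere_int f = sphere_int (\<lambda>x. \<Sum>i\<in>UNIV. x $ i * (x $ i * f x))"
  proof (rule sphere_int_cong)
    fix x :: "real ^ 'm" assume "x \<in> sphere 0 1"
    then have "x \<bullet> x = 1" by (simp add: dot_square_norm)
    then have "(\<Sum>i\<in>UNIV. x $ i * x $ i) = 1" by (simp add: inner_vec_def)
    then show "f x = (\<Sum>i\<in>UNIV. x $ i * (x $ i * f x))"
      by (simp add: mult.assoc[symmetric] sum_distrib_right[symmetric])
  qed
  also have "\<dots> = (\<Sum>i\<in>UNIV. sphere_int (\<lambda>x. x $ i * (x $ i * f x)))"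
    by (intro sphere_int_sum continuous_intros continuous_on_subset[OF continuous_f]) auto
  also have "\<dots> = (\<Sum>i\<in>UNIV. LINT x:ball 0 1|lborel. partial_deriv i (\<lambda>x. x $ i * f x) x)"
    by (simp add: smooth_near_ball.Gauss[OF snb])
  also have "\<dots> = (LINT x:ball 0 1|lborel. (\<Sum>i\<in>UNIV. partial_deriv i (\<lambda>x. x $ i * f x) x))"
    by (intro set_lebesgue_integral_finite_sum(2)[symmetric] int smooth_near_ball.continuous_partial[OF snb])
  also have "\<dots> = (LINT x:ball 0 1|lborel. real CARD('m) * f x + radial_deriv f x)"
  proof (rule set_lebesgue_integral_cong)
    show "\<forall>x. x \<in> ball 0 1 \<longrightarrow> (\<Sum>i\<in>UNIV. partial_deriv i (\<lambda>x. x $ i * f x) x) = real CARD('m) * f x + radial_deriv f x"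
    proof (intro allI impI)
      fix x :: "real ^ 'm" assume "x \<in> ball 0 1"
      then have x: "x \<in> U" using ball_U by auto
      have "partial_deriv i (\<lambda>x. x $ i * f x) x = f x + x $ i * partial_deriv i f x" for i
        using smooth_on_differentiable[OF open_U smooth x] smooth_on_differentiable[OF open_U smooth_on_nth[OF open_U] x]
        by (simp add: partial_deriv_mult)
      then show "(\<Sum>i\<in>UNIV. partial_deriv i (\<lambda>x. x $ i * f x) x) = real CARD('m) * f x + radial_deriv f x"
        by (simp add: sum.distrib radial_deriv_def)
    qed
  qed auto
  also have "\<dots> = real CARD('m) * (LINT x:ball 0 1|lborel. f x) + (LINT x:ball 0 1|lborel. radial_deriv f x)"
    by (subst set_integral_add(2)) (auto intro!: int continuous_f rad set_integrable_mult_right)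
  finally show ?thesis .
qed

section \<open>The boundary integrand up to tangential divergences\<close>

context conformal_factor
begin

lemma sigma1_op_eq: "sigma1_op u x = - u x * laplacian u x / c - (1 + 1 / c) * grad_sq u x"
proof -
  have e: "real CARD('m) - 1 - 3 = 4 / c" "real CARD('m) - 1 + 1 = 4 + 4 / c"
    by (simp_all add: card_c)
  show ?thesis
    unfolding sigma1_op_def grad_sq_norm e using c_pos by (simp add: field_simps)
qed

lemma L4_eq_divergence:
  assumes x: "x \<in> U"
  shows "u x * L4 u x = (1 / c) * (\<Sum>i\<in>UNIV. partial_deriv i (Z i) x)
    + (sigma1_op u x * grad_sq u x + (grad_sq u x)\<^sup>2 / 2)"
  unfolding L4_formula[OF x] divergence_Z[OF x] sigma1_op_eq
  using c_pos by (simp add: field_simps power2_eq_square)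

text \<open>On the sphere \<open>radial_deriv\<close> is the normal derivative, so \<open>q\<close>
  is the squared tangential gradient and \<open>H\<close> the value of \<open>H_op\<close>.\<close>

definition bdry_density :: "real ^ 'm \<Rightarrow> real" where
  "bdry_density x = (let s = u x / c; H = radial_deriv u x + s; q = grad_sq u x - (radial_deriv u x)\<^sup>2
     in s * H * q + s\<^sup>2 * q + s * (H ^ 3 / 3 - s * H\<^sup>2 + s\<^sup>2 * H) + (c + 1) * s ^ 4)"

text \<open>On the sphere, \<open>u B\<^sub>3(u)\<close> together with the boundary terms of the bulk integral equals
  \<open>bdry_density\<close> minus the tangential divergence of the field \<open>T\<close>. The two coefficients come from
  integrating by parts the terms with second tangential derivatives of \<open>u\<close>.\<close>

definition T_coeff :: "real ^ 'm \<Rightarrow> real" where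
  "T_coeff x = (1 / (2 * c)) * (u x * u x * radial_deriv u x) + (1 / c\<^sup>2) * (u x * u x * u x)"

definition T :: "'m \<Rightarrow> real ^ 'm \<Rightarrow> real" where
  "T j x = T_coeff x * partial_deriv j u x"

lemma smooth_T_coeff: "smooth_on U T_coeff"
  unfolding T_coeff_def[abs_def]
  by (intro smooth_on_add smooth_on_mult smooth_on_const smooth_invariants open_U smooth)

lemma smooth_T: "smooth_on U (T j)"
  unfolding T_def[abs_def]
  by (intro smooth_on_mult smooth_T_coeff smooth_on_partial_deriv open_U smooth)

definition div_T :: "real ^ 'm \<Rightarrow> real" where
  "div_T x = (\<Sum>j\<in>UNIV. partial_deriv j (T j) x)
      - (\<Sum>i\<in>UNIV. \<Sum>j\<in>UNIV. x $ i * x $ j * partial_deriv i (T j) x)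
      - (real CARD('m) - 1) * (\<Sum>j\<in>UNIV. x $ j * T j x)"

lemma radial_Z:
  assumes x: "x \<in> U"
  shows "(\<Sum>i\<in>UNIV. x $ i * Z i x) = (u x)\<^sup>2 / 2 * (laplacian u x * radial_deriv u x - hess_radial_grad x)
    + (1 + c / 2) * u x * grad_sq u x * radial_deriv u x"
proof -
  have m: "(\<Sum>i\<in>UNIV. x $ i * (\<Sum>j\<in>UNIV. hess u i j x * partial_deriv j u x)) = hess_radial_grad x"
  proof -
    have "(\<Sum>i\<in>UNIV. x $ i * (\<Sum>j\<in>UNIV. hess u i j x * partial_deriv j u x))
        = (\<Sum>i\<in>UNIV. \<Sum>j\<in>UNIV. hess u j i x * (partial_deriv j u x * x $ i))"
      unfolding sum_distrib_left
      by (intro sum.cong refl, subst hess_symmetric[OF x]) (simp add: mult_ac)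
    also have "\<dots> = hess_radial_grad x"
      unfolding hess_radial_grad_def by (rule sum.swap)
    finally show ?thesis .
  qed
  have "(\<Sum>i\<in>UNIV. x $ i * Z i x) = (\<Sum>i\<in>UNIV. (u x)\<^sup>2 / 2 * (laplacian u x * (x $ i * partial_deriv i u x)
      - x $ i * (\<Sum>j\<in>UNIV. hess u i j x * partial_deriv j u x)) + (1 + c / 2) * u x * grad_sq u x * (x $ i * partial_deriv i u x))"
    unfolding Z_def by (intro sum.cong refl) (simp add: algebra_simps)
  then show ?thesis
    unfolding sum.distrib sum_distrib_left[symmetric] sum_subtractf m radial_deriv_def[symmetric] .
qed

lemma div_T_eq:
  assumes x: "x \<in> U"
  defines "t \<equiv> u x" and "g \<equiv> grad_sq u x" and "h \<equiv> radial_deriv u x" and "X \<equiv> radial_hess u x"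
    and "m \<equiv> hess_radial_grad x" and "P \<equiv> T_coeff x"
  shows "div_T x = (t * g * h / c + t\<^sup>2 / (2 * c) * (g + m) + 3 * t\<^sup>2 * g / c\<^sup>2) + P * laplacian u x
    - (t * h\<^sup>2 / c + t\<^sup>2 / (2 * c) * (h + X) + 3 * t\<^sup>2 * h / c\<^sup>2) * h - P * X - (real CARD('m) - 1) * (P * h)"
proof -
  note D = smooth_on_differentiable[OF open_U _ x]
  note du = D[OF smooth] and dv = D[OF smooth_on_partial_deriv[OF open_U smooth]]
    and dh = D[OF smooth_invariants(3)] and dP = D[OF smooth_T_coeff] and dn = D[OF smooth_on_nth[OF open_U]]
  define v where "v i = partial_deriv i u x" for i
  define k where "k i = (\<Sum>j\<in>UNIV. hess u i j x * x $ j)" for i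
  have pdh: "partial_deriv i (radial_deriv u) x = v i + k i" for i
  proof -
    have "partial_deriv i (radial_deriv u) x = (\<Sum>j\<in>UNIV. partial_deriv i (\<lambda>x. x $ j * partial_deriv j u x) x)"
      unfolding radial_deriv_def[abs_def] by (rule partial_deriv_sum) (rule differentiable_mult[OF dn dv])
    also have "\<dots> = (\<Sum>j\<in>UNIV. kron i j * v j + hess u i j x * x $ j)"
      unfolding partial_deriv_mult[OF dn dv] by (simp add: v_def hess_def mult.commute)
    finally show ?thesis unfolding sum.distrib sum_kron k_def .
  qed
  have pdP: "partial_deriv i T_coeff x = (t * h / c + t\<^sup>2 / (2 * c) + 3 * t\<^sup>2 / c\<^sup>2) * v i + t\<^sup>2 / (2 * c) * k i" for i
  proof -
    note d1 = differentiable_mult[OF differentiable_mult[OF du du] dh]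
      and d2 = differentiable_mult[OF differentiable_mult[OF du du] du]
    have "partial_deriv i T_coeff x = 1 / (2 * c) * ((v i * t + t * v i) * h + t * t * (v i + k i))
        + 1 / c\<^sup>2 * ((v i * t + t * v i) * t + t * t * v i)"
      unfolding T_coeff_def[abs_def] partial_deriv_add[OF differentiable_mult[OF differentiable_const d1] differentiable_mult[OF differentiable_const d2]]
        partial_deriv_cmult[OF d1] partial_deriv_cmult[OF d2] partial_deriv_mult[OF differentiable_mult[OF du du] dh]
        partial_deriv_mult[OF differentiable_mult[OF du du] du] partial_deriv_mult[OF du du] pdh
      by (simp only: v_def t_def h_def)
    then show ?thesis using c_pos by (simp add: field_simps power2_eq_square)
  qed
  define p where "p = t * h / c + t\<^sup>2 / (2 * c) + 3 * t\<^sup>2 / c\<^sup>2"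
  define r where "r = t\<^sup>2 / (2 * c)"
  have pdT: "partial_deriv i (T j) x = (p * v i + r * k i) * v j + P * hess u i j x" for i j
    unfolding T_def[abs_def] partial_deriv_mult[OF dP dv] pdP by (simp add: p_def r_def P_def v_def hess_def)
  have kv: "(\<Sum>i\<in>UNIV. k i * v i) = m" "(\<Sum>i\<in>UNIV. k i * x $ i) = X"
    unfolding k_def m_def X_def hess_radial_grad_def radial_hess_def v_def sum_distrib_right
    by (intro sum.cong refl; simp add: mult_ac)+
  have vv: "(\<Sum>i\<in>UNIV. v i * v i) = g" "(\<Sum>i\<in>UNIV. v i * x $ i) = h"
    unfolding g_def h_def v_def grad_sq_def radial_deriv_def by (simp_all add: power2_eq_square mult.commute)
  have 1: "(\<Sum>j\<in>UNIV. partial_deriv j (T j) x) = p * g + r * m + P * laplacian u x"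
  proof -
    have "(\<Sum>j\<in>UNIV. partial_deriv j (T j) x) = (\<Sum>j\<in>UNIV. p * (v j * v j) + r * (k j * v j) + P * hess u j j x)"
      unfolding pdT by (intro sum.cong refl) (simp add: algebra_simps)
    then show ?thesis unfolding sum.distrib sum_distrib_left[symmetric] kv vv laplacian_hess .
  qed
  have 2: "(\<Sum>i\<in>UNIV. \<Sum>j\<in>UNIV. x $ i * x $ j * partial_deriv i (T j) x) = (p * h + r * X) * h + P * X"
  proof -
    have "(\<Sum>i\<in>UNIV. \<Sum>j\<in>UNIV. x $ i * x $ j * partial_deriv i (T j) x) = (\<Sum>i\<in>UNIV. \<Sum>j\<in>UNIV.
        p * ((v i * x $ i) * (v j * x $ j)) + r * ((k i * x $ i) * (v j * x $ j)) + P * (hess u i j x * (x $ i * x $ j)))"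
      unfolding pdT by (intro sum.cong refl) (simp add: algebra_simps)
    also have "\<dots> = p * (h * h) + r * (X * h) + P * X"
      unfolding sum.distrib sum_distrib_left[symmetric] sum_distrib_right[symmetric] vv kv
      by (simp add: X_def radial_hess_def)
    finally show ?thesis by (simp add: algebra_simps)
  qed
  have 3: "(\<Sum>j\<in>UNIV. x $ j * T j x) = P * h"
  proof -
    have "(\<Sum>j\<in>UNIV. x $ j * T j x) = (\<Sum>j\<in>UNIV. P * (v j * x $ j))"
      unfolding T_def P_def v_def by (intro sum.cong refl) (simp add: mult_ac)
    then show ?thesis unfolding sum_distrib_left[symmetric] vv .
  qed
  show ?thesis
    unfolding div_T_def 1 2 3 p_def r_def by (simp add: algebra_simps power2_eq_square add_divide_distrib)
qed

text \<open>With the dimension expressed through \<open>c\<close> and \<open>u = c * s\<close>, the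
  terms in \<open>laplacian\<close>, \<open>radial_hess\<close> and \<open>hess_radial_grad\<close>
  cancel. What is left is a polynomial identity in \<open>s\<close>, the radial derivative and
  \<open>grad_sq\<close>.\<close>

lemma B3_eq_bdry_density:
  assumes x: "x \<in> sphere 0 1"
  shows "u x * B3 u x = bdry_density x - (1 / c) * (\<Sum>i\<in>UNIV. x $ i * Z i x) - div_T x"
proof -
  have xU: "x \<in> U" using x ball_U by auto
  have n: "real CARD('m) - 1 = 3 + 4 / c" by (simp add: card_c)
  define s where "s = u x / c"
  have us: "u x = c * s" using c_pos by (simp add: s_def)
  show ?thesis
    unfolding B3_formula[OF x] H_op_eq[OF x] radial_Z[OF xU] div_T_eq[OF xU] bdry_density_def Let_def T_coeff_def n us
    using c_pos by (simp add: field_simps power2_eq_square power3_eq_cube power4_eq_xxxx)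
qed

lemma continuous_on_sphere_smooth: "smooth_on U f \<Longrightarrow> continuous_on (sphere 0 1) f"
  using smooth_on_continuous_on[OF open_U, of f "sphere 0 1"] ball_U by force

lemma continuous_on_cball_smooth: "smooth_on U f \<Longrightarrow> continuous_on (cball 0 1) f"
  using smooth_on_continuous_on[OF open_U _ ball_U] .

text \<open>The flux of \<open>Z\<close> coming from the ball cancels the one in
  \<open>B3_eq_bdry_density\<close>, and the integral of \<open>div_T\<close> vanishes. The
  assumption on \<open>\<bar>u\<bar>\<close> allows the boundary term of \<open>E2\<close> to be
  rewritten as a \<open>sphere_int\<close>.\<close>

theorem energy_identity:
  assumes meas: "(\<lambda>x. \<bar>u x\<bar>) \<in> borel_measurable borel"
  shows "E2 u = (LINT x:ball 0 1|lborel. sigma1_op u x * grad_sq u x + (grad_sq u x)\<^sup>2 / 2) + sphere_int bdry_density"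
proof -
  note int = set_integrable_ball
  have snb: "smooth_near_ball U (Z i)" for i
    using open_U ball_U smooth_Z by (simp add: smooth_near_ball_def)
  have div: "continuous_on (cball 0 1) (\<lambda>x. \<Sum>i\<in>UNIV. partial_deriv i (Z i) x)"
    by (intro continuous_on_sum smooth_near_ball.continuous_partial[OF snb])
  have rest: "continuous_on (cball 0 1) (\<lambda>x. sigma1_op u x * grad_sq u x + (grad_sq u x)\<^sup>2 / 2)"
    unfolding sigma1_op_eq using c_pos
    by (intro continuous_intros continuous_on_cball_smooth smooth smooth_invariants) auto
  have "(LINT x:cball 0 1|lborel. u x * L4 u x) = (LINT x:cball 0 1|lborel. (1 / c) * (\<Sum>i\<in>UNIV. partial_deriv i (Z i) x)
    + (sigma1_op u x * grad_sq u x + (grad_sq u x)\<^sup>2 / 2))"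
    using L4_eq_divergence ball_U by (intro set_lebesgue_integral_cong) auto
  also have "\<dots> = (LINT x:ball 0 1|lborel. (1 / c) * (\<Sum>i\<in>UNIV. partial_deriv i (Z i) x)
    + (sigma1_op u x * grad_sq u x + (grad_sq u x)\<^sup>2 / 2))"
    by (intro integral_cball_eq_ball continuous_on_add continuous_on_mult continuous_on_const div rest)
  also have "\<dots> = (1 / c) * (LINT x:ball 0 1|lborel. (\<Sum>i\<in>UNIV. partial_deriv i (Z i) x))
      + (LINT x:ball 0 1|lborel. sigma1_op u x * grad_sq u x + (grad_sq u x)\<^sup>2 / 2)"
    by (subst set_integral_add(2)) (simp_all only: int div rest set_integrable_mult_right set_integral_mult_right)
  also have "(LINT x:ball 0 1|lborel. (\<Sum>i\<in>UNIV. partial_deriv i (Z i) x)) = (\<Sum>i\<in>UNIV. LINT x:ball 0 1|lborel. partial_deriv i (Z i) x)"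
    by (intro set_lebesgue_integral_finite_sum(2) int smooth_near_ball.continuous_partial[OF snb])
  also have "\<dots> = sphere_int (\<lambda>x. \<Sum>i\<in>UNIV. x $ i * Z i x)"
    unfolding smooth_near_ball.Gauss[OF snb]
    by (intro sphere_int_sum[symmetric] continuous_intros continuous_on_sphere_smooth smooth_Z)
  finally have bulk: "(LINT x:cball 0 1|lborel. u x * L4 u x) = (1 / c) * sphere_int (\<lambda>x. \<Sum>i\<in>UNIV. x $ i * Z i x)
      + (LINT x:ball 0 1|lborel. sigma1_op u x * grad_sq u x + (grad_sq u x)\<^sup>2 / 2)" .
  have cZ: "continuous_on (sphere 0 1) (\<lambda>x. (1 / c) * (\<Sum>i\<in>UNIV. x $ i * Z i x))"
    by (intro continuous_intros continuous_on_sphere_smooth smooth_Z)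
  have cT: "continuous_on (sphere 0 1) div_T"
    unfolding div_T_def[abs_def]
    by (intro continuous_intros continuous_on_sphere_smooth smooth_T smooth_on_partial_deriv open_U)
  have cd: "continuous_on (sphere 0 1) bdry_density"
    unfolding bdry_density_def[abs_def] Let_def using c_pos
    by (intro continuous_intros continuous_on_sphere_smooth smooth smooth_invariants) auto
  have "(LINT x|sphere_measure. u x * B3 u x) = sphere_int (\<lambda>x. u x * B3 u x)"
    by (rule integral_sphere_measure[OF borel_measurable_B3[OF meas]])
  also have "\<dots> = sphere_int (\<lambda>x. bdry_density x - (1 / c) * (\<Sum>i\<in>UNIV. x $ i * Z i x) - div_T x)"
    by (rule sphere_int_cong) (rule B3_eq_bdry_density)
  also have "\<dots> = sphere_int bdry_density - (1 / c) * sphere_int (\<lambda>x. \<Sum>i\<in>UNIV. x $ i * Z i x) - sphere_int div_T"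
    by (simp only: sphere_int_diff cd cZ cT continuous_on_diff sphere_int_cmult)
  also have "sphere_int div_T = 0"
    unfolding div_T_def[abs_def] by (rule tangential_divergence[OF open_U ball_U smooth_T])
  finally show ?thesis
    unfolding E2_def bulk by simp
qed

theorem energy_lower_bound:
  assumes meas: "(\<lambda>x. \<bar>u x\<bar>) \<in> borel_measurable borel"
    and sigma1: "\<And>x. x \<in> cball 0 1 \<Longrightarrow> sigma1_op u x \<ge> 0"
    and H: "\<And>x. x \<in> sphere 0 1 \<Longrightarrow> H_op u x > 0"
  shows "E2 u \<ge> 1 / 2 * (LINT x:ball 0 1|lborel. (grad_sq u x)\<^sup>2) + (c + 1) / c ^ 4 * sphere_int (\<lambda>x. u x ^ 4)"
proof -
  note int = set_integrable_ball
  have g0: "grad_sq u x \<ge> 0" for x by (simp add: grad_sq_def sum_nonneg)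
  have "(LINT x:ball 0 1|lborel. 1 / 2 * (grad_sq u x)\<^sup>2)
      \<le> (LINT x:ball 0 1|lborel. sigma1_op u x * grad_sq u x + (grad_sq u x)\<^sup>2 / 2)"
  proof (rule set_integral_mono)
    show "set_integrable lborel (ball 0 1) (\<lambda>x. 1 / 2 * (grad_sq u x)\<^sup>2)"
      by (intro int continuous_intros continuous_on_cball_smooth smooth_invariants)
    show "set_integrable lborel (ball 0 1) (\<lambda>x. sigma1_op u x * grad_sq u x + (grad_sq u x)\<^sup>2 / 2)"
      unfolding sigma1_op_eq using c_pos
      by (intro int continuous_intros continuous_on_cball_smooth smooth smooth_invariants) auto
  qed (use sigma1 g0 in auto)
  moreover have "sphere_int (\<lambda>x. (c + 1) / c ^ 4 * u x ^ 4) \<le> sphere_int bdry_density"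
  proof (rule sphere_int_mono)
    show "continuous_on (sphere 0 1) (\<lambda>x. (c + 1) / c ^ 4 * u x ^ 4)"
      by (intro continuous_intros continuous_on_sphere_smooth smooth)
    show "continuous_on (sphere 0 1) bdry_density"
      unfolding bdry_density_def[abs_def] Let_def using c_pos
      by (intro continuous_intros continuous_on_sphere_smooth smooth smooth_invariants) auto
    fix x :: "real ^ 'm" assume x: "x \<in> sphere 0 1"
    then have xU: "x \<in> U" using ball_U by auto
    define s where "s = u x / c"
    define h where "h = radial_deriv u x + s"
    define q where "q = grad_sq u x - (radial_deriv u x)\<^sup>2"
    have s: "s > 0" using pos[OF xU] c_pos by (simp add: s_def)
    have h: "h > 0" using H[OF x] unfolding H_op_eq[OF x] h_def s_def .
    have "\<bar>radial_deriv u x\<bar> \<le> norm (gradient u x)"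
      using radial_deriv_le[of u x] x by simp
    then have "(radial_deriv u x)\<^sup>2 \<le> (norm (gradient u x))\<^sup>2"
      by (metis abs_ge_zero power2_abs power_mono)
    then have q: "q \<ge> 0" unfolding q_def grad_sq_norm by simp
    \<comment> \<open>The quadratic factor has negative discriminant; completing the square makes
      its sign visible.\<close>
    have "h ^ 3 / 3 - s * h\<^sup>2 + s\<^sup>2 * h = h * ((h / 2 - s)\<^sup>2 + h\<^sup>2 / 12)"
      by (simp add: power2_eq_square power3_eq_cube algebra_simps)
    then have cubic: "h ^ 3 / 3 - s * h\<^sup>2 + s\<^sup>2 * h \<ge> 0" using h by simp
    have "bdry_density x = s * h * q + s\<^sup>2 * q + s * (h ^ 3 / 3 - s * h\<^sup>2 + s\<^sup>2 * h) + (c + 1) * s ^ 4"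
      by (simp add: bdry_density_def Let_def s_def h_def q_def)
    moreover have "s * h * q \<ge> 0" "s\<^sup>2 * q \<ge> 0" "s * (h ^ 3 / 3 - s * h\<^sup>2 + s\<^sup>2 * h) \<ge> 0"
      using s h q cubic by (auto intro!: mult_nonneg_nonneg)
    ultimately have "(c + 1) * s ^ 4 \<le> bdry_density x" by linarith
    then show "(c + 1) / c ^ 4 * u x ^ 4 \<le> bdry_density x"
      by (simp add: s_def power_divide)
  qed
  ultimately show ?thesis
    unfolding energy_identity[OF meas] sphere_int_cmult by (simp del: times_divide_eq_left)
qed

end

subsection \<open>The Sobolev trace inequality\<close>

text \<open>Young's inequality with exponents 4 and 4/3. Substituting \<open>a = \<tau> * e\<close>
  reduces it to e^4 - 4 b^3 e + 3 b^4 \<ge> 0, a polynomial with the double root b = e.\<close>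

lemma Young_three_one:
  fixes a b \<tau> :: real
  assumes "\<tau> > 0"
  shows "b ^ 3 * a \<le> a ^ 4 / (4 * \<tau> ^ 3) + 3 / 4 * \<tau> * b ^ 4"
proof -
  define e where "e = a / \<tau>"
  have a: "a = \<tau> * e" using assms by (simp add: e_def)
  have "0 \<le> (b - e)\<^sup>2 * ((e + b)\<^sup>2 + 2 * b\<^sup>2)" by simp
  then have "b ^ 3 * e \<le> e ^ 4 / 4 + 3 / 4 * b ^ 4"
    by (simp add: power2_eq_square power3_eq_cube power4_eq_xxxx algebra_simps)
  then have "\<tau> * (b ^ 3 * e) \<le> \<tau> * (e ^ 4 / 4 + 3 / 4 * b ^ 4)"
    using assms by (intro mult_left_mono) auto
  then show ?thesis
    unfolding a using assms by (simp add: field_simps power3_eq_cube power4_eq_xxxx)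
qed

text \<open>Split at \<open>z = 1 / \<tau>\<close>: beyond it the quartic term dominates, below it
  the constant does.\<close>

lemma cube_le_interpolation:
  fixes z \<tau> :: real
  assumes "\<tau> > 0" "z \<ge> 0"
  shows "z ^ 3 \<le> 1 / \<tau> ^ 3 + \<tau> * z ^ 4"
proof (cases "\<tau> * z \<ge> 1")
  case True
  then have "1 * z ^ 3 \<le> (\<tau> * z) * z ^ 3" using assms by (intro mult_right_mono) auto
  then have "z ^ 3 \<le> \<tau> * z ^ 4" by (simp add: eval_nat_numeral mult_ac)
  moreover have "1 / \<tau> ^ 3 \<ge> 0" using assms by simp
  ultimately show ?thesis by linarith
next
  case False
  then have "z \<le> 1 / \<tau>" using assms by (simp add: field_simps)
  then have "z ^ 3 \<le> (1 / \<tau>) ^ 3" using assms by (intro power_mono) auto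
  moreover have "\<tau> * z ^ 4 \<ge> 0" using assms by simp
  ultimately show ?thesis by (simp add: power_one_over)
qed

text \<open>The numbers attached to one normalised \<open>u\<close>: \<open>Y\<close>,
  \<open>M\<close>, \<open>I\<close>, \<open>W\<close> and \<open>G\<close> are the integrals over
  the ball of u^(4c+4), u^(q-1)|\<nabla>u|, u^q, u^4 and |\<nabla>u|^4, and \<open>F\<close> is the
  integral of u^4 over the sphere. Passing to real numbers makes the resulting constant visibly
  independent of \<open>u\<close>.\<close>

definition trace_data :: "real \<Rightarrow> real \<Rightarrow> real \<Rightarrow> real \<Rightarrow> real \<Rightarrow> real \<Rightarrow> real \<Rightarrow> real \<Rightarrow> bool" where
  "trace_data d q Y M I W F G \<longleftrightarrow> Y \<ge> 0 \<and> M \<ge> 0 \<and> W \<ge> 0 \<and> F \<ge> 0 \<and> G \<ge> 0 \<and>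
      Y \<le> (q * M + 1) powr (d / (d - 1)) \<and> 1 \<le> d * I + q * M \<and> W \<le> F + G \<and>
      (\<forall>\<tau>>0. M \<le> G / (4 * \<tau> ^ 3) + 3 / 4 * \<tau> * Y) \<and> (\<forall>\<tau>>0. I \<le> W / \<tau> ^ 3 + \<tau> * Y)"

text \<open>Absorption: once \<open>G \<le> 1\<close>, the Sobolev inequality bounds \<open>Y\<close> because
  \<open>3/4 \<cdot> d/(d - 1) < 1\<close>, and then the trace identity forces \<open>F + G\<close> to be bounded below.\<close>

lemma trace_absorption:
  fixes d q :: real
  assumes d: "d \<ge> 5" and q: "q \<ge> 0"
  obtains \<delta> where "\<delta> > 0" "\<And>Y M I W F G. trace_data d q Y M I W F G \<Longrightarrow> \<delta> \<le> F + G"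
proof -
  \<comment> \<open>The absorption below yields \<open>y \<le> (q + 1) powr (5 / 4)\<close> for the
    sixteenth root \<open>y\<close> of \<open>Y\<close>, whence the exponent 20.\<close>
  define Y0 where "Y0 = (q + 1) powr 20"
  have Y0: "Y0 \<ge> 1" using q by (simp add: Y0_def ge_one_powr_ge_zero)
  \<comment> \<open>Chosen so that \<open>(d + q) * (\<tau> * Y)\<close> is at most 1/2 whenever
    \<open>Y \<le> Y0\<close>, which leaves half of the unit trace to be paid for by
    \<open>F + G\<close>.\<close>
  define \<tau> where "\<tau> = 1 / ((d + q) * (2 * Y0))"
  have \<tau>: "\<tau> > 0" using d q Y0 by (simp add: \<tau>_def)
  define \<delta> where "\<delta> = min 1 (\<tau> ^ 3 / (2 * (d + q)))"
  have "\<delta> > 0" using d q \<tau> by (simp add: \<delta>_def)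
  moreover have "\<delta> \<le> F + G" if "trace_data d q Y M I W F G" for Y M I W F G
  proof -
    note data = that[unfolded trace_data_def]
    from data have nonneg: "Y \<ge> 0" "M \<ge> 0" "W \<ge> 0" "F \<ge> 0" "G \<ge> 0"
      and Sobolev: "Y \<le> (q * M + 1) powr (d / (d - 1))" and trace: "1 \<le> d * I + q * M" and W: "W \<le> F + G"
      by blast+
    from data have M: "M \<le> G / (4 * \<tau> ^ 3) + 3 / 4 * \<tau> * Y" and I: "I \<le> W / \<tau> ^ 3 + \<tau> * Y" if "\<tau> > 0" for \<tau>
      using that by blast+
    show ?thesis
    proof (cases "G \<le> 1")
      case False
      then show ?thesis using nonneg by (simp add: \<delta>_def)
    next
      case True
      have "Y \<le> Y0"
      proof (cases "Y \<le> 1")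
        case False
        \<comment> \<open>The sixteenth root keeps all exponents integral. The weight
          \<open>1 / y ^ 4\<close>, that is Y^(-1/4), gives \<open>M \<le> y ^ 12\<close>; the
          Sobolev power is at most 5/4 because \<open>d \<ge> 5\<close>, so it produces
          \<open>y ^ 15\<close>, one factor less than \<open>Y\<close>.\<close>
        define y where "y = Y powr (1 / 16)"
        have y: "y > 1" using False unfolding y_def by (simp add: gr_one_powr)
        have Yy: "Y = y ^ 16"
        proof -
          have "Y = y powr 16" using False unfolding y_def powr_powr by simp
          then show ?thesis using y by simp
        qed
        have "M \<le> G / (4 * (1 / y ^ 4) ^ 3) + 3 / 4 * (1 / y ^ 4) * Y"
          using y by (intro M) simp
        also have "\<dots> = y ^ 12 * (G / 4) + 3 / 4 * y ^ 12"
        proof -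
          have 1: "(1 / y ^ 4) ^ 3 = 1 / y ^ 12" by (simp add: power_one_over flip: power_mult)
          have 2: "3 / 4 * (1 / y ^ 4) * y ^ 16 = 3 / 4 * y ^ 12"
            using y by (simp add: field_simps flip: power_add)
          show ?thesis unfolding Yy 1 2 by simp
        qed
        also have "\<dots> \<le> y ^ 12 * (1 / 4) + 3 / 4 * y ^ 12"
          using True y by (intro add_right_mono mult_left_mono) auto
        finally have "M \<le> y ^ 12" by simp
        then have "q * M + 1 \<le> q * y ^ 12 + 1 * y ^ 12"
          using q y by (intro add_mono mult_left_mono) (auto intro: one_le_power)
        then have base: "q * M + 1 \<le> (q + 1) * y ^ 12" by (simp add: algebra_simps)
        have "Y \<le> ((q + 1) * y ^ 12) powr (d / (d - 1))"
          using base nonneg q d by (intro order_trans[OF Sobolev] powr_mono2) auto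
        also have "\<dots> \<le> ((q + 1) * y ^ 12) powr (5 / 4)"
        proof (rule powr_mono)
          show "d / (d - 1) \<le> 5 / 4" using d by (simp add: field_simps)
          have "1 * 1 \<le> (q + 1) * y ^ 12" using q y by (intro mult_mono one_le_power) auto
          then show "1 \<le> (q + 1) * y ^ 12" by simp
        qed
        also have "\<dots> = (q + 1) powr (5 / 4) * y ^ 15"
        proof -
          have "(y ^ 12) powr (5 / 4) = (y powr 12) powr (5 / 4)" using y by simp
          also have "\<dots> = y powr 15" unfolding powr_powr by simp
          also have "\<dots> = y ^ 15" using y by simp
          finally show ?thesis using q y by (simp add: powr_mult)
        qed
        finally have "y * y ^ 15 \<le> (q + 1) powr (5 / 4) * y ^ 15"
          unfolding Yy by (simp flip: power_Suc)
        then have "y \<le> (q + 1) powr (5 / 4)" using y by simp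
        then have "y ^ 16 \<le> ((q + 1) powr (5 / 4)) ^ 16" using y by (intro power_mono) auto
        also have "\<dots> = Y0"
        proof -
          have "((q + 1) powr (5 / 4)) ^ 16 = ((q + 1) powr (5 / 4)) powr 16" using q by simp
          then show ?thesis unfolding Y0_def powr_powr by simp
        qed
        finally show ?thesis unfolding Yy .
      qed (use Y0 in simp)
      moreover have "(d + q) * (\<tau> * Y) = (Y / Y0) / 2"
      proof -
        have "d + q \<noteq> 0" using d q by linarith
        then have "(d + q) * \<tau> = 1 / (2 * Y0)" by (simp add: \<tau>_def del: distrib_left distrib_right)
        then show ?thesis by (simp add: mult.assoc[symmetric])
      qed
      ultimately have \<tau>Y: "(d + q) * (\<tau> * Y) \<le> 1 / 2"
        using Y0 by simp
      have "1 \<le> d * (W / \<tau> ^ 3 + \<tau> * Y) + q * (G / (4 * \<tau> ^ 3) + 3 / 4 * \<tau> * Y)"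
        using trace mult_left_mono[OF I[OF \<tau>], of d] mult_left_mono[OF M[OF \<tau>], of q] d q by linarith
      also have "\<dots> \<le> d * ((F + G) / \<tau> ^ 3 + \<tau> * Y) + q * ((F + G) / \<tau> ^ 3 + \<tau> * Y)"
      proof (intro add_mono mult_left_mono)
        show "W / \<tau> ^ 3 \<le> (F + G) / \<tau> ^ 3" using W \<tau> by (intro divide_right_mono) auto
        have "G / (4 * \<tau> ^ 3) = (G / 4) / \<tau> ^ 3" by simp
        also have "\<dots> \<le> (F + G) / \<tau> ^ 3" using nonneg \<tau> by (intro divide_right_mono) auto
        finally show "G / (4 * \<tau> ^ 3) \<le> (F + G) / \<tau> ^ 3" .
        show "3 / 4 * \<tau> * Y \<le> \<tau> * Y" using \<tau> nonneg by simp
      qed (use d q \<tau> in auto)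
      also have "\<dots> = (d + q) * ((F + G) / \<tau> ^ 3) + (d + q) * (\<tau> * Y)"
        by (simp only: distrib_left distrib_right add_ac)
      finally have "1 / 2 \<le> (d + q) * ((F + G) / \<tau> ^ 3)" using \<tau>Y by linarith
      then have "\<tau> ^ 3 / (2 * (d + q)) \<le> F + G"
        using \<tau> d q by (simp add: field_simps)
      then show ?thesis by (simp add: \<delta>_def)
    qed
  qed
  ultimately show ?thesis by (rule that)
qed

section \<open>The trace inequality for a normalised conformal factor\<close>

context conformal_factor
begin

definition qexp :: real where "qexp = 3 * c + 4"

lemma qexp_pos: "qexp > 0"
  using c_pos by (simp add: qexp_def)

lemma gradient_powr:
  assumes x: "x \<in> U"
  shows "gradient (\<lambda>x. u x powr a) x = (a * u x powr (a - 1)) *\<^sub>R gradient u x"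
    and "radial_deriv (\<lambda>x. u x powr a) x = a * u x powr (a - 1) * radial_deriv u x"
  unfolding gradient_def radial_deriv_def powr_has_partial_deriv(1)[OF open_U differentiable_u[OF x] pos[OF x]]
  by (simp_all add: vec_eq_iff sum_distrib_left mult_ac)

text \<open>The first two identities prepare \<open>Young_three_one\<close> with
  \<open>b = u powr (c + 1)\<close>, the last two \<open>cube_le_interpolation\<close> with
  \<open>z = u powr c\<close> after the factor \<open>u ^ 4\<close> is split off.\<close>

lemma powr_exponents:
  assumes "x \<in> U"
  shows "u x powr (qexp - 1) = (u x powr (c + 1)) ^ 3" "u x powr (4 * c + 4) = (u x powr (c + 1)) ^ 4"
    "u x powr qexp = u x ^ 4 * (u x powr c) ^ 3" "u x powr (4 * c + 4) = u x ^ 4 * (u x powr c) ^ 4"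
proof -
  note u = pos[OF assms]
  have pw: "(u x powr a) ^ 3 = u x powr (3 * a)" "(u x powr a) ^ 4 = u x powr (4 * a)" for a
    using u by (simp_all add: powr_power mult.commute)
  have u4: "u x powr 4 = u x ^ 4"
    using u by simp
  show "u x powr (qexp - 1) = (u x powr (c + 1)) ^ 3" "u x powr (4 * c + 4) = (u x powr (c + 1)) ^ 4"
    unfolding pw qexp_def by (simp_all add: algebra_simps)
  show "u x powr qexp = u x ^ 4 * (u x powr c) ^ 3" "u x powr (4 * c + 4) = u x ^ 4 * (u x powr c) ^ 4"
    unfolding pw u4[symmetric] powr_add[symmetric] qexp_def by (simp_all add: algebra_simps)
qed

text \<open>The Sobolev inequality is applied to \<open>u powr qexp\<close>, whose boundary integral
  is 1 by the normalisation; this is the summand 1 in the bound for \<open>Y\<close>.\<close>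

lemma trace_lower_bound:
  assumes X: "sphere_int (\<lambda>x. u x powr qexp) = 1"
    and \<delta>: "\<And>Y M I W F G. trace_data (real CARD('m)) qexp Y M I W F G \<Longrightarrow> \<delta> \<le> F + G"
  shows "\<delta> \<le> sphere_int (\<lambda>x. u x ^ 4) + (LINT x:ball 0 1|lborel. (grad_sq u x)\<^sup>2)"
proof -
  define \<nu> where "\<nu> x = norm (gradient u x)" for x
  have \<nu>4: "(grad_sq u x)\<^sup>2 = \<nu> x ^ 4" for x
    unfolding grad_sq_norm[symmetric] \<nu>_def by (simp flip: power_mult)
  note int = set_integrable_ball
  have nonneg: "(LINT x:ball 0 1|lborel. h x) \<ge> 0" if "\<And>x. x \<in> ball 0 1 \<Longrightarrow> h x \<ge> 0" for h :: "real ^ 'm \<Rightarrow> real"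
    unfolding set_lebesgue_integral_def
    by (intro Bochner_Integration.integral_nonneg) (use that in \<open>auto simp: indicator_def\<close>)
  have inU: "x \<in> U" if "x \<in> ball 0 1" for x using that ball_U by auto
  have smp: "smooth_on U (\<lambda>x. u x powr a)" for a
    by (intro smooth_on_powr open_U smooth pos)
  have snp: "smooth_near_ball U (\<lambda>x. u x powr a)" for a
    using open_U ball_U smp by (simp add: smooth_near_ball_def)
  have cp: "continuous_on (cball 0 1) (\<lambda>x. u x powr a)" for a
    by (rule continuous_on_cball_smooth[OF smp])
  have cu: "continuous_on (cball 0 1) u" by (rule continuous_on_cball_smooth[OF smooth])
  have c\<nu>: "continuous_on (cball 0 1) \<nu>"
    unfolding \<nu>_def[abs_def] gradient_def by (intro continuous_on_norm continuous_on_vec_lambda continuous_partial)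
  have crad: "continuous_on (cball 0 1) (radial_deriv u)"
    by (rule continuous_on_cball_smooth[OF smooth_invariants(3)])
  have rad: "\<bar>radial_deriv u x\<bar> \<le> \<nu> x" if "x \<in> ball 0 1" for x
  proof -
    have "norm x * \<nu> x \<le> 1 * \<nu> x" using that by (intro mult_right_mono) (auto simp: \<nu>_def)
    then show ?thesis using radial_deriv_le[of u x] by (simp add: \<nu>_def)
  qed
  define Y M I W F G where "Y = (LINT x:ball 0 1|lborel. u x powr (4 * c + 4))"
    and "M = (LINT x:ball 0 1|lborel. u x powr (qexp - 1) * \<nu> x)"
    and "I = (LINT x:ball 0 1|lborel. u x powr qexp)"
    and "W = (LINT x:ball 0 1|lborel. u x ^ 4)"
    and "F = sphere_int (\<lambda>x. u x ^ 4)" and "G = (LINT x:ball 0 1|lborel. \<nu> x ^ 4)"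
  have "\<delta> \<le> F + G"
  proof (rule \<delta>, unfold trace_data_def, intro conjI allI impI)
    show "Y \<ge> 0" unfolding Y_def by (rule nonneg) simp
    show "M \<ge> 0" unfolding M_def by (rule nonneg) (simp add: \<nu>_def)
    show W0: "W \<ge> 0" unfolding W_def by (rule nonneg) simp
    show "G \<ge> 0" unfolding G_def by (rule nonneg) simp
    show "F \<ge> 0"
      using sphere_int_mono[of "\<lambda>_. 0" "\<lambda>x. u x ^ 4"] continuous_on_sphere_smooth[OF smooth]
      by (simp add: F_def sphere_int_def[of "\<lambda>_. 0"] continuous_on_power)
    show "Y \<le> (qexp * M + 1) powr (real CARD('m) / (real CARD('m) - 1))"
    proof -
      have "(LINT x:ball 0 1|lborel. (u x powr qexp) powr (real CARD('m) / (real CARD('m) - 1)))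
        \<le> ((LINT x:ball 0 1|lborel. norm (gradient (\<lambda>x. u x powr qexp) x)) + sphere_int (\<lambda>x. u x powr qexp))
          powr (real CARD('m) / (real CARD('m) - 1))"
        using card by (intro smooth_near_ball.Sobolev_zero_extension[OF snp]) auto
      \<comment> \<open>Criticality: with d the dimension, \<open>4 * c + 4\<close> is also the
        Sobolev exponent 4d/(d - 4) of W^(1,4) in the ball.\<close>
      moreover have "qexp * (real CARD('m) / (real CARD('m) - 1)) = 4 * c + 4"
      proof -
        have "real CARD('m) = (4 * c + 4) / c" "real CARD('m) - 1 = qexp / c"
          using c_pos by (simp_all add: card_c qexp_def field_simps)
        then show ?thesis using c_pos qexp_pos by simp
      qed
      moreover have "(LINT x:ball 0 1|lborel. norm (gradient (\<lambda>x. u x powr qexp) x))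
        = (LINT x:ball 0 1|lborel. qexp * (u x powr (qexp - 1) * \<nu> x))"
        using qexp_pos by (intro set_lebesgue_integral_cong) (auto simp: gradient_powr[OF inU] \<nu>_def abs_mult)
      ultimately show ?thesis
        by (simp add: powr_powr X Y_def M_def)
    qed
    show "1 \<le> real CARD('m) * I + qexp * M"
    proof -
      have "1 = real CARD('m) * I + (LINT x:ball 0 1|lborel. radial_deriv (\<lambda>x. u x powr qexp) x)"
        using smooth_near_ball.sphere_int_eq_ball[OF snp, of qexp] by (simp add: X I_def)
      also have "(LINT x:ball 0 1|lborel. radial_deriv (\<lambda>x. u x powr qexp) x)
        = (LINT x:ball 0 1|lborel. qexp * (u x powr (qexp - 1) * radial_deriv u x))"
        by (intro set_lebesgue_integral_cong) (auto simp: gradient_powr[OF inU])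
      also have "\<dots> \<le> (LINT x:ball 0 1|lborel. qexp * (u x powr (qexp - 1) * \<nu> x))"
      proof (rule set_integral_mono)
        show "qexp * (u x powr (qexp - 1) * radial_deriv u x) \<le> qexp * (u x powr (qexp - 1) * \<nu> x)" if "x \<in> ball 0 1" for x
          using rad[OF that] qexp_pos by (intro mult_left_mono) auto
      qed (intro int continuous_on_mult continuous_on_const cp c\<nu> crad)+
      also have "\<dots> = qexp * M" by (simp add: M_def)
      finally show ?thesis by simp
    qed
    \<comment> \<open>Apply the divergence identity to \<open>u ^ 4\<close> and bound 4 u^3
      |\<nabla>u| by 3 u^4 + |\<nabla>u|^4. The dimension is larger than 4, so at least one copy of
      \<open>W\<close> survives the subtraction of \<open>3 * W\<close>.\<close>
    show "W \<le> F + G"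
    proof -
      have sn4: "smooth_near_ball U (\<lambda>x. u x ^ 4)"
        using open_U ball_U smooth by (auto simp: smooth_near_ball_def intro!: smooth_on_power)
      have eq4: "radial_deriv (\<lambda>x. u x ^ 4) x = 4 * u x ^ 3 * radial_deriv u x" if x: "x \<in> U" for x
      proof -
        have "partial_deriv i (\<lambda>x. u x ^ 4) x = 4 * u x ^ 3 * partial_deriv i u x" for i
          by (rule partial_deriv_chain(1)[OF differentiable_u[OF x]]) (auto intro!: derivative_eq_intros)
        then show ?thesis by (simp add: radial_deriv_def sum_distrib_left mult_ac)
      qed
      have "(LINT x:ball 0 1|lborel. (- 1) * (3 * u x ^ 4 + \<nu> x ^ 4)) \<le> (LINT x:ball 0 1|lborel. 4 * u x ^ 3 * radial_deriv u x)"
      proof (rule set_integral_mono)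
        fix x :: "real ^ 'm" assume x: "x \<in> ball 0 1"
        have u: "u x > 0" using pos[OF inU[OF x]] .
        have "u x ^ 3 * \<nu> x \<le> \<nu> x ^ 4 / 4 + 3 / 4 * u x ^ 4"
          using Young_three_one[of 1 "u x" "\<nu> x"] by simp
        moreover have "u x ^ 3 * (- \<nu> x) \<le> u x ^ 3 * radial_deriv u x"
          using rad[OF x] u by (intro mult_left_mono) auto
        ultimately show "(- 1) * (3 * u x ^ 4 + \<nu> x ^ 4) \<le> 4 * u x ^ 3 * radial_deriv u x" by simp
      qed (intro int continuous_intros cu c\<nu> crad)+
      also have "\<dots> = (LINT x:ball 0 1|lborel. radial_deriv (\<lambda>x. u x ^ 4) x)"
        using eq4 inU by (intro set_lebesgue_integral_cong) auto
      also have "\<dots> = F - real CARD('m) * W"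
        using smooth_near_ball.sphere_int_eq_ball[OF sn4] by (simp add: F_def W_def)
      finally have "(- 1) * (LINT x:ball 0 1|lborel. 3 * u x ^ 4 + \<nu> x ^ 4) \<le> F - real CARD('m) * W"
        unfolding set_integral_mult_right .
      moreover have "(LINT x:ball 0 1|lborel. 3 * u x ^ 4 + \<nu> x ^ 4) = 3 * W + G"
        unfolding W_def G_def
        by (subst set_integral_add(2)) (auto intro!: int continuous_intros cu c\<nu>)
      moreover have "4 * W \<le> real CARD('m) * W" using card W0 by (intro mult_right_mono) auto
      ultimately show ?thesis by linarith
    qed
    fix \<tau> :: real assume \<tau>: "\<tau> > 0"
    show "M \<le> G / (4 * \<tau> ^ 3) + 3 / 4 * \<tau> * Y"
    proof -
      have "M \<le> (LINT x:ball 0 1|lborel. (1 / (4 * \<tau> ^ 3)) * \<nu> x ^ 4 + (3 / 4 * \<tau>) * u x powr (4 * c + 4))"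
        unfolding M_def
      proof (rule set_integral_mono)
        fix x :: "real ^ 'm" assume x: "x \<in> ball 0 1"
        show "u x powr (qexp - 1) * \<nu> x \<le> (1 / (4 * \<tau> ^ 3)) * \<nu> x ^ 4 + (3 / 4 * \<tau>) * u x powr (4 * c + 4)"
          unfolding powr_exponents(1,2)[OF inU[OF x]] using Young_three_one[OF \<tau>, of "u x powr (c + 1)" "\<nu> x"] by simp
      qed (intro int continuous_intros cp c\<nu>)+
      also have "\<dots> = (1 / (4 * \<tau> ^ 3)) * G + (3 / 4 * \<tau>) * Y"
        unfolding G_def Y_def set_integral_mult_right[symmetric]
        by (rule set_integral_add(2)) (intro int continuous_intros cp c\<nu>)+
      finally show ?thesis by simp
    qed
    show "I \<le> W / \<tau> ^ 3 + \<tau> * Y"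
    proof -
      have "I \<le> (LINT x:ball 0 1|lborel. (1 / \<tau> ^ 3) * u x ^ 4 + \<tau> * u x powr (4 * c + 4))"
        unfolding I_def
      proof (rule set_integral_mono)
        fix x :: "real ^ 'm" assume x: "x \<in> ball 0 1"
        have "u x ^ 4 * (u x powr c) ^ 3 \<le> u x ^ 4 * (1 / \<tau> ^ 3 + \<tau> * (u x powr c) ^ 4)"
          using cube_le_interpolation[OF \<tau>, of "u x powr c"] by (intro mult_left_mono) auto
        then show "u x powr qexp \<le> (1 / \<tau> ^ 3) * u x ^ 4 + \<tau> * u x powr (4 * c + 4)"
          unfolding powr_exponents(3,4)[OF inU[OF x]] by (simp add: algebra_simps)
      qed (intro int continuous_intros cp cu)+
      also have "\<dots> = (1 / \<tau> ^ 3) * W + \<tau> * Y"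
        unfolding W_def Y_def set_integral_mult_right[symmetric]
        by (rule set_integral_add(2)) (intro int continuous_intros cp cu)+
      finally show ?thesis by simp
    qed
  qed
  then show ?thesis by (simp add: F_def G_def \<nu>4)
qed

end

section \<open>Uniform lower bound on the admissible cone\<close>

lemma conformal_factor_C1:
  fixes u :: "real ^ 'm::finite \<Rightarrow> real"
  assumes u: "u \<in> C1" and card: "CARD('m) \<ge> 5"
  obtains U where "conformal_factor U u"
proof -
  obtain U where U: "open U" "cball 0 1 \<subseteq> U" "smooth_on U u"
    using u by (auto simp: C1_def smooth_ball_def)
  \<comment> \<open>The smooth extension may become nonpositive off the ball, where powers of
    \<open>u\<close> would no longer be smooth; by continuity its positivity set is still an open
    neighbourhood of the ball.\<close>
  define V where "V = {x \<in> U. u x > 0}"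
  have "continuous_on U u" using smooth_on_continuous_on[OF U(1,3)] by simp
  then have "open (U \<inter> u -` {0<..})"
    using U(1) by (rule continuous_open_preimage) simp
  also have "U \<inter> u -` {0<..} = V" by (auto simp: V_def)
  finally have "open V" .
  moreover have "smooth_on V u"
    using U(3) unfolding smooth_on_def V_def by (auto intro: differentiable_on_subset)
  moreover have "cball 0 1 \<subseteq> V" using u U(2) by (auto simp: V_def C1_def)
  ultimately have "conformal_factor V u"
    using card by unfold_locales (auto simp: V_def)
  then show ?thesis by (rule that)
qed

theorem theorem3p1:
  fixes n :: nat
  assumes "n \<ge> 4" and "CARD('m::finite) = n + 1"
  shows "Inf {ereal (E2 u) | u :: real ^ 'm \<Rightarrow> real.
            u \<in> C1 \<and> (LINT x|sphere_measure. \<bar>u x\<bar> powr (4 * real n / (real n - 3))) = 1} > 0"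
proof -
  define q where "q = 4 * real n / (real n - 3)"
  define c where "c = 4 / (real n - 3)"
  have card: "CARD('m) \<ge> 5" using assms by simp
  have c: "c > 0" using assms(1) by (simp add: c_def)
  have q: "q > 0" "q = 3 * c + 4" using assms(1) by (simp_all add: q_def c_def field_simps)
  have d: "real CARD('m) \<ge> 5" using card by simp
  \<comment> \<open>Fixed before any \<open>u\<close> is chosen: it depends only on the dimension
    and the exponent.\<close>
  obtain \<delta> where \<delta>: "\<delta> > 0"
    "\<And>Y M I W F G. trace_data (real CARD('m)) q Y M I W F G \<Longrightarrow> \<delta> \<le> F + G"
    using trace_absorption[OF d less_imp_le[OF q(1)]] by blast
  \<comment> \<open>The smaller of the two coefficients in
    \<open>energy_lower_bound\<close>.\<close>
  define \<kappa> where "\<kappa> = min (1 / 2) ((c + 1) / c ^ 4)"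
  have \<kappa>: "\<kappa> > 0" using c by (simp add: \<kappa>_def)
  have "\<kappa> * \<delta> \<le> E2 u"
    if u: "u \<in> C1" and int: "(LINT x|sphere_measure. \<bar>u x\<bar> powr q) = 1" for u :: "real ^ 'm \<Rightarrow> real"
  proof -
    obtain U where "conformal_factor U u" using conformal_factor_C1[OF u card] .
    then interpret cf: conformal_factor U u .
    have cfc: "cf.c = c" "cf.qexp = q"
      using assms(2) by (simp_all add: cf.c_def cf.qexp_def c_def q)
    \<comment> \<open>A function that is not integrable has integral 0, so the normalisation itself
      supplies integrability and with it measurability on the whole space; a root then recovers
      \<open>\<bar>u\<bar>\<close>.\<close>
    have "integrable sphere_measure (\<lambda>x. \<bar>u x\<bar> powr q)"
      using int not_integrable_integral_eq by force
    then have meas_q: "(\<lambda>x. \<bar>u x\<bar> powr q) \<in> borel_measurable borel"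
      using borel_measurable_integrable by (fastforce simp: sphere_measure_def)
    then have "(\<lambda>x. (\<bar>u x\<bar> powr q) powr (1 / q)) \<in> borel_measurable borel" by measurable
    then have meas: "(\<lambda>x. \<bar>u x\<bar>) \<in> borel_measurable borel"
      using q(1) by (simp add: powr_powr)
    have "sphere_int (\<lambda>x. \<bar>u x\<bar> powr q) = 1"
      using int unfolding integral_sphere_measure[OF meas_q] .
    then have "sphere_int (\<lambda>x. u x powr cf.qexp) = 1"
      unfolding cfc powr_abs .
    then have "\<delta> \<le> sphere_int (\<lambda>x. u x ^ 4) + (LINT x:ball 0 1|lborel. (grad_sq u x)\<^sup>2)"
      using \<delta>(2) unfolding cfc(2)[symmetric] by (rule cf.trace_lower_bound)
    then have "\<kappa> * \<delta> \<le> \<kappa> * sphere_int (\<lambda>x. u x ^ 4) + \<kappa> * (LINT x:ball 0 1|lborel. (grad_sq u x)\<^sup>2)"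
      using \<kappa> by (simp flip: distrib_left)
    also have "\<dots> \<le> (c + 1) / c ^ 4 * sphere_int (\<lambda>x. u x ^ 4) + 1 / 2 * (LINT x:ball 0 1|lborel. (grad_sq u x)\<^sup>2)"
    proof (intro add_mono mult_right_mono)
      show "0 \<le> sphere_int (\<lambda>x. u x ^ 4)"
        unfolding sphere_int_def set_lebesgue_integral_def
        by (intro mult_nonneg_nonneg Bochner_Integration.integral_nonneg) auto
      show "0 \<le> (LINT x:ball 0 1|lborel. (grad_sq u x)\<^sup>2)"
        unfolding set_lebesgue_integral_def by (intro Bochner_Integration.integral_nonneg) auto
    qed (simp_all only: \<kappa>_def min.cobounded1 min.cobounded2)
    also have "\<dots> \<le> E2 u"
      using cf.energy_lower_bound[OF meas] u unfolding cfc(1) by (auto simp: C1_def)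
    finally show ?thesis .
  qed
  then have "ereal (\<kappa> * \<delta>) \<le> Inf {ereal (E2 u) | u :: real ^ 'm \<Rightarrow> real.
            u \<in> C1 \<and> (LINT x|sphere_measure. \<bar>u x\<bar> powr q) = 1}"
    by (intro Inf_greatest) auto
  moreover have "0 < ereal (\<kappa> * \<delta>)" using \<kappa> \<delta>(1) by simp
  ultimately show ?thesis unfolding q_def by (rule less_le_trans[rotated])
qed

end
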